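(* (i) For every $0<p<\infty$ there is a constant $C\ge 1$ depending only on $p$ such that for every function $g$ on $\mathbb{R}^2$, $$C^{-1}\|g\|_{L^\infty(\mathbb{R}^2)}\le \|\pi^2_g\|_{H^p_d(\mathbb{R}\otimes\mathbb{R})\to H^p_d(\mathbb{R}\otimes\mathbb{R})}\le C\|g\|_{L^\infty(\mathbb{R}^2)}.$$ (ii) For all $0<p,q,r<\infty$ with $\frac1q=\frac1p+\frac1r$ there is a constant $C\ge 1$ depending only on $p,q,r$ such that for every function $g$ on $\mathbb{R}^2$, $$C^{-1}\|g\|_{H^r_d(\mathbb{R}\otimes\mathbb{R})}\le \|\pi^2_g\|_{H^p_d(\mathbb{R}\otimes\mathbb{R})\to H^q_d(\mathbb{R}\otimes\mathbb{R})}\le C\|g\|_{H^r_d(\mathbb{R}\otimes\mathbb{R})}.$$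
   Context: $\mathcal{D}$ is the collection of all dyadic intervals of $\mathbb{R}$. A dyadic rectangle is $R=I\times J$ with $I,J\in\mathcal{D}$. $h_I$ is the $L^2$-normalized Haar function of $I$ (supported on $I$, equal to $\pm|I|^{-1/2}$ on the two dyadic halves of $I$ with opposite signs), and $h_R(x,y)=h_I(x)h_J(y)$. For a function $f$ on $\mathbb{R}^2$, $f_R=\langle f,h_R\rangle=\int_{\mathbb{R}^2} f h_R$, and $\langle f\rangle_R=\frac{1}{|R|}\int_R f$. Standing convention: all functions $f,g$ are real-valued and simple, i.e. finite linear combinations of characteristic functions of dyadic squares; norms may take the value $+\infty$, and the constants do not depend on this a priori assumption. For $0<p<\infty$, the bi-parameter dyadic Hardy space (quasi-)norm is $\|f\|_{H^p_d(\mathbb{R}\otimes\mathbb{R})}=\|M(f)\|_{L^p(\mathbb{R}^2)}$, where $M(f)(x,y)=\sup_{R\ni(x,y)}|\langle f\rangle_R|$, the supremum being over dyadic rectangles $R$ containing $(x,y)$. The operator is $\pi^2_g(f)=\sum_{R} f_R\,\langle g\rangle_R\, h_R$, the sum being over all dyadic rectangles (it converges in $L^2(\mathbb{R}^2)$ for simple $f,g$). $\|\pi^2_g\|_{H^p_d\to H^q_d}$ is the supremum of $\|\pi^2_g(f)\|_{H^q_d(\mathbb{R}\otimes\mathbb{R})}/\|f\|_{H^p_d(\mathbb{R}\otimes\mathbb{R})}$ over $f$ with $0<\|f\|_{H^p_d(\mathbb{R}\otimes\mathbb{R})}<\infty$. *)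

theory Defs
  imports "HOL-Analysis.Analysis" "HOL-Probability.Essential_Supremum"
begin

section \<open>Dyadic intervals, rectangles and squares\<close>

text \<open>Dyadic intervals are taken half-open, so that those of a given length partition the line
  and each of them is the disjoint union of its two dyadic halves.\<close>

definition dyadic_interval :: "int \<Rightarrow> int \<Rightarrow> real set" where
  "dyadic_interval n k = {of_int k * 2 powi n ..< (of_int k + 1) * 2 powi n}"

definition dyadic_intervals :: "real set set" where
  "dyadic_intervals = {dyadic_interval n k | n k. True}"

definition dyadic_rectangles :: "(real \<times> real) set set" where
  "dyadic_rectangles = {I \<times> J | I J. I \<in> dyadic_intervals \<and> J \<in> dyadic_intervals}"

definition dyadic_squares :: "(real \<times> real) set set" where
  "dyadic_squares = {dyadic_interval n k \<times> dyadic_interval n l | n k l. True}"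

definition dyadic_simple :: "(real \<times> real \<Rightarrow> real) \<Rightarrow> bool" where
  "dyadic_simple f \<longleftrightarrow>
     (\<exists>\<S> c. finite \<S> \<and> \<S> \<subseteq> dyadic_squares \<and> f = (\<lambda>z. \<Sum>Q\<in>\<S>. c Q * indicator Q z))"

section \<open>Haar functions, coefficients and averages\<close>

text \<open>The left half carries the positive sign; as \<^term>\<open>haar I\<close> is only used below through products
  of a Haar coefficient with the corresponding Haar function, this choice is immaterial.\<close>

definition haar :: "real set \<Rightarrow> real \<Rightarrow> real" where
  "haar I x =
     (if x \<in> I then (if x < (Inf I + Sup I) / 2 then 1 else - 1) / sqrt (measure lborel I) else 0)"

definition haar2 :: "real set \<Rightarrow> real set \<Rightarrow> real \<times> real \<Rightarrow> real" where
  "haar2 I J z = haar I (fst z) * haar J (snd z)"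

definition haar_coeff :: "(real \<times> real \<Rightarrow> real) \<Rightarrow> real set \<Rightarrow> real set \<Rightarrow> real" where
  "haar_coeff f I J = (LINT z|lborel. f z * haar2 I J z)"

definition average :: "(real \<times> real \<Rightarrow> real) \<Rightarrow> (real \<times> real) set \<Rightarrow> real" where
  "average f R = (LINT z:R|lborel. f z) / measure lborel R"

section \<open>Norms\<close>

text \<open>Power of an extended nonnegative number by a positive real exponent.\<close>

definition epowr :: "ennreal \<Rightarrow> real \<Rightarrow> ennreal" where
  "epowr x a = (if x = \<infinity> then \<infinity> else ennreal (enn2real x powr a))"

definition dyadic_strong_maximal :: "(real \<times> real \<Rightarrow> real) \<Rightarrow> real \<times> real \<Rightarrow> ennreal" where
  "dyadic_strong_maximal f z = (SUP R\<in>{R \<in> dyadic_rectangles. z \<in> R}. ennreal \<bar>average f R\<bar>)"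

definition hardy_norm :: "real \<Rightarrow> (real \<times> real \<Rightarrow> real) \<Rightarrow> ennreal" where
  "hardy_norm p f = epowr (\<integral>\<^sup>+z. epowr (dyadic_strong_maximal f z) p \<partial>lborel) (1 / p)"

definition linfty_norm :: "(real \<times> real \<Rightarrow> real) \<Rightarrow> ennreal" where
  "linfty_norm g = esssup lborel (\<lambda>z. ennreal \<bar>g z\<bar>)"

definition hardy_opnorm ::
  "real \<Rightarrow> real \<Rightarrow> ((real \<times> real \<Rightarrow> real) \<Rightarrow> (real \<times> real \<Rightarrow> real)) \<Rightarrow> ennreal" where
  "hardy_opnorm p q T =
     (SUP f\<in>{f. dyadic_simple f \<and> 0 < hardy_norm p f \<and> hardy_norm p f < \<infinity>}.
        hardy_norm q (T f) / hardy_norm p f)"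

section \<open>The paraproduct\<close>

text \<open>The sum over all dyadic rectangles is the unconditional limit in \<open>L\<^sup>2\<close> of its finite partial
  sums, and \<open>pi2 g f\<close> is a representative of that limit. The representative is determined only up
  to a null set, which affects neither its averages nor its Hardy norms. Dyadic rectangles are
  indexed by their pairs of sides.\<close>

definition is_pi2 ::
  "(real \<times> real \<Rightarrow> real) \<Rightarrow> (real \<times> real \<Rightarrow> real) \<Rightarrow> (real \<times> real \<Rightarrow> real) \<Rightarrow> bool" where
  "is_pi2 g f F \<longleftrightarrow>
     F \<in> borel_measurable lborel \<and> integrable lborel (\<lambda>z. (F z)\<^sup>2) \<and>
     ((\<lambda>\<R>. LINT z|lborel.
         (F z - (\<Sum>(I, J)\<in>\<R>. haar_coeff f I J * average g (I \<times> J) * haar2 I J z))\<^sup>2)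
       \<longlongrightarrow> 0) (finite_subsets_at_top (dyadic_intervals \<times> dyadic_intervals))"

definition pi2 :: "(real \<times> real \<Rightarrow> real) \<Rightarrow> (real \<times> real \<Rightarrow> real) \<Rightarrow> (real \<times> real \<Rightarrow> real)" where
  "pi2 g f = (SOME F. is_pi2 g f F)"

end

theory Submission
  imports Defs
begin

text \<open>Both parts rest on one fact: for every exponent \<open>0 < p < \<infinity>\<close> the strong dyadic maximal function and the
  product square function \<open>S f\<close>, the square root of the sum of \<open>f\<^sub>R\<^sup>2 / |R|\<close> over the dyadic rectangles
  \<open>R\<close> around a point, have comparable norms in \<open>L\<^sup>p\<close> (\<open>square_le_maximal\<close>,
  \<open>maximal_le_square\<close>). The coefficients of the paraproduct are \<open>f\<^sub>R\<close> times the average of \<open>g\<close> over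
  \<open>R\<close>, so its square function is pointwise at most the maximal function of \<open>g\<close> times \<open>S f\<close>, and the upper bounds follow from
  Hoelder's inequality (\<open>paraproduct_upper\<close>, \<open>paraproduct_upper_bounded\<close>).

  For exponents below two the comparison is a pair of estimates between distribution functions. The square
  function is dominated by a discrete integration by parts, carried out in one variable
  after the other with the indicator of the set where the maximal function is small (\<open>truncated_energy_le\<close>).
  The maximal function is dominated by splitting the rectangles according to how
  much of them is filled by the set where the square function is large (\<open>maximal_distribution_le\<close>). Exponent two is
  orthogonality and the strong maximal theorem, which is Doob's inequality applied twice. Exponents
  above two follow by duality, with random signs for the square function.

  For the lower bound in the supremum norm a single Haar function suffices. For the lower bound in the Hardy norm, the
  rectangles on which the average of \<open>g\<close> exceeds \<open>2\<^sup>k\<close> are thinned out, for each \<open>k\<close>, to a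
  family in which each has a share of at least half of itself and the shares are disjoint, and whose union is still comparable to the set where
  the maximal function of \<open>g\<close> exceeds \<open>2\<^sup>k\<close>. With coefficients depending only on \<open>k\<close>, these
  rectangles form a function with \<open>(S f)\<^sup>p\<close> of the size of the \<open>r\<close>-th power of the maximal function, while
  the \<open>q\<close>-th power of the square function of the paraproduct is at least of that size
  (\<open>paraproduct_lower\<close>).

  A simple function is constant on the cells of a fine lattice, and then all its averages are averages of
  finitely many samples. The analysis is therefore done for functions on the integer lattice with
  levels up to \<open>N\<close>, with constants that do not depend on \<open>N\<close>, and returns to the plane by letting \<open>N\<close> grow (\<open>hardy_norm_eq_SUP\<close>). The
  paraproduct, a limit in \<open>L\<^sup>2\<close> of infinitely many terms because rectangles may be
  arbitrarily large, enters through its averages only, which are limits of the discrete ones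
  (\<open>average_pi2_lim\<close>).\<close>

section \<open>Inequalities for finite sums\<close>

lemma Young_weighted:
  fixes a b :: real
  assumes "0 < \<alpha>" "0 < \<beta>" "\<alpha> + \<beta> = 1" "0 \<le> a" "0 \<le> b"
  shows "a powr \<alpha> * b powr \<beta> \<le> \<alpha> * a + \<beta> * b"
  using Youngs_inequality_0[of \<alpha> \<beta> a b] assms by (cases "a = 0 \<or> b = 0") auto

lemma Hoelder_sum:
  fixes a b :: "'a \<Rightarrow> real"
  assumes ab: "0 < \<alpha>" "0 < \<beta>" "\<alpha> + \<beta> = 1"
    and nn: "\<And>z. z \<in> Z \<Longrightarrow> 0 \<le> a z" "\<And>z. z \<in> Z \<Longrightarrow> 0 \<le> b z"
  shows "(\<Sum>z\<in>Z. a z powr \<alpha> * b z powr \<beta>) \<le> (\<Sum>z\<in>Z. a z) powr \<alpha> * (\<Sum>z\<in>Z. b z) powr \<beta>"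
proof (cases "finite Z")
  case fin: True
  define A where "A = (\<Sum>z\<in>Z. a z)"
  define B where "B = (\<Sum>z\<in>Z. b z)"
  have A0: "0 \<le> A" and B0: "0 \<le> B" unfolding A_def B_def by (auto intro: sum_nonneg nn)
  show ?thesis
  proof (cases "A = 0 \<or> B = 0")
    case True
    then have "a z powr \<alpha> * b z powr \<beta> = 0" if "z \<in> Z" for z
      using that fin nn by (auto simp: A_def B_def sum_nonneg_eq_0_iff)
    then have "(\<Sum>z\<in>Z. a z powr \<alpha> * b z powr \<beta>) = 0" by (intro sum.neutral) blast
    then show ?thesis by simp
  next
    case False
    then have pos: "0 < A" "0 < B" using A0 B0 by auto
    have "a z powr \<alpha> * b z powr \<beta> \<le> A powr \<alpha> * B powr \<beta> * (\<alpha> * (a z / A) + \<beta> * (b z / B))"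
      if "z \<in> Z" for z
    proof -
      have "a z powr \<alpha> * b z powr \<beta> = A powr \<alpha> * B powr \<beta> * ((a z / A) powr \<alpha> * (b z / B) powr \<beta>)"
        using pos nn[OF that] by (simp add: powr_divide)
      also have "\<dots> \<le> A powr \<alpha> * B powr \<beta> * (\<alpha> * (a z / A) + \<beta> * (b z / B))"
        using pos nn[OF that] ab by (intro mult_left_mono Young_weighted) auto
      finally show ?thesis .
    qed
    then have "(\<Sum>z\<in>Z. a z powr \<alpha> * b z powr \<beta>) \<le>
      (\<Sum>z\<in>Z. A powr \<alpha> * B powr \<beta> * (\<alpha> * (a z / A) + \<beta> * (b z / B)))"
      by (intro sum_mono)
    also have "\<dots> = A powr \<alpha> * B powr \<beta> * (\<alpha> * (A / A) + \<beta> * (B / B))"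
      unfolding sum_distrib_left[symmetric] sum.distrib sum_divide_distrib[symmetric]
        A_def[symmetric] B_def[symmetric] by simp
    also have "\<dots> = A powr \<alpha> * B powr \<beta>" using pos ab by simp
    finally show ?thesis by (simp add: A_def B_def)
  qed
qed simp

lemma Hoelder_sum_conjugate:
  fixes a b :: "'a \<Rightarrow> real"
  assumes s: "1 < s"
    and nn: "\<And>z. z \<in> Z \<Longrightarrow> 0 \<le> a z" "\<And>z. z \<in> Z \<Longrightarrow> 0 \<le> b z"
  shows "(\<Sum>z\<in>Z. a z * b z) \<le>
    (\<Sum>z\<in>Z. a z powr s) powr (1 / s) * (\<Sum>z\<in>Z. b z powr (s / (s - 1))) powr (1 - 1 / s)"
proof -
  have e: "s / (s - 1) * (1 - 1 / s) = 1" using s by (simp add: field_simps)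
  have "(\<Sum>z\<in>Z. a z * b z) =
    (\<Sum>z\<in>Z. (a z powr s) powr (1 / s) * (b z powr (s / (s - 1))) powr (1 - 1 / s))"
    using s nn by (intro sum.cong refl) (simp add: powr_powr e del: times_divide_eq_left)
  also have "\<dots> \<le> (\<Sum>z\<in>Z. a z powr s) powr (1 / s) * (\<Sum>z\<in>Z. b z powr (s / (s - 1))) powr (1 - 1 / s)"
    using s by (intro Hoelder_sum) auto
  finally show ?thesis .
qed

text \<open>Duality arguments end in a bound of \<open>X\<close> by a power of itself with exponent below one. Finite sums
  cannot be infinite, so this power may be divided out.\<close>

lemma powr_absorb:
  fixes X Y C :: real
  assumes \<alpha>: "\<alpha> < 1" and nn: "0 \<le> X" "0 \<le> Y" and le: "X \<le> Y * X powr \<alpha>"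
  shows "X powr (1 - \<alpha>) \<le> Y"
proof (cases "X = 0")
  case False
  then have "0 < X" using nn by simp
  then have "X powr (1 - \<alpha>) * X powr \<alpha> \<le> Y * X powr \<alpha>" using le by (simp add: powr_add[symmetric])
  then show ?thesis using \<open>0 < X\<close> by simp
qed (use nn in auto)

lemma sum_powr_mean_le:
  fixes x :: "'a \<Rightarrow> real"
  assumes s: "1 \<le> s" and fin: "finite S" "S \<noteq> {}" and nn: "\<And>i. i \<in> S \<Longrightarrow> 0 \<le> x i"
  shows "((\<Sum>i\<in>S. x i) / card S) powr s \<le> (\<Sum>i\<in>S. x i powr s) / card S"
proof (cases "s = 1")
  case True
  then show ?thesis using nn by (simp add: sum_nonneg)
next
  case False
  then have s1: "1 < s" using s by simp
  define n where "n = real (card S)"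
  have n: "0 < n" using fin by (simp add: n_def card_gt_0_iff)
  have "(\<Sum>i\<in>S. x i) \<le> (\<Sum>i\<in>S. x i powr s) powr (1 / s) * n powr (1 - 1 / s)"
    using Hoelder_sum_conjugate[OF s1, of S x "\<lambda>_. 1"] nn by (simp add: n_def)
  then have "(\<Sum>i\<in>S. x i) powr s \<le> ((\<Sum>i\<in>S. x i powr s) powr (1 / s) * n powr (1 - 1 / s)) powr s"
    using s1 nn by (intro powr_mono2) (auto intro: sum_nonneg)
  also have "\<dots> = (\<Sum>i\<in>S. x i powr s) * n powr (s - 1)"
    using s1 n by (simp add: powr_mult powr_powr sum_nonneg algebra_simps)
  finally have "(\<Sum>i\<in>S. x i) powr s / n powr s \<le> (\<Sum>i\<in>S. x i powr s) * n powr (s - 1) / n powr s"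
    using n by (intro divide_right_mono) auto
  also have "\<dots> = (\<Sum>i\<in>S. x i powr s) / n" using n by (simp add: powr_diff)
  finally show ?thesis using nn n by (simp add: powr_divide sum_nonneg n_def)
qed

section \<open>Dyadic layer-cake sums\<close>

lemma two_powr_minus_less_1: "0 < p \<Longrightarrow> (2::real) powr - p < 1"
  using powr_less_cancel_iff[of 2 "- p" 0] by simp

lemma geometric_below_le:
  fixes \<theta> :: real
  assumes \<theta>: "0 \<le> \<theta>" "\<theta> < 1" and K: "finite K" "\<And>k. k \<in> K \<Longrightarrow> k \<le> (k0::int)"
  shows "(\<Sum>k\<in>K. \<theta> ^ nat (k0 - k)) \<le> 1 / (1 - \<theta>)"
proof -
  have inj: "inj_on (\<lambda>k. nat (k0 - k)) K" by (intro inj_onI) (smt (verit) K(2) eq_nat_nat_iff)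
  have "(\<Sum>k\<in>K. \<theta> ^ nat (k0 - k)) = (\<Sum>j\<in>(\<lambda>k. nat (k0 - k)) ` K. \<theta> ^ j)"
    by (subst sum.reindex[OF inj]) simp
  also have "\<dots> \<le> (\<Sum>j. \<theta> ^ j)"
    using \<theta> K by (intro sum_le_suminf) (auto intro: summable_geometric)
  also have "\<dots> = 1 / (1 - \<theta>)" using \<theta> by (intro suminf_geometric) auto
  finally show ?thesis .
qed

lemma geometric_above_le:
  fixes \<theta> :: real
  assumes \<theta>: "0 \<le> \<theta>" "\<theta> < 1" and K: "finite K" "\<And>k. k \<in> K \<Longrightarrow> (k0::int) \<le> k"
  shows "(\<Sum>k\<in>K. \<theta> ^ nat (k - k0)) \<le> 1 / (1 - \<theta>)"
proof -
  have "(\<Sum>k\<in>K. \<theta> ^ nat (k - k0)) = (\<Sum>k\<in>uminus ` K. \<theta> ^ nat (- k0 - k))"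
    by (subst sum.reindex) (auto intro!: inj_onI)
  also have "\<dots> \<le> 1 / (1 - \<theta>)" using K \<theta> by (intro geometric_below_le) auto
  finally show ?thesis .
qed

text \<open>Strict below and weak above, so that every positive \<open>b\<close> lies in exactly one of the intervals
  from \<open>2\<^sup>k\<close> to \<open>2\<^bsup>k+1\<^esup>\<close>.\<close>

definition dyscale :: "real \<Rightarrow> int" where
  "dyscale b = \<lceil>log 2 b\<rceil> - 1"

lemma dyscale:
  assumes "0 < b"
  shows "2 powr dyscale b < b" "b \<le> 2 powr (dyscale b + 1)"
proof -
  have "real_of_int (dyscale b) < log 2 b" unfolding dyscale_def by linarith
  then show "2 powr dyscale b < b" using assms by (simp add: less_log_iff)
  have "log 2 b \<le> real_of_int (dyscale b + 1)" unfolding dyscale_def by linarith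
  then show "b \<le> 2 powr (dyscale b + 1)" using assms by (simp add: log_le_iff)
qed

lemma dyscale_le: "0 < b \<Longrightarrow> 2 powr (real_of_int k) < b \<Longrightarrow> k \<le> dyscale b"
proof -
  assume a: "0 < b" "2 powr (real_of_int k) < b"
  have "2 powr (real_of_int k) < 2 powr (dyscale b + 1)" using a dyscale(2)[of b] by linarith
  then show ?thesis by (simp del: of_int_add)
qed

text \<open>A geometric sum is dominated by its last term. This is what makes the supremum, the sum and every
  \<open>\<ell>\<^sup>p\<close> norm over the dyadic levels of a function comparable.\<close>

lemma dyadic_powr_sum_le:
  fixes p b :: real
  assumes p: "0 < p" and K: "finite (K :: int set)" and b: "0 \<le> b"
    and lt: "\<And>k. k \<in> K \<Longrightarrow> 2 powr k < b"
  shows "(\<Sum>k\<in>K. 2 powr (k * p)) \<le> 1 / (1 - 2 powr (- p)) * b powr p"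
proof (cases "K = {}")
  case False
  then obtain k where "k \<in> K" by auto
  then have b0: "0 < b" using lt[of k] by (smt (verit) powr_gt_zero)
  define k0 where "k0 = dyscale b"
  have le: "k \<le> k0" if "k \<in> K" for k using dyscale_le[OF b0 lt[OF that]] by (simp add: k0_def)
  have "2 powr (k * p) = 2 powr (k0 * p) * (2 powr (- p)) ^ nat (k0 - k)" if "k \<in> K" for k
  proof -
    have "(2 powr (- p)) ^ nat (k0 - k) = (2::real) powr (- p * (k0 - k))"
      using le[OF that] by (simp add: powr_powr powr_realpow[symmetric])
    then show ?thesis by (simp add: powr_add[symmetric] algebra_simps)
  qed
  then have "(\<Sum>k\<in>K. 2 powr (k * p)) = 2 powr (k0 * p) * (\<Sum>k\<in>K. (2 powr (- p)) ^ nat (k0 - k))"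
    by (simp add: sum_distrib_left)
  also have "\<dots> \<le> b powr p * (1 / (1 - 2 powr (- p)))"
  proof (intro mult_mono)
    have "2 powr (k0 * p) = (2 powr k0) powr p" by (simp add: powr_powr)
    also have "\<dots> \<le> b powr p" using dyscale[OF b0] p by (intro powr_mono2) (auto simp: k0_def)
    finally show "2 powr (k0 * p) \<le> b powr p" .
    show "(\<Sum>k\<in>K. (2 powr (- p)) ^ nat (k0 - k)) \<le> 1 / (1 - 2 powr (- p))"
      using K le p by (intro geometric_below_le) (use p in \<open>auto simp: two_powr_minus_less_1\<close>)
  qed (auto intro: sum_nonneg)
  finally show ?thesis by (simp add: mult.commute)
qed (use two_powr_minus_less_1[OF p] in simp)

definition layer_const :: "real \<Rightarrow> real" where
  "layer_const p = 2 powr p * (1 / (1 - 2 powr (- p)) + 2 powr (2 - p) / (1 - 2 powr (- (2 - p))))"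

lemma layer_const_pos: "0 < p \<Longrightarrow> p < 2 \<Longrightarrow> 0 < layer_const p"
  unfolding layer_const_def
  using two_powr_minus_less_1[of p] two_powr_minus_less_1[of "2 - p"]
  by (intro mult_pos_pos add_pos_pos divide_pos_pos) auto

lemma dyadic_min_sum_le:
  fixes p b :: real
  assumes p: "0 < p" "p < 2" and K: "finite (K :: int set)" and b: "0 \<le> b"
  shows "2 powr p * (\<Sum>k\<in>K. 2 powr (k * p) * min 1 ((b / 2 powr k)\<^sup>2)) \<le> layer_const p * b powr p"
proof (cases "b = 0")
  case False
  then have b0: "0 < b" using b by simp
  define k0 where "k0 = dyscale b"
  define L where "L = {k\<in>K. 2 powr k < b}"
  define U where "U = {k\<in>K. \<not> 2 powr k < b}"
  have split: "K = L \<union> U" "L \<inter> U = {}" "finite L" "finite U" using K by (auto simp: L_def U_def)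
  have "(\<Sum>k\<in>L. 2 powr (k * p) * min 1 ((b / 2 powr k)\<^sup>2)) \<le> (\<Sum>k\<in>L. 2 powr (k * p))"
    by (intro sum_mono) (auto simp: mult_left_le)
  also have "\<dots> \<le> 1 / (1 - 2 powr (- p)) * b powr p"
    using p split b by (intro dyadic_powr_sum_le) (auto simp: L_def)
  finally have 1: "(\<Sum>k\<in>L. 2 powr (k * p) * min 1 ((b / 2 powr k)\<^sup>2)) \<le> 1 / (1 - 2 powr (- p)) * b powr p" .
  have Uk: "k0 \<le> k" if "k \<in> U" for k
  proof -
    have "b \<le> 2 powr k" using that unfolding U_def by (simp only: mem_Collect_eq not_less)
    with dyscale(1)[OF b0] have "2 powr k0 < 2 powr k" unfolding k0_def by linarith
    then have "k0 < k" by (subst (asm) powr_less_cancel_iff) auto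
    then show ?thesis by simp
  qed
  have "2 powr (k * p) * min 1 ((b / 2 powr k)\<^sup>2) \<le>
      2 powr (2 - p) * b powr p * (2 powr (- (2 - p))) ^ nat (k - k0)" if "k \<in> U" for k
  proof -
    define B where "B = b / 2 powr k"
    have B0: "0 < B" using b0 by (simp add: B_def)
    have bB: "b = 2 powr k * B" by (simp add: B_def)
    have e: "(2 powr (- (2 - p))) ^ nat (k - k0) = (2::real) powr (- (2 - p) * (k - k0))"
      using Uk[OF that] by (simp add: powr_powr powr_realpow[symmetric])
    have "B \<le> 2 powr (k0 + 1) / 2 powr k"
      unfolding B_def using dyscale(2)[OF b0] by (intro divide_right_mono) (auto simp: k0_def)
    also have "\<dots> = 2 powr (k0 + 1 - k)" by (simp add: powr_diff)
    finally have Ble: "B \<le> 2 powr (k0 + 1 - k)" .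
    have "2 powr (k * p) * min 1 (B\<^sup>2) \<le> 2 powr (k * p) * B powr 2"
      using B0 by (intro mult_left_mono) (auto simp: powr_numeral)
    also have "\<dots> = 2 powr (k * p) * (B powr p * B powr (2 - p))"
      unfolding powr_add[symmetric] by simp
    also have "\<dots> = b powr p * B powr (2 - p)"
      unfolding bB using B0 by (simp add: powr_mult powr_powr)
    also have "\<dots> \<le> b powr p * (2 powr (k0 + 1 - k)) powr (2 - p)"
      using Ble B0 p by (intro mult_left_mono powr_mono2) auto
    also have "(2 powr (k0 + 1 - k)) powr (2 - p) = 2 powr (2 - p) * (2 powr (- (2 - p) * (k - k0)) :: real)"
      unfolding powr_powr powr_add[symmetric] by (intro arg_cong[of _ _ "\<lambda>x. 2 powr x"]) (simp add: algebra_simps)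
    also have "b powr p * \<dots> = 2 powr (2 - p) * b powr p * (2 powr (- (2 - p))) ^ nat (k - k0)"
      unfolding e by (simp only: mult_ac)
    finally show ?thesis unfolding B_def .
  qed
  then have "(\<Sum>k\<in>U. 2 powr (k * p) * min 1 ((b / 2 powr k)\<^sup>2)) \<le>
    2 powr (2 - p) * b powr p * (\<Sum>k\<in>U. (2 powr (- (2 - p))) ^ nat (k - k0))"
    by (subst sum_distrib_left) (intro sum_mono)
  also have "\<dots> \<le> 2 powr (2 - p) * b powr p * (1 / (1 - 2 powr (- (2 - p))))"
    using two_powr_minus_less_1[of "2 - p"] p(2) split(4) Uk
    by (intro mult_left_mono geometric_above_le) auto
  finally have 2: "(\<Sum>k\<in>U. 2 powr (k * p) * min 1 ((b / 2 powr k)\<^sup>2)) \<le> \<dots>" .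
  have "(\<Sum>k\<in>K. 2 powr (k * p) * min 1 ((b / 2 powr k)\<^sup>2)) \<le>
     1 / (1 - 2 powr (- p)) * b powr p + 2 powr (2 - p) * b powr p * (1 / (1 - 2 powr (- (2 - p))))"
    using 1 2 unfolding sum.union_disjoint[OF split(3,4,2)] split(1) by linarith
  then have "2 powr p * (\<Sum>k\<in>K. 2 powr (k * p) * min 1 ((b / 2 powr k)\<^sup>2)) \<le> 2 powr p *
     (1 / (1 - 2 powr (- p)) * b powr p + 2 powr (2 - p) * b powr p * (1 / (1 - 2 powr (- (2 - p)))))"
    by (intro mult_left_mono) auto
  also have "\<dots> = layer_const p * b powr p"
    unfolding layer_const_def by (simp only: distrib_left distrib_right mult_ac times_divide_eq_right mult_1_right)
  finally show ?thesis .
qed auto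

lemma powr_le_dyadic_layers:
  fixes p :: real and a :: "'a \<Rightarrow> real"
  assumes p: "0 < p" and fin: "finite Z" and nn: "\<And>z. z \<in> Z \<Longrightarrow> 0 \<le> a z"
  shows "\<exists>K :: int set. finite K \<and>
    (\<forall>z\<in>Z. a z powr p \<le> 2 powr p * (\<Sum>k\<in>K. 2 powr (k * p) * of_bool (2 powr k < a z)))"
proof (intro exI conjI ballI)
  let ?K = "(\<lambda>z. dyscale (a z)) ` Z"
  show "finite ?K" using fin by simp
  fix z assume z: "z \<in> Z"
  show "a z powr p \<le> 2 powr p * (\<Sum>k\<in>?K. 2 powr (k * p) * of_bool (2 powr k < a z))"
  proof (cases "a z = 0")
    case False
    then have az: "0 < a z" using nn[OF z] by simp
    define k where "k = dyscale (a z)"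
    have "a z powr p \<le> (2 powr (k + 1)) powr p"
      using dyscale(2)[OF az] az p by (intro powr_mono2) (auto simp: k_def)
    also have "\<dots> = 2 powr p * (2 powr (k * p) * of_bool (2 powr k < a z))"
    proof -
      have "of_bool (2 powr k < a z) = (1::real)" using dyscale(1)[OF az] unfolding k_def by simp
      then show ?thesis
        unfolding powr_powr powr_add[symmetric] mult_1_right by (simp only: powr_add[symmetric] mult_1_right)
          (simp add: distrib_right add.commute)
    qed
    also have "\<dots> \<le> 2 powr p * (\<Sum>k\<in>?K. 2 powr (k * p) * of_bool (2 powr k < a z))"
      using z fin by (intro mult_left_mono member_le_sum) (auto simp: k_def)
    finally show ?thesis .
  qed (auto intro!: mult_nonneg_nonneg sum_nonneg)
qed

text \<open>The hypothesis splits each level into the part where \<open>b\<close> exceeds the level and a weak type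
  estimate of order two for the rest. Summed over dyadic levels, both parts are geometric series at the
  size of \<open>b\<close>; the second one converges because the exponent is below two.\<close>

lemma sum_powr_le_of_distribution:
  fixes p :: real and a b :: "'a \<Rightarrow> real"
  assumes p: "0 < p" "p < 2" and fin: "finite Z" and C: "0 \<le> C"
    and nn: "\<And>z. z \<in> Z \<Longrightarrow> 0 \<le> a z" "\<And>z. z \<in> Z \<Longrightarrow> 0 \<le> b z"
    and distr: "\<And>l. 0 < l \<Longrightarrow> card {z\<in>Z. l < a z} \<le> C * (\<Sum>z\<in>Z. min 1 ((b z / l)\<^sup>2))"
  shows "(\<Sum>z\<in>Z. a z powr p) \<le> C * layer_const p * (\<Sum>z\<in>Z. b z powr p)"
proof -
  obtain K :: "int set" where K: "finite K"
    "\<And>z. z \<in> Z \<Longrightarrow> a z powr p \<le> 2 powr p * (\<Sum>k\<in>K. 2 powr (k * p) * of_bool (2 powr k < a z))"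
    using powr_le_dyadic_layers[of p Z a, OF p(1) fin nn(1)] by metis
  have "(\<Sum>z\<in>Z. a z powr p) \<le> (\<Sum>z\<in>Z. 2 powr p * (\<Sum>k\<in>K. 2 powr (k * p) * of_bool (2 powr k < a z)))"
    by (intro sum_mono K)
  also have "\<dots> = 2 powr p * (\<Sum>k\<in>K. \<Sum>z\<in>Z. 2 powr (k * p) * of_bool (2 powr k < a z))"
    unfolding sum_distrib_left by (rule sum.swap)
  also have "\<dots> = 2 powr p * (\<Sum>k\<in>K. 2 powr (k * p) * (\<Sum>z\<in>Z. of_bool (2 powr k < a z)))"
    by (simp only: sum_distrib_left)
  also have "\<dots> = 2 powr p * (\<Sum>k\<in>K. 2 powr (k * p) * card {z\<in>Z. 2 powr k < a z})"
    using fin by (simp add: of_bool_def sum.If_cases Int_def)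
  also have "\<dots> \<le> 2 powr p * (\<Sum>k\<in>K. 2 powr (k * p) * (C * (\<Sum>z\<in>Z. min 1 ((b z / 2 powr k)\<^sup>2))))"
    by (intro mult_left_mono sum_mono distr) auto
  also have "\<dots> = C * (2 powr p * (\<Sum>k\<in>K. \<Sum>z\<in>Z. 2 powr (k * p) * min 1 ((b z / 2 powr k)\<^sup>2)))"
    by (simp only: sum_distrib_left mult_ac)
  also have "\<dots> = C * (\<Sum>z\<in>Z. 2 powr p * (\<Sum>k\<in>K. 2 powr (k * p) * min 1 ((b z / 2 powr k)\<^sup>2)))"
    unfolding sum_distrib_left by (rule sum.swap)
  also have "\<dots> \<le> C * (\<Sum>z\<in>Z. layer_const p * b z powr p)"
    using C p K nn by (intro mult_left_mono sum_mono dyadic_min_sum_le) auto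
  finally show ?thesis by (simp add: sum_distrib_left mult_ac)
qed

section \<open>Averaging along one dyadic filtration\<close>

text \<open>One-parameter arguments are carried out for an abstract nested family of blocks, since they are used
  in each of the two variables, on functions of both.\<close>

locale dyadic_filtration =
  fixes blk :: "nat \<Rightarrow> 'a \<Rightarrow> 'a set"
  assumes blk_self: "z \<in> blk n z"
    and blk_eq: "w \<in> blk n z \<Longrightarrow> blk n w = blk n z"
    and blk_card: "card (blk n z) = 2 ^ n"
    and blk_Suc: "blk n z \<subseteq> blk (Suc n) z"
begin

definition avg :: "nat \<Rightarrow> ('a \<Rightarrow> real) \<Rightarrow> 'a \<Rightarrow> real" where
  "avg n h z = (\<Sum>w\<in>blk n z. h w) / 2 ^ n"

definition dif :: "nat \<Rightarrow> ('a \<Rightarrow> real) \<Rightarrow> 'a \<Rightarrow> real" where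
  "dif n h z = avg n h z - avg (Suc n) h z"

definition meas :: "nat \<Rightarrow> ('a \<Rightarrow> real) \<Rightarrow> bool" where
  "meas n w \<longleftrightarrow> (\<forall>z. \<forall>z'\<in>blk n z. w z' = w z)"

definition saturated :: "nat \<Rightarrow> 'a set \<Rightarrow> bool" where
  "saturated N Z \<longleftrightarrow> finite Z \<and> (\<forall>z\<in>Z. blk N z \<subseteq> Z)"

definition mx :: "nat \<Rightarrow> ('a \<Rightarrow> real) \<Rightarrow> 'a \<Rightarrow> real" where
  "mx N h z = Max ((\<lambda>n. avg n h z) ` {..N})"

lemma finite_blk [simp]: "finite (blk n z)"
  using blk_card[of n z] by (metis card.infinite power_not_zero zero_neq_numeral)

lemma blk_mono: "n \<le> m \<Longrightarrow> blk n z \<subseteq> blk m z"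
  by (rule lift_Suc_mono_le[of "\<lambda>n. blk n z"]) (rule blk_Suc)

lemma blk_sym: "w \<in> blk n z \<longleftrightarrow> z \<in> blk n w"
proof -
  have "z \<in> blk n w" if "w \<in> blk n z" for z w using blk_eq[OF that] blk_self[of z n] by simp
  then show ?thesis by blast
qed

lemma saturated_finite: "saturated N Z \<Longrightarrow> finite Z"
  by (simp add: saturated_def)

lemma saturated_mono: "saturated N Z \<Longrightarrow> n \<le> N \<Longrightarrow> saturated n Z"
  unfolding saturated_def by (meson blk_mono order_trans)

lemma saturated_blk: "n \<le> m \<Longrightarrow> saturated n (blk m z)"
  unfolding saturated_def using blk_mono[of n m] blk_eq[of _ m z] by (metis finite_blk)

lemma sum_avg:
  assumes "saturated n Z"
  shows "(\<Sum>z\<in>Z. avg n h z) = (\<Sum>z\<in>Z. h z)"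
proof -
  have fin: "finite Z" using assms by (rule saturated_finite)
  have blk: "blk n z = {w\<in>Z. w \<in> blk n z}" if "z \<in> Z" for z
    using assms that by (auto simp: saturated_def)
  have "(\<Sum>z\<in>Z. \<Sum>w\<in>blk n z. h w) = (\<Sum>z\<in>Z. \<Sum>w | w \<in> Z \<and> w \<in> blk n z. h w)"
    by (intro sum.cong refl) (rule blk)
  also have "\<dots> = (\<Sum>w\<in>Z. \<Sum>z | z \<in> Z \<and> w \<in> blk n z. h w)"
    using fin by (rule sum.swap_restrict[OF _ fin])
  also have "\<dots> = (\<Sum>w\<in>Z. \<Sum>z\<in>blk n w. h w)"
  proof (intro sum.cong refl)
    fix w assume "w \<in> Z"
    then show "{z. z \<in> Z \<and> w \<in> blk n z} = blk n w" using assms blk_sym by (auto simp: saturated_def)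
  qed
  also have "\<dots> = (\<Sum>w\<in>Z. 2 ^ n * h w)"
    by (simp add: blk_card)
  finally show ?thesis
    by (simp add: avg_def sum_divide_distrib[symmetric] sum_distrib_left[symmetric])
qed

lemma avg_diff: "avg n (\<lambda>z. f z - g z) z = avg n f z - avg n g z"
  by (simp add: avg_def sum_subtractf diff_divide_distrib)

lemma avg_0 [simp]: "avg 0 h = h"
proof
  fix z
  have "card (blk 0 z) = 1" by (simp add: blk_card)
  then have "blk 0 z = {z}" using blk_self[of z 0] by (metis card_1_singletonE singletonD)
  then show "avg 0 h z = h z" by (simp add: avg_def)
qed

lemma avg_mono: "(\<And>w. w \<in> blk n z \<Longrightarrow> f w \<le> g w) \<Longrightarrow> avg n f z \<le> avg n g z"
  unfolding avg_def by (intro divide_right_mono sum_mono) auto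

lemma avg_nonneg: "(\<And>w. w \<in> blk n z \<Longrightarrow> 0 \<le> f w) \<Longrightarrow> 0 \<le> avg n f z"
  unfolding avg_def by (intro divide_nonneg_nonneg sum_nonneg) auto

lemma measD: "meas n w \<Longrightarrow> z' \<in> blk n z \<Longrightarrow> w z' = w z"
  unfolding meas_def by blast

lemma meas_avg: "meas n (avg n h)"
  unfolding meas_def avg_def by (metis blk_eq)

lemma meas_mono: "meas m w \<Longrightarrow> n \<le> m \<Longrightarrow> meas n w"
  unfolding meas_def using blk_mono[of n m] by blast

lemma meas_combine: "meas n f \<Longrightarrow> meas n g \<Longrightarrow> meas n (\<lambda>z. F (f z) (g z))"
  unfolding meas_def by metis

lemma meas_fun: "meas n f \<Longrightarrow> meas n (\<lambda>z. F (f z))"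
  unfolding meas_def by metis

lemma avg_meas_mult: "meas n w \<Longrightarrow> avg n (\<lambda>z. w z * h z) z = w z * avg n h z"
proof -
  assume w: "meas n w"
  have "(\<Sum>z\<in>blk n z. w z * h z) = (\<Sum>z'\<in>blk n z. w z * h z')"
    by (intro sum.cong refl) (use measD[OF w] in auto)
  then show ?thesis by (simp add: avg_def sum_distrib_left)
qed

lemma avg_const: "avg n (\<lambda>_. c) z = c"
  by (simp add: avg_def blk_card)

lemma avg_meas: "meas n w \<Longrightarrow> avg n w z = w z"
  using avg_meas_mult[of n w "\<lambda>_. 1" z] by (simp add: avg_const)

lemma avg_avg: "avg m (avg n h) z = avg (max m n) h z"
proof (cases "n \<le> m")
  case True
  then have "(\<Sum>w\<in>blk m z. avg n h w) = (\<Sum>w\<in>blk m z. h w)" by (intro sum_avg saturated_blk)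
  then show ?thesis using True by (simp add: avg_def[of m] max_def)
next
  case False
  then have "meas m (avg n h)" using meas_mono[OF meas_avg] by simp
  then show ?thesis using False by (simp add: avg_meas max_def)
qed

lemma sum_meas_avg:
  assumes "saturated n Z" "meas n w"
  shows "(\<Sum>z\<in>Z. w z * avg n h z) = (\<Sum>z\<in>Z. w z * h z)"
  using sum_avg[OF assms(1), of "\<lambda>z. w z * h z"] by (simp add: avg_meas_mult[OF assms(2)])

lemma sum_avg_adjoint:
  assumes "saturated n Z"
  shows "(\<Sum>z\<in>Z. f z * avg n g z) = (\<Sum>z\<in>Z. avg n f z * g z)"
  using sum_meas_avg[OF assms meas_avg, of f g] sum_meas_avg[OF assms meas_avg, of g f]
  by (simp add: mult.commute)

lemma dif_diff: "dif n (\<lambda>z. f z - g z) z = dif n f z - dif n g z"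
  by (simp add: dif_def avg_diff)

lemma dif_const: "dif n (\<lambda>_. c) z = 0"
  by (simp add: dif_def avg_const)

lemma dif_meas_mult: "meas (Suc n) w \<Longrightarrow> dif n (\<lambda>z. w z * h z) z = w z * dif n h z"
  using avg_meas_mult[of "Suc n" w h z] avg_meas_mult[of n w h z] meas_mono[of "Suc n" w n]
  by (simp add: dif_def right_diff_distrib)

lemma meas_dif: "meas n (dif n h)"
  using meas_combine[of n "avg n h" "avg (Suc n) h" "(-)"] meas_avg[of n h]
    meas_mono[OF meas_avg[of "Suc n" h], of n] by (simp add: dif_def[abs_def])

lemma avg_dif: "avg a (dif n h) z = (if a \<le> n then dif n h z else 0)"
proof -
  have "avg a (dif n h) z = avg (max a n) h z - avg (max a (Suc n)) h z"
    unfolding dif_def by (simp add: avg_diff avg_avg)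
  then show ?thesis by (auto simp: dif_def max_def le_Suc_eq)
qed

lemma sum_meas_dif:
  assumes "saturated (Suc n) Z" "meas (Suc n) w"
  shows "(\<Sum>z\<in>Z. w z * dif n h z) = 0"
  using sum_meas_avg[OF assms, of h] sum_meas_avg[of n Z w h] assms
    saturated_mono[of "Suc n" Z n] meas_mono[of "Suc n" w n]
  by (simp add: dif_def right_diff_distrib sum_subtractf)

lemma sum_dif_adjoint:
  assumes "saturated (Suc n) Z"
  shows "(\<Sum>z\<in>Z. f z * dif n g z) = (\<Sum>z\<in>Z. dif n f z * g z)"
  using sum_avg_adjoint[OF assms, of f g] sum_avg_adjoint[of n Z f g] saturated_mono[OF assms, of n]
  by (simp add: dif_def right_diff_distrib left_diff_distrib sum_subtractf)

text \<open>A block of level \<open>Suc n\<close> consists of two blocks of level \<open>n\<close>, on which a difference takes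
  opposite values. So products of two differences of the same level are measurable one level up. Because of this
  regularity of the dyadic filtration, \<open>increment_square\<close> is an identity without error terms.\<close>

lemma meas_dif_mult: "meas (Suc n) (\<lambda>z. dif n f z * dif n g z)"
proof -
  have opp: "dif n h z' = - dif n h z" if z': "z' \<in> blk (Suc n) z" "z' \<notin> blk n z" for z z' h
  proof -
    have disj: "blk n z \<inter> blk n z' = {}"
      using z' blk_eq[of _ n z] blk_eq[of _ n z'] blk_self[of z' n] by (metis disjoint_iff)
    have "blk n z \<union> blk n z' \<subseteq> blk (Suc n) z"
      using blk_Suc[of n z] blk_Suc[of n z'] blk_eq[OF z'(1)] by auto
    moreover have "card (blk n z \<union> blk n z') = card (blk (Suc n) z)"
      by (simp add: card_Un_disjoint[OF _ _ disj] blk_card)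
    ultimately have "blk (Suc n) z = blk n z \<union> blk n z'"
      by (metis card_subset_eq finite_blk)
    then have "avg (Suc n) h z = (avg n h z + avg n h z') / 2"
      using disj by (simp add: avg_def sum.union_disjoint field_simps)
    moreover have "avg (Suc n) h z' = avg (Suc n) h z" using measD[OF meas_avg z'(1)] .
    ultimately show ?thesis by (simp add: dif_def)
  qed
  show ?thesis
    unfolding meas_def
  proof (intro allI ballI)
    fix z z' assume z': "z' \<in> blk (Suc n) z"
    show "dif n f z' * dif n g z' = dif n f z * dif n g z"
      using opp[OF z'] measD[OF meas_dif, of z' n z] by (cases "z' \<in> blk n z") auto
  qed
qed

text \<open>Write both factors as coarse average plus difference and expand the square. Terms that are odd in the
  differences have a coefficient that is measurable one level up and sum to zero.
  With \<open>V = 1\<close> this is the energy identity.\<close>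

lemma increment_square:
  assumes Z: "saturated (Suc n) Z"
  shows "(\<Sum>z\<in>Z. (avg n U z * avg n V z)\<^sup>2) - (\<Sum>z\<in>Z. (avg (Suc n) U z * avg (Suc n) V z)\<^sup>2) =
    (\<Sum>z\<in>Z. (avg (Suc n) U z * dif n V z)\<^sup>2 + (avg (Suc n) V z * dif n U z)\<^sup>2 + (dif n U z * dif n V z)\<^sup>2
      + 4 * (avg (Suc n) U z * dif n V z) * (avg (Suc n) V z * dif n U z))"
proof -
  let ?a = "avg (Suc n) U" and ?b = "avg (Suc n) V"
  let ?wu = "\<lambda>z. 2 * ?a z * (?b z)\<^sup>2 + 2 * ?a z * (dif n V z * dif n V z)"
  let ?wv = "\<lambda>z. 2 * (?a z)\<^sup>2 * ?b z + 2 * ?b z * (dif n U z * dif n U z)"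
  have m: "?a z' = ?a z" "?b z' = ?b z" "dif n V z' * dif n V z' = dif n V z * dif n V z"
    "dif n U z' * dif n U z' = dif n U z * dif n U z" if "z' \<in> blk (Suc n) z" for z z'
    using measD[OF meas_avg that] measD[OF meas_dif_mult that] by auto
  have "meas (Suc n) ?wu" "meas (Suc n) ?wv"
    unfolding meas_def by (intro allI ballI, simp only: m)+
  then have 0: "(\<Sum>z\<in>Z. ?wu z * dif n U z) = 0" "(\<Sum>z\<in>Z. ?wv z * dif n V z) = 0"
    using sum_meas_dif[OF Z] by auto
  have u: "avg n U z = ?a z + dif n U z" "avg n V z = ?b z + dif n V z" for z
    by (simp_all add: dif_def)
  have "(\<Sum>z\<in>Z. (avg n U z * avg n V z)\<^sup>2) - (\<Sum>z\<in>Z. (?a z * ?b z)\<^sup>2) =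
      (\<Sum>z\<in>Z. ((?a z * dif n V z)\<^sup>2 + (?b z * dif n U z)\<^sup>2 + (dif n U z * dif n V z)\<^sup>2
        + 4 * (?a z * dif n V z) * (?b z * dif n U z)) + ?wu z * dif n U z + ?wv z * dif n V z)"
    unfolding sum_subtractf[symmetric] u
    by (intro sum.cong refl) (simp add: power2_eq_square algebra_simps)
  then show ?thesis unfolding sum.distrib using 0 by simp
qed

lemma sum_dif_square:
  assumes Z: "saturated N Z" and n: "n < N"
  shows "(\<Sum>z\<in>Z. (dif n h z)\<^sup>2) = (\<Sum>z\<in>Z. (avg n h z)\<^sup>2) - (\<Sum>z\<in>Z. (avg (Suc n) h z)\<^sup>2)"
  using increment_square[OF saturated_mono[OF Z], of n h "\<lambda>_. 1"] n
  by (simp add: avg_const dif_const)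

lemma energy_le:
  assumes Z: "saturated N Z"
  shows "(\<Sum>n<N. \<Sum>z\<in>Z. (dif n h z)\<^sup>2) \<le> (\<Sum>z\<in>Z. (h z)\<^sup>2)"
proof -
  have "(\<Sum>n<N. \<Sum>z\<in>Z. (dif n h z)\<^sup>2) =
     (\<Sum>n<N. (\<Sum>z\<in>Z. (avg n h z)\<^sup>2) - (\<Sum>z\<in>Z. (avg (Suc n) h z)\<^sup>2))"
    by (intro sum.cong refl sum_dif_square[OF Z]) auto
  also have "\<dots> = (\<Sum>z\<in>Z. (avg 0 h z)\<^sup>2) - (\<Sum>z\<in>Z. (avg N h z)\<^sup>2)"
    by (rule sum_lessThan_telescope')
  finally show ?thesis by (simp add: sum_nonneg)
qed

text \<open>The substitute for integration by parts: differences are moved from \<open>U\<close> to \<open>V\<close>. The increments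
  of \<open>increment_square\<close> telescope, and the term at the coarsest level has the favourable sign. The cross term is
  split by the arithmetic-geometric mean inequality, at the cost of half of the left side.\<close>

lemma exchange_le:
  assumes Z: "saturated N Z"
  shows "(\<Sum>n<N. \<Sum>z\<in>Z. (avg (Suc n) V z * dif n U z)\<^sup>2) \<le>
    2 * (\<Sum>z\<in>Z. (U z * V z)\<^sup>2) + 14 * (\<Sum>n<N. \<Sum>z\<in>Z. (avg (Suc n) U z * dif n V z)\<^sup>2)"
proof -
  let ?Q = "\<lambda>n. \<Sum>z\<in>Z. (avg n U z * avg n V z)\<^sup>2"
  have "(\<Sum>z\<in>Z. (avg (Suc n) V z * dif n U z)\<^sup>2) \<le>
    2 * (?Q n - ?Q (Suc n)) + 14 * (\<Sum>z\<in>Z. (avg (Suc n) U z * dif n V z)\<^sup>2)" if "n < N" for n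
  proof -
    have le: "y\<^sup>2 \<le> 2 * (x\<^sup>2 + y\<^sup>2 + w\<^sup>2 + 4 * x * y) + 14 * x\<^sup>2" for x y w :: real
    proof -
      have "0 \<le> (y + 4 * x)\<^sup>2 + 2 * w\<^sup>2" by simp
      then show ?thesis by (simp add: power2_eq_square algebra_simps)
    qed
    show ?thesis
      using increment_square[OF saturated_mono[OF Z, of "Suc n"], of U V] that
      by (simp only: sum_distrib_left sum.distrib[symmetric] Suc_le_eq) (intro sum_mono le)
  qed
  then have "(\<Sum>n<N. \<Sum>z\<in>Z. (avg (Suc n) V z * dif n U z)\<^sup>2) \<le>
    (\<Sum>n<N. 2 * (?Q n - ?Q (Suc n)) + 14 * (\<Sum>z\<in>Z. (avg (Suc n) U z * dif n V z)\<^sup>2))"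
    by (intro sum_mono) auto
  also have "\<dots> = 2 * (\<Sum>n<N. ?Q n - ?Q (Suc n)) + 14 * (\<Sum>n<N. \<Sum>z\<in>Z. (avg (Suc n) U z * dif n V z)\<^sup>2)"
    by (simp only: sum.distrib sum_distrib_left)
  also have "(\<Sum>n<N. ?Q n - ?Q (Suc n)) = ?Q 0 - ?Q N" by (rule sum_lessThan_telescope')
  also have "\<dots> \<le> ?Q 0" by (simp add: sum_nonneg)
  finally show ?thesis by simp
qed

text \<open>Follow the sum of \<open>U\<^sup>s - s' U\<^bsup>s-1\<^esup> a\<close>, where \<open>a\<close> is the average at the current level, \<open>U\<close>
  its maximum over all coarser levels and \<open>s'\<close> the conjugate exponent, from the coarsest level down.
  It is not positive at the start. Refining \<open>a\<close> does not change it, as \<open>U\<close> is measurable for the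
  coarser level, and raising \<open>U\<close> to a new maximum does not increase it, by Young's inequality.\<close>

lemma doob:
  assumes Z: "saturated N Z" and s: "1 < s" and nn: "\<And>z. 0 \<le> h z"
  shows "(\<Sum>z\<in>Z. mx N h z powr s) \<le> (s / (s - 1)) powr s * (\<Sum>z\<in>Z. h z powr s)"
proof -
  define s' where "s' = s / (s - 1)"
  define U where "U n z = Max ((\<lambda>k. avg k h z) ` {n..N})" for n z
  have s'1: "1 \<le> s'" using s by (simp add: s'_def)
  have pw: "a powr (s - 1) * a = a powr s" if "0 \<le> a" for a :: real
    using that s powr_mult_base[of a "s - 1"] by (cases "a = 0") (auto simp: mult.commute)
  have avg0: "0 \<le> avg n h z" for n z by (intro avg_nonneg nn)
  have U0: "0 \<le> U n z" if "n \<le> N" for n z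
  proof -
    have "avg n h z \<le> U n z" unfolding U_def using that by (intro Max_ge) auto
    then show ?thesis using avg0[of n z] by linarith
  qed
  have main: "(\<Sum>z\<in>Z. U n z powr s - s' * U n z powr (s - 1) * avg n h z) \<le> 0" if "n \<le> N" for n
    using that
  proof (induction rule: inc_induct)
    case base
    have "a powr s - s' * a powr (s - 1) * a \<le> 0" if "0 \<le> a" for a
    proof -
      have "1 * a powr s \<le> s' * a powr s" using s'1 by (intro mult_right_mono) auto
      then show ?thesis by (simp add: mult.assoc pw[OF that])
    qed
    then show ?case using avg0 by (intro sum_nonpos) (simp add: U_def)
  next
    case (step n)
    have Un: "U n z = max (avg n h z) (U (Suc n) z)" for z
    proof -
      have "{n..N} = insert n {Suc n..N}" using step by auto
      then show ?thesis unfolding U_def using step by simp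
    qed
    have mU: "meas (Suc n) (U (Suc n))"
      unfolding meas_def U_def
    proof (intro allI ballI arg_cong[of _ _ Max] image_cong refl)
      fix z z' k assume "z' \<in> blk (Suc n) z" "k \<in> {Suc n..N}"
      then show "avg k h z' = avg k h z" using measD[OF meas_mono[OF meas_avg]] by auto
    qed
    have "(\<Sum>z\<in>Z. U n z powr s - s' * U n z powr (s - 1) * avg n h z) \<le>
      (\<Sum>z\<in>Z. U (Suc n) z powr s - s' * U (Suc n) z powr (s - 1) * avg n h z)"
    proof (intro sum_mono)
      fix z
      let ?a = "avg n h z" and ?V = "U (Suc n) z"
      show "U n z powr s - s' * U n z powr (s - 1) * ?a \<le> ?V powr s - s' * ?V powr (s - 1) * ?a"
      proof (cases "?a \<le> ?V")
        case False
        then have [simp]: "U n z = ?a" unfolding Un by simp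
        have V0: "0 \<le> ?V" using step by (intro U0) auto
        have "(?V powr s) powr (1 - 1 / s) * (?a powr s) powr (1 / s) \<le> (1 - 1 / s) * ?V powr s + 1 / s * ?a powr s"
          using s by (intro Young_weighted) auto
        also have "(?V powr s) powr (1 - 1 / s) = ?V powr (s - 1)" using s by (simp add: powr_powr right_diff_distrib)
        also have "(?a powr s) powr (1 / s) = ?a" using s avg0[of n z] by (simp add: powr_powr)
        finally have "s' * (?V powr (s - 1) * ?a) \<le> s' * ((1 - 1 / s) * ?V powr s + 1 / s * ?a powr s)"
          using s by (intro mult_left_mono) (auto simp: s'_def)
        also have "\<dots> = (s' * (1 - 1 / s)) * ?V powr s + (s' / s) * ?a powr s"
          by (simp add: distrib_left)
        also have "s' * (1 - 1 / s) = 1" using s by (simp add: s'_def field_simps)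
        also have "s' / s = s' - 1" using s by (simp add: s'_def field_simps)
        finally show ?thesis by (simp add: mult.assoc pw[OF avg0] left_diff_distrib)
      qed (simp add: Un max_def)
    qed
    also have "\<dots> = (\<Sum>z\<in>Z. U (Suc n) z powr s - s' * U (Suc n) z powr (s - 1) * avg (Suc n) h z)"
    proof -
      have m: "meas (Suc n) (\<lambda>z. s' * U (Suc n) z powr (s - 1))" using meas_fun[OF mU, of "\<lambda>x. s' * x powr (s - 1)"] .
      have "saturated (Suc n) Z" "saturated n Z" using saturated_mono[OF Z] step by auto
      then show ?thesis
        unfolding sum_subtractf using sum_meas_avg[of "Suc n" Z _ h] sum_meas_avg[of n Z _ h] m meas_mono[OF m, of n]
        by simp
    qed
    finally show ?case using step by linarith
  qed
  from main[of 0] have "(\<Sum>z\<in>Z. U 0 z powr s) \<le> s' * (\<Sum>z\<in>Z. h z * U 0 z powr (s - 1))"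
    by (simp add: sum_subtractf sum_distrib_left mult_ac)
  also have "(\<Sum>z\<in>Z. h z * U 0 z powr (s - 1)) \<le> (\<Sum>z\<in>Z. h z powr s) powr (1 / s) *
     (\<Sum>z\<in>Z. (U 0 z powr (s - 1)) powr (s / (s - 1))) powr (1 - 1 / s)"
    using s nn by (intro Hoelder_sum_conjugate) auto
  also have "(\<Sum>z\<in>Z. (U 0 z powr (s - 1)) powr (s / (s - 1))) = (\<Sum>z\<in>Z. U 0 z powr s)"
    using s by (simp add: powr_powr)
  finally have "(\<Sum>z\<in>Z. U 0 z powr s) \<le>
    s' * (\<Sum>z\<in>Z. h z powr s) powr (1 / s) * (\<Sum>z\<in>Z. U 0 z powr s) powr (1 - 1 / s)"
    using s'1 by (simp add: mult_left_mono mult.assoc)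
  then have "(\<Sum>z\<in>Z. U 0 z powr s) powr (1 - (1 - 1 / s)) \<le> s' * (\<Sum>z\<in>Z. h z powr s) powr (1 / s)"
    using s s'1 by (intro powr_absorb) (auto intro!: sum_nonneg mult_nonneg_nonneg)
  then have "((\<Sum>z\<in>Z. U 0 z powr s) powr (1 / s)) powr s \<le> (s' * (\<Sum>z\<in>Z. h z powr s) powr (1 / s)) powr s"
    using s by (intro powr_mono2) auto
  then have "(\<Sum>z\<in>Z. U 0 z powr s) \<le> s' powr s * (\<Sum>z\<in>Z. h z powr s)"
    using s s'1 by (simp add: powr_powr powr_mult sum_nonneg)
  moreover have "U 0 z = mx N h z" for z by (simp add: U_def mx_def atMost_atLeast0)
  ultimately show ?thesis by (simp add: s'_def)
qed

lemma avg_le_mx: "n \<le> N \<Longrightarrow> avg n h z \<le> mx N h z"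
  unfolding mx_def by (intro Max_ge) auto

end

section \<open>The two filtrations of the integer lattice\<close>

definition blk1 :: "nat \<Rightarrow> int \<times> int \<Rightarrow> (int \<times> int) set" where
  "blk1 n z = {w. fst w div 2 ^ n = fst z div 2 ^ n \<and> snd w = snd z}"

definition blk2 :: "nat \<Rightarrow> int \<times> int \<Rightarrow> (int \<times> int) set" where
  "blk2 n z = {w. fst w = fst z \<and> snd w div 2 ^ n = snd z div 2 ^ n}"

definition rect :: "nat \<Rightarrow> nat \<Rightarrow> int \<times> int \<Rightarrow> (int \<times> int) set" where
  "rect n m z = {w. fst w div 2 ^ n = fst z div 2 ^ n \<and> snd w div 2 ^ m = snd z div 2 ^ m}"

lemma cell_eq_interval: "{t::int. t div 2 ^ n = q} = {q * 2 ^ n ..< (q + 1) * 2 ^ n}"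
proof (intro set_eqI iffI)
  fix t :: int
  have dm: "t = t div 2 ^ n * 2 ^ n + t mod 2 ^ n" "0 \<le> t mod 2 ^ n" "t mod 2 ^ n < 2 ^ n"
    by (simp_all only: div_mult_mod_eq) simp_all
  show "t \<in> {q * 2 ^ n ..< (q + 1) * 2 ^ n}" if "t \<in> {t. t div 2 ^ n = q}"
  proof -
    have q: "t div 2 ^ n = q" using that by simp
    have "q * 2 ^ n \<le> t" "t < q * 2 ^ n + 2 ^ n" using dm unfolding q by linarith+
    then show ?thesis by (simp add: algebra_simps)
  qed
  show "t \<in> {t. t div 2 ^ n = q}" if "t \<in> {q * 2 ^ n ..< (q + 1) * 2 ^ n}"
  proof -
    have "t div 2 ^ n = q"
      using that by (intro int_div_pos_eq[of _ _ _ "t - q * 2 ^ n"]) (auto simp: algebra_simps)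
    then show ?thesis by simp
  qed
qed

lemma card_cell: "card {t::int. t div 2 ^ n = q} = 2 ^ n"
  unfolding cell_eq_interval by (simp add: algebra_simps nat_power_eq)

lemma finite_cell: "finite {t::int. t div 2 ^ n = q}"
  unfolding cell_eq_interval by simp

lemma div_power_mono:
  fixes x y :: int
  assumes "x div 2 ^ n = y div 2 ^ n" "n \<le> m"
  shows "x div 2 ^ m = y div 2 ^ m"
proof -
  have "(2::int) ^ m = 2 ^ n * 2 ^ (m - n)" using assms(2) by (simp add: power_add[symmetric])
  then show ?thesis using assms(1) by (simp add: zdiv_zmult2_eq)
qed

lemma blk1_image: "blk1 n (x, y) = (\<lambda>t. (t, y)) ` {t. t div 2 ^ n = x div 2 ^ n}"
  by (auto simp: blk1_def)

lemma blk2_image: "blk2 n (x, y) = (\<lambda>t. (x, t)) ` {t. t div 2 ^ n = y div 2 ^ n}"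
  by (auto simp: blk2_def)

interpretation X: dyadic_filtration blk1
proof
  show "card (blk1 n z) = 2 ^ n" for n z
    by (cases z) (simp add: blk1_image card_image inj_on_def card_cell)
  show "blk1 n z \<subseteq> blk1 (Suc n) z" for n z
    by (auto simp: blk1_def simp del: power_Suc intro: div_power_mono[of _ n _ "Suc n"])
qed (auto simp: blk1_def)

interpretation Y: dyadic_filtration blk2
proof
  show "card (blk2 n z) = 2 ^ n" for n z
    by (cases z) (simp add: blk2_image card_image inj_on_def card_cell)
  show "blk2 n z \<subseteq> blk2 (Suc n) z" for n z
    by (auto simp: blk2_def simp del: power_Suc intro: div_power_mono[of _ n _ "Suc n"])
qed (auto simp: blk2_def)

lemma X_avg_eq: "X.avg n u (x, y) = (\<Sum>t | t div 2 ^ n = x div 2 ^ n. u (t, y)) / 2 ^ n"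
  unfolding X.avg_def blk1_image by (subst sum.reindex) (auto simp: inj_on_def)

lemma Y_avg_eq: "Y.avg n u (x, y) = (\<Sum>t | t div 2 ^ n = y div 2 ^ n. u (x, t)) / 2 ^ n"
  unfolding Y.avg_def blk2_image by (subst sum.reindex) (auto simp: inj_on_def)

lemma avg_commute: "X.avg n (Y.avg m u) = Y.avg m (X.avg n u)"
proof
  fix z :: "int \<times> int"
  obtain x y where z: "z = (x, y)" by (cases z)
  show "X.avg n (Y.avg m u) z = Y.avg m (X.avg n u) z"
    unfolding z X_avg_eq Y_avg_eq
    by (simp add: sum_divide_distrib[symmetric]) (subst sum.swap, simp)
qed

lemma dif_avg_commute: "X.dif n (Y.avg m u) = Y.avg m (X.dif n u)"
  by (simp add: fun_eq_iff X.dif_def[abs_def] avg_commute Y.avg_diff)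

lemma avg_dif_commute: "X.avg n (Y.dif m u) = Y.dif m (X.avg n u)"
  by (simp add: fun_eq_iff Y.dif_def[abs_def] avg_commute X.avg_diff)

lemma dif_commute: "X.dif n (Y.dif m u) = Y.dif m (X.dif n u)"
  by (simp add: fun_eq_iff Y.dif_def[abs_def] dif_avg_commute X.dif_diff)

text \<open>\<open>EE n m u\<close> averages over rectangles with sides of levels \<open>n\<close> and \<open>m\<close>. \<open>DD n m u\<close> is the part
  of \<open>u\<close> in the span of the Haar functions of the rectangles of levels \<open>Suc n\<close> and \<open>Suc m\<close>: its square
  at a point is the term of the square function that belongs to the rectangle around the point.\<close>

definition EE :: "nat \<Rightarrow> nat \<Rightarrow> (int \<times> int \<Rightarrow> real) \<Rightarrow> int \<times> int \<Rightarrow> real" where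
  "EE n m u = X.avg n (Y.avg m u)"

definition DD :: "nat \<Rightarrow> nat \<Rightarrow> (int \<times> int \<Rightarrow> real) \<Rightarrow> int \<times> int \<Rightarrow> real" where
  "DD n m u = X.dif n (Y.dif m u)"

text \<open>The grid meets all four quadrants, and no block of level at most \<open>N\<close> crosses its boundary.\<close>

definition grid :: "nat \<Rightarrow> (int \<times> int) set" where
  "grid N = {- (2 ^ N) ..< 2 ^ N} \<times> {- (2 ^ N) ..< 2 ^ N}"

lemma finite_grid [simp]: "finite (grid N)" by (simp add: grid_def)

lemma mem_grid_iff: "z \<in> grid N \<longleftrightarrow> fst z div 2 ^ N \<in> {-1, 0} \<and> snd z div 2 ^ N \<in> {-1, 0}"
proof -
  have "t \<in> {- (2 ^ N) ..< 2 ^ N} \<longleftrightarrow> t div 2 ^ N \<in> {-1, 0}" for t :: int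
  proof -
    have "t div 2 ^ N = q \<longleftrightarrow> t \<in> {q * 2 ^ N ..< (q + 1) * 2 ^ N}" for q
      using cell_eq_interval[of N q] by blast
    from this[of "-1"] this[of 0] show ?thesis by auto
  qed
  then show ?thesis unfolding grid_def by (cases z) auto
qed

lemma rect_grid: "z \<in> grid N \<Longrightarrow> n \<le> N \<Longrightarrow> m \<le> N \<Longrightarrow> rect n m z \<subseteq> grid N"
proof
  fix w assume z: "z \<in> grid N" and nm: "n \<le> N" "m \<le> N" and w: "w \<in> rect n m z"
  have "fst w div 2 ^ N = fst z div 2 ^ N" using w nm div_power_mono unfolding rect_def by blast
  moreover have "snd w div 2 ^ N = snd z div 2 ^ N" using w nm div_power_mono unfolding rect_def by blast
  ultimately show "w \<in> grid N" using z unfolding mem_grid_iff by simp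
qed

lemma saturated_grid: "X.saturated N (grid N)" "Y.saturated N (grid N)"
  unfolding X.saturated_def Y.saturated_def blk1_def blk2_def by (auto simp: mem_grid_iff)

lemma saturated_grid_le: "n \<le> N \<Longrightarrow> X.saturated n (grid N)" "n \<le> N \<Longrightarrow> Y.saturated n (grid N)"
  using X.saturated_mono[OF saturated_grid(1)] Y.saturated_mono[OF saturated_grid(2)] by auto

lemma grid_mono: "N \<le> M \<Longrightarrow> grid N \<subseteq> grid M"
proof -
  assume "N \<le> M"
  then have p: "(2::int) ^ N \<le> 2 ^ M" by (intro power_increasing) auto
  show ?thesis unfolding grid_def
  proof (intro Sigma_mono subsetI)
    fix t :: int assume "t \<in> {- (2 ^ N) ..< 2 ^ N}"
    then have "- (2 ^ N) \<le> t" "t < 2 ^ N" by auto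
    with p have "- (2 ^ M) \<le> t" "t < 2 ^ M" by linarith+
    then show "t \<in> {- (2 ^ M) ..< 2 ^ M}" by simp
    then show "t \<in> {- (2 ^ M) ..< 2 ^ M}" .
  qed
qed

lemma rect_self: "z \<in> rect n m z" by (simp add: rect_def)

lemma rect_mono: "n \<le> n' \<Longrightarrow> m \<le> m' \<Longrightarrow> rect n m z \<subseteq> rect n' m' z"
  unfolding rect_def by (auto intro: div_power_mono)

lemma rect_eq: "w \<in> rect n m z \<Longrightarrow> rect n m w = rect n m z"
  unfolding rect_def by auto

lemma rect_prod: "rect n m (x, y) = {t. t div 2 ^ n = x div 2 ^ n} \<times> {t. t div 2 ^ m = y div 2 ^ m}"
  by (auto simp: rect_def)

lemma finite_rect [simp]: "finite (rect n m z)"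
  by (cases z) (simp add: rect_prod finite_cell)

lemma card_rect: "card (rect n m z) = 2 ^ (n + m)"
  by (cases z) (simp add: rect_prod card_cartesian_product card_cell power_add)

lemma EE_eq_sum_rect: "EE n m u z = (\<Sum>w\<in>rect n m z. u w) / 2 ^ (n + m)"
proof -
  obtain x y where z: "z = (x, y)" by (cases z)
  show ?thesis
    unfolding z rect_prod EE_def X_avg_eq Y_avg_eq
    by (simp add: sum.cartesian_product' sum_divide_distrib power_add mult.commute)
qed

lemma EE_const_on_rect: "w \<in> rect n m z \<Longrightarrow> EE n m u w = EE n m u z"
  by (simp add: EE_eq_sum_rect rect_eq)

lemma EE_0 [simp]: "EE 0 0 u = u"
  by (simp add: EE_def)

lemma EE_mono: "(\<And>w. w \<in> rect n m z \<Longrightarrow> f w \<le> g w) \<Longrightarrow> EE n m f z \<le> EE n m g z"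
  unfolding EE_eq_sum_rect by (intro divide_right_mono sum_mono) auto

lemma EE_cong: "(\<And>w. w \<in> rect n m z \<Longrightarrow> f w = g w) \<Longrightarrow> EE n m f z = EE n m g z"
  unfolding EE_eq_sum_rect by simp

lemma EE_nonneg: "(\<And>w. 0 \<le> f w) \<Longrightarrow> 0 \<le> EE n m f z"
  unfolding EE_eq_sum_rect by (intro divide_nonneg_nonneg sum_nonneg) auto

lemma abs_EE_le: "\<bar>EE n m f z\<bar> \<le> EE n m (\<lambda>w. \<bar>f w\<bar>) z"
  unfolding EE_eq_sum_rect by (simp add: divide_right_mono sum_abs)

lemma EE_const: "EE n m (\<lambda>_. c) z = c"
  unfolding EE_eq_sum_rect by (simp add: card_rect)

lemma EE_diff: "EE n m (\<lambda>z. f z - g z) z = EE n m f z - EE n m g z"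
  unfolding EE_eq_sum_rect by (simp add: sum_subtractf diff_divide_distrib)

lemma EE_cmult: "EE n m (\<lambda>z. c * f z) z = c * EE n m f z"
  unfolding EE_eq_sum_rect by (simp add: sum_distrib_left)

lemma EE_sum: "EE n m (\<lambda>z. \<Sum>i\<in>I. f i z) z = (\<Sum>i\<in>I. EE n m (f i) z)"
  unfolding EE_eq_sum_rect by (subst sum.swap) (simp add: sum_divide_distrib)

lemma EE_EE: "EE a b (EE n m u) = EE (max a n) (max b m) u"
proof -
  have "EE a b (EE n m u) = X.avg a (X.avg n (Y.avg b (Y.avg m u)))"
    unfolding EE_def by (simp add: avg_commute)
  also have "Y.avg b (Y.avg m u) = Y.avg (max b m) u" by (simp add: fun_eq_iff Y.avg_avg)
  also have "X.avg a (X.avg n (Y.avg (max b m) u)) = X.avg (max a n) (Y.avg (max b m) u)"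
    by (simp add: fun_eq_iff X.avg_avg)
  finally show ?thesis by (simp add: EE_def)
qed

lemma DD_eq_EE: "DD n m u z = EE n m u z - EE (Suc n) m u z - EE n (Suc m) u z + EE (Suc n) (Suc m) u z"
  unfolding DD_def EE_def X.dif_def Y.dif_def[abs_def] X.avg_diff by simp

lemma EE_DD: "EE a b (DD n m u) z = (if a \<le> n \<and> b \<le> m then DD n m u z else 0)"
proof -
  have "EE a b (DD n m u) z = X.avg a (X.dif n (Y.avg b (Y.dif m u))) z"
    unfolding EE_def DD_def by (simp add: dif_avg_commute)
  also have "Y.avg b (Y.dif m u) = (\<lambda>z. if b \<le> m then Y.dif m u z else 0)"
    by (simp add: fun_eq_iff Y.avg_dif)
  finally show ?thesis by (auto simp: X.avg_dif DD_def X.dif_const)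
qed

lemma DD_DD: "DD a b (DD n m u) z = (if a = n \<and> b = m then DD n m u z else 0)"
  unfolding DD_eq_EE[of a b] EE_DD by auto

lemma DD_cmult: "DD n m (\<lambda>z. c * f z) z = c * DD n m f z"
  unfolding DD_eq_EE EE_cmult by (simp add: algebra_simps)

lemma DD_sum: "DD n m (\<lambda>z. \<Sum>i\<in>I. f i z) z = (\<Sum>i\<in>I. DD n m (f i) z)"
  unfolding DD_eq_EE EE_sum by (simp add: sum_subtractf sum.distrib)

definition MEAS :: "nat \<Rightarrow> nat \<Rightarrow> (int \<times> int \<Rightarrow> real) \<Rightarrow> bool" where
  "MEAS n m w \<longleftrightarrow> X.meas n w \<and> Y.meas m w"

lemma MEAS_combine: "MEAS n m f \<Longrightarrow> MEAS n m g \<Longrightarrow> MEAS n m (\<lambda>z. F (f z) (g z))"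
  unfolding MEAS_def by (simp add: X.meas_combine Y.meas_combine)

lemma MEAS_fun: "MEAS n m f \<Longrightarrow> MEAS n m (\<lambda>z. F (f z))"
  unfolding MEAS_def by (simp add: X.meas_fun Y.meas_fun)

lemma MEAS_EE: "MEAS n m (EE n m u)"
  unfolding MEAS_def EE_def using X.meas_avg Y.meas_avg avg_commute by metis

lemma MEAS_DD_square: "MEAS (Suc n) (Suc m) (\<lambda>z. (DD n m u z)\<^sup>2)"
proof -
  have "X.meas (Suc n) (\<lambda>z. (DD n m u z)\<^sup>2)"
    unfolding DD_def power2_eq_square by (rule X.meas_dif_mult)
  moreover have "Y.meas (Suc m) (\<lambda>z. (DD n m u z)\<^sup>2)"
    unfolding DD_def dif_commute power2_eq_square by (rule Y.meas_dif_mult)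
  ultimately show ?thesis by (simp add: MEAS_def)
qed

lemma DD_MEAS_mult:
  assumes "MEAS (Suc n) (Suc m) w"
  shows "DD n m (\<lambda>z. w z * u z) z = w z * DD n m u z"
proof -
  have "Y.dif m (\<lambda>z. w z * u z) = (\<lambda>z. w z * Y.dif m u z)"
    using assms by (simp add: fun_eq_iff Y.dif_meas_mult MEAS_def)
  then show ?thesis using assms by (simp add: DD_def X.dif_meas_mult MEAS_def)
qed

lemma sum_MEAS_EE:
  assumes "MEAS n m w" "n \<le> N" "m \<le> N"
  shows "(\<Sum>z\<in>grid N. w z * EE n m u z) = (\<Sum>z\<in>grid N. w z * u z)"
  using assms saturated_grid_le unfolding EE_def MEAS_def
  by (simp add: X.sum_meas_avg Y.sum_meas_avg)

lemma sum_DD_adjoint: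
  assumes "n < N" "m < N"
  shows "(\<Sum>z\<in>grid N. f z * DD n m g z) = (\<Sum>z\<in>grid N. DD n m f z * g z)"
proof -
  have "(\<Sum>z\<in>grid N. f z * DD n m g z) = (\<Sum>z\<in>grid N. X.dif n f z * Y.dif m g z)"
    unfolding DD_def using assms saturated_grid_le(1)[of "Suc n" N] by (intro X.sum_dif_adjoint) auto
  also have "\<dots> = (\<Sum>z\<in>grid N. Y.dif m (X.dif n f) z * g z)"
    using assms saturated_grid_le(2)[of "Suc m" N] by (intro Y.sum_dif_adjoint) auto
  finally show ?thesis by (simp add: DD_def dif_commute)
qed

section \<open>The strong maximal function\<close>

definition fmax :: "nat \<Rightarrow> (nat \<Rightarrow> nat \<Rightarrow> 'a \<Rightarrow> real) \<Rightarrow> 'a \<Rightarrow> real" where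
  "fmax N e z = Max ((\<lambda>(n, m). \<bar>e n m z\<bar>) ` ({..N} \<times> {..N}))"

definition MM :: "nat \<Rightarrow> (int \<times> int \<Rightarrow> real) \<Rightarrow> int \<times> int \<Rightarrow> real" where
  "MM N u = fmax N (\<lambda>n m. EE n m u)"

lemma fmax_ge: "n \<le> N \<Longrightarrow> m \<le> N \<Longrightarrow> \<bar>e n m z\<bar> \<le> fmax N e z"
  unfolding fmax_def by (intro Max_ge) (auto intro!: rev_image_eqI[of "(n, m)"])

lemma fmax_le: "(\<And>n m. n \<le> N \<Longrightarrow> m \<le> N \<Longrightarrow> \<bar>e n m z\<bar> \<le> c) \<Longrightarrow> fmax N e z \<le> c"
  unfolding fmax_def by (intro Max.boundedI) auto

lemma fmax_nonneg: "0 \<le> fmax N e z"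
  using fmax_ge[of 0 N 0 e z] by (meson abs_ge_zero le0 order_trans)

lemma fmax_attained: "\<exists>n m. n \<le> N \<and> m \<le> N \<and> fmax N e z = \<bar>e n m z\<bar>"
proof -
  have "fmax N e z \<in> (\<lambda>(n, m). \<bar>e n m z\<bar>) ` ({..N} \<times> {..N})"
    unfolding fmax_def by (intro Max_in) auto
  then show ?thesis by auto
qed

lemma MM_ge: "n \<le> N \<Longrightarrow> m \<le> N \<Longrightarrow> \<bar>EE n m u z\<bar> \<le> MM N u z"
  unfolding MM_def by (rule fmax_ge)

lemma MM_nonneg [simp]: "0 \<le> MM N u z"
  unfolding MM_def by (rule fmax_nonneg)

lemma abs_le_MM: "\<bar>u z\<bar> \<le> MM N u z"
  using MM_ge[of 0 N 0 u z] by simp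

definition doob_const :: "real \<Rightarrow> real" where
  "doob_const s = (s / (s - 1)) powr s"

text \<open>The maximal functions of the two variables are applied one after the other.\<close>

lemma strong_maximal:
  assumes s: "1 < s"
  shows "(\<Sum>z\<in>grid N. MM N u z powr s) \<le> (doob_const s)\<^sup>2 * (\<Sum>z\<in>grid N. \<bar>u z\<bar> powr s)"
proof -
  define w where "w = Y.mx N (\<lambda>z. \<bar>u z\<bar>)"
  have w0: "0 \<le> w z" for z
    unfolding w_def using Y.avg_le_mx[of 0 N "\<lambda>z. \<bar>u z\<bar>" z] abs_ge_zero[of "u z"] by simp
  have "MM N u z \<le> X.mx N w z" for z
    unfolding MM_def
  proof (rule fmax_le)
    fix n m assume nm: "n \<le> N" "m \<le> N"
    have "\<bar>EE n m u z\<bar> \<le> EE n m (\<lambda>z. \<bar>u z\<bar>) z" by (rule abs_EE_le)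
    also have "\<dots> \<le> X.avg n w z"
      unfolding EE_def w_def by (intro X.avg_mono Y.avg_le_mx nm)
    also have "\<dots> \<le> X.mx N w z" by (intro X.avg_le_mx nm)
    finally show "\<bar>EE n m u z\<bar> \<le> X.mx N w z" .
  qed
  then have "(\<Sum>z\<in>grid N. MM N u z powr s) \<le> (\<Sum>z\<in>grid N. X.mx N w z powr s)"
    using s by (intro sum_mono powr_mono2) auto
  also have "\<dots> \<le> doob_const s * (\<Sum>z\<in>grid N. w z powr s)"
    unfolding doob_const_def by (intro X.doob saturated_grid s w0)
  also have "\<dots> \<le> doob_const s * (doob_const s * (\<Sum>z\<in>grid N. \<bar>u z\<bar> powr s))"
    unfolding w_def by (intro mult_left_mono, unfold doob_const_def) (intro Y.doob saturated_grid s, auto)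
  finally show ?thesis by (simp add: power2_eq_square)
qed

lemma strong_maximal_2: "(\<Sum>z\<in>grid N. (MM N u z)\<^sup>2) \<le> 16 * (\<Sum>z\<in>grid N. (u z)\<^sup>2)"
proof -
  have "doob_const 2 = 4" unfolding doob_const_def by (simp add: powr_numeral)
  then show ?thesis using strong_maximal[of 2 N u] by (simp add: powr_numeral)
qed

definition ind :: "'a set \<Rightarrow> 'a \<Rightarrow> real" where
  "ind A z = of_bool (z \<in> A)"

lemma sum_ind: "finite Z \<Longrightarrow> (\<Sum>z\<in>Z. ind A z) = card (A \<inter> Z)"
  unfolding ind_def of_bool_def by (simp add: sum.If_cases Int_def conj_commute)

text \<open>The weak type estimate, at one height and for indicators only, that lets a set be enlarged to
  all points with a rectangle around them that the set fills at least half.\<close>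

lemma card_half_dense_le:
  assumes "A \<subseteq> grid N"
  shows "card {z\<in>grid N. 1 / 2 \<le> MM N (ind A) z} \<le> 64 * real (card A)"
proof -
  have "card {z\<in>grid N. 1 / 2 \<le> MM N (ind A) z} = (\<Sum>z\<in>grid N. of_bool (1 / 2 \<le> MM N (ind A) z) :: real)"
    by (simp add: of_bool_def sum.If_cases Int_def)
  also have "\<dots> \<le> (\<Sum>z\<in>grid N. 4 * (MM N (ind A) z)\<^sup>2)"
  proof (intro sum_mono)
    fix z
    have "1 \<le> 4 * x\<^sup>2" if "1 / 2 \<le> x" for x :: real
      using mult_mono[of "1/2" x "1/2" x] that by (simp add: power2_eq_square)
    then show "of_bool (1 / 2 \<le> MM N (ind A) z) \<le> 4 * (MM N (ind A) z)\<^sup>2" by auto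
  qed
  also have "\<dots> = 4 * (\<Sum>z\<in>grid N. (MM N (ind A) z)\<^sup>2)" by (simp add: sum_distrib_left)
  also have "\<dots> \<le> 4 * (16 * (\<Sum>z\<in>grid N. (ind A z)\<^sup>2))"
    by (intro mult_left_mono strong_maximal_2) auto
  also have "(\<Sum>z\<in>grid N. (ind A z)\<^sup>2) = (\<Sum>z\<in>grid N. ind A z)"
    by (intro sum.cong) (auto simp: ind_def)
  also have "\<dots> = card A" using assms by (simp add: sum_ind Int_absorb2)
  finally show ?thesis by simp
qed

section \<open>The square function is controlled by the maximal function\<close>

definition SS :: "nat \<Rightarrow> (int \<times> int \<Rightarrow> real) \<Rightarrow> int \<times> int \<Rightarrow> real" where
  "SS N u z = (\<Sum>n<N. \<Sum>m<N. (DD n m u z)\<^sup>2)"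

lemma SS_nonneg [simp]: "0 \<le> SS N u z"
  unfolding SS_def by (intro sum_nonneg) auto

lemma energy_DD_le:
  "(\<Sum>n<N. \<Sum>m<N. \<Sum>z\<in>grid N. (DD n m u z)\<^sup>2) \<le> (\<Sum>z\<in>grid N. (u z)\<^sup>2)"
proof -
  have "(\<Sum>n<N. \<Sum>m<N. \<Sum>z\<in>grid N. (DD n m u z)\<^sup>2) = (\<Sum>m<N. \<Sum>n<N. \<Sum>z\<in>grid N. (X.dif n (Y.dif m u) z)\<^sup>2)"
    unfolding DD_def by (rule sum.swap)
  also have "\<dots> \<le> (\<Sum>m<N. \<Sum>z\<in>grid N. (Y.dif m u z)\<^sup>2)"
    by (intro sum_mono X.energy_le saturated_grid)
  also have "\<dots> \<le> (\<Sum>z\<in>grid N. (u z)\<^sup>2)"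
    by (intro Y.energy_le saturated_grid)
  finally show ?thesis .
qed

lemma sum_SS_le: "(\<Sum>z\<in>grid N. SS N u z) \<le> (\<Sum>z\<in>grid N. (u z)\<^sup>2)"
proof -
  have "(\<Sum>z\<in>grid N. SS N u z) = (\<Sum>n<N. \<Sum>m<N. \<Sum>z\<in>grid N. (DD n m u z)\<^sup>2)"
    unfolding SS_def by (subst sum.swap, intro sum.cong refl, rule sum.swap)
  then show ?thesis using energy_DD_le[of u N] by simp
qed

text \<open>This is the heart of the domination of the square function. The energy of \<open>u\<close> is weighted with
  averages of the indicator \<open>v\<close> of the set where the maximal function is small. Exchanging differences
  between \<open>u\<close> and \<open>v\<close> in the first variable, and then in the second, leaves
  \<open>u\<^sup>2\<close> on the support of \<open>v\<close> and terms in which an average of \<open>u\<close> multiplies a difference of \<open>v\<close>.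
  If that difference is not zero, the rectangle meets the support of \<open>v\<close>, so the average of \<open>u\<close> over it is at
  most \<open>l\<close>; and the energy of \<open>v\<close>, which is that of \<open>ind E\<close> up to sign, is at most the size of \<open>E\<close>.\<close>

lemma truncated_energy_le:
  fixes l :: real
  assumes small: "\<And>z. z \<in> grid N \<Longrightarrow> z \<notin> E \<Longrightarrow> MM N u z \<le> l"
  defines "v \<equiv> \<lambda>z. 1 - ind E z"
  shows "(\<Sum>n<N. \<Sum>m<N. \<Sum>z\<in>grid N. (EE (Suc n) (Suc m) v z * DD n m u z)\<^sup>2) \<le>
    4 * (\<Sum>z\<in>grid N. (u z * v z)\<^sup>2) + 252 * (l\<^sup>2 * card (E \<inter> grid N))"
proof -
  define L where "L = l\<^sup>2 * card (E \<inter> grid N)"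
  define A where "A = (\<Sum>z\<in>grid N. (u z * v z)\<^sup>2)"
  have bound: "(EE a b u z * d)\<^sup>2 \<le> l\<^sup>2 * d\<^sup>2"
    if ab: "a \<le> N" "b \<le> N" and z: "z \<in> grid N" and d: "(\<And>w. w \<in> rect a b z \<Longrightarrow> v w = 0) \<Longrightarrow> d = 0"
    for a b z d
  proof (cases "d = 0")
    case False
    then obtain w where w: "w \<in> rect a b z" "v w \<noteq> 0" using d by blast
    then have "w \<notin> E" by (auto simp: v_def ind_def)
    moreover have "w \<in> grid N" using w(1) rect_grid[OF z ab] by blast
    ultimately have "\<bar>EE a b u w\<bar> \<le> l" using small MM_ge[OF ab] order_trans by blast
    then have "\<bar>EE a b u z\<bar> \<le> l" using EE_const_on_rect[OF w(1)] by simp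
    then have "(EE a b u z)\<^sup>2 \<le> l\<^sup>2" by (metis abs_le_square_iff abs_of_nonneg abs_ge_zero order_trans)
    then show ?thesis by (simp add: power_mult_distrib mult_right_mono)
  qed simp
  define e where "e z = v z - 1" for z
  have e2: "(\<Sum>z\<in>grid N. (e z)\<^sup>2) = card (E \<inter> grid N)"
  proof -
    have "(\<Sum>z\<in>grid N. (e z)\<^sup>2) = (\<Sum>z\<in>grid N. ind E z)"
      by (intro sum.cong) (auto simp: e_def v_def ind_def)
    then show ?thesis by (simp add: sum_ind)
  qed
  have Yv: "Y.dif m v = Y.dif m e" for m
    unfolding e_def by (simp add: fun_eq_iff Y.dif_diff Y.dif_const)
  have Xv: "X.dif n v = X.dif n e" for n
    unfolding e_def by (simp add: fun_eq_iff X.dif_diff X.dif_const)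
  have z0: "EE a' b' v z = 0" if "\<And>w. w \<in> rect a b z \<Longrightarrow> v w = 0" "a' \<le> a" "b' \<le> b" for a b a' b' z
  proof -
    have "EE a' b' v z = EE a' b' (\<lambda>_. 0) z"
      using that rect_mono[of a' a b' b z] by (intro EE_cong) blast
    then show ?thesis by (simp add: EE_const)
  qed
  have T1: "(\<Sum>m<N. \<Sum>z\<in>grid N. (Y.avg (Suc m) u z * Y.dif m v z)\<^sup>2) \<le> L"
  proof -
    have "(\<Sum>m<N. \<Sum>z\<in>grid N. (Y.avg (Suc m) u z * Y.dif m v z)\<^sup>2) \<le>
        (\<Sum>m<N. \<Sum>z\<in>grid N. l\<^sup>2 * (Y.dif m v z)\<^sup>2)"
    proof (intro sum_mono)
      fix m z assume mz: "m \<in> {..<N}" "z \<in> grid N"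
      show "(Y.avg (Suc m) u z * Y.dif m v z)\<^sup>2 \<le> l\<^sup>2 * (Y.dif m v z)\<^sup>2"
        using bound[of 0 "Suc m" z "Y.dif m v z"] mz z0[of 0 "Suc m" z 0 m] z0[of 0 "Suc m" z 0 "Suc m"]
        by (simp add: EE_def Y.dif_def)
    qed
    also have "\<dots> = l\<^sup>2 * (\<Sum>m<N. \<Sum>z\<in>grid N. (Y.dif m e z)\<^sup>2)"
      by (simp add: sum_distrib_left Yv)
    also have "\<dots> \<le> L"
      unfolding L_def e2[symmetric] by (intro mult_left_mono Y.energy_le saturated_grid) auto
    finally show ?thesis .
  qed
  have T2: "(\<Sum>n<N. \<Sum>z\<in>grid N. (X.avg (Suc n) u z * X.dif n v z)\<^sup>2) \<le> L"
  proof -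
    have "(\<Sum>n<N. \<Sum>z\<in>grid N. (X.avg (Suc n) u z * X.dif n v z)\<^sup>2) \<le>
        (\<Sum>n<N. \<Sum>z\<in>grid N. l\<^sup>2 * (X.dif n v z)\<^sup>2)"
    proof (intro sum_mono)
      fix n z assume nz: "n \<in> {..<N}" "z \<in> grid N"
      show "(X.avg (Suc n) u z * X.dif n v z)\<^sup>2 \<le> l\<^sup>2 * (X.dif n v z)\<^sup>2"
        using bound[of "Suc n" 0 z "X.dif n v z"] nz z0[of "Suc n" 0 z n 0] z0[of "Suc n" 0 z "Suc n" 0]
        by (simp add: EE_def X.dif_def)
    qed
    also have "\<dots> = l\<^sup>2 * (\<Sum>n<N. \<Sum>z\<in>grid N. (X.dif n e z)\<^sup>2)"
      by (simp add: sum_distrib_left Xv)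
    also have "\<dots> \<le> L"
      unfolding L_def e2[symmetric] by (intro mult_left_mono X.energy_le saturated_grid) auto
    finally show ?thesis .
  qed
  have T3: "(\<Sum>n<N. \<Sum>m<N. \<Sum>z\<in>grid N. (EE (Suc n) (Suc m) u z * DD n m v z)\<^sup>2) \<le> L"
  proof -
    have "(\<Sum>n<N. \<Sum>m<N. \<Sum>z\<in>grid N. (EE (Suc n) (Suc m) u z * DD n m v z)\<^sup>2) \<le>
        (\<Sum>n<N. \<Sum>m<N. \<Sum>z\<in>grid N. l\<^sup>2 * (DD n m v z)\<^sup>2)"
    proof (intro sum_mono bound)
      fix n m z assume "n \<in> {..<N}" "m \<in> {..<N}" "\<And>w. w \<in> rect (Suc n) (Suc m) z \<Longrightarrow> v w = 0"
      then show "DD n m v z = 0" unfolding DD_eq_EE using z0[of "Suc n" "Suc m" z] by simp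
    qed auto
    also have "\<dots> = l\<^sup>2 * (\<Sum>n<N. \<Sum>m<N. \<Sum>z\<in>grid N. (DD n m e z)\<^sup>2)"
      by (simp add: sum_distrib_left DD_def Yv)
    also have "\<dots> \<le> L"
      unfolding L_def e2[symmetric] by (intro mult_left_mono energy_DD_le) auto
    finally show ?thesis .
  qed
  have "(\<Sum>n<N. \<Sum>m<N. \<Sum>z\<in>grid N. (EE (Suc n) (Suc m) v z * DD n m u z)\<^sup>2) =
      (\<Sum>m<N. \<Sum>n<N. \<Sum>z\<in>grid N. (X.avg (Suc n) (Y.avg (Suc m) v) z * X.dif n (Y.dif m u) z)\<^sup>2)"
    unfolding EE_def DD_def by (rule sum.swap)
  also have "\<dots> \<le> (\<Sum>m<N. 2 * (\<Sum>z\<in>grid N. (Y.dif m u z * Y.avg (Suc m) v z)\<^sup>2) +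
      14 * (\<Sum>n<N. \<Sum>z\<in>grid N. (X.avg (Suc n) (Y.dif m u) z * X.dif n (Y.avg (Suc m) v) z)\<^sup>2))"
    by (intro sum_mono X.exchange_le saturated_grid)
  also have "\<dots> = 2 * (\<Sum>m<N. \<Sum>z\<in>grid N. (Y.avg (Suc m) v z * Y.dif m u z)\<^sup>2) +
      14 * (\<Sum>n<N. \<Sum>m<N. \<Sum>z\<in>grid N. (Y.avg (Suc m) (X.dif n v) z * Y.dif m (X.avg (Suc n) u) z)\<^sup>2)"
    unfolding avg_dif_commute dif_avg_commute sum.distrib sum_distrib_left[symmetric]
    by (simp add: mult.commute) (rule sum.swap)
  also have "\<dots> \<le> 2 * (2 * A + 14 * L) +
      14 * (\<Sum>n<N. 2 * (\<Sum>z\<in>grid N. (X.avg (Suc n) u z * X.dif n v z)\<^sup>2) +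
        14 * (\<Sum>m<N. \<Sum>z\<in>grid N. (Y.avg (Suc m) (X.avg (Suc n) u) z * Y.dif m (X.dif n v) z)\<^sup>2))"
  proof (intro add_mono mult_left_mono sum_mono)
    have "(\<Sum>m<N. \<Sum>z\<in>grid N. (Y.avg (Suc m) v z * Y.dif m u z)\<^sup>2) \<le>
       2 * A + 14 * (\<Sum>m<N. \<Sum>z\<in>grid N. (Y.avg (Suc m) u z * Y.dif m v z)\<^sup>2)"
      unfolding A_def by (intro Y.exchange_le saturated_grid)
    then show "(\<Sum>m<N. \<Sum>z\<in>grid N. (Y.avg (Suc m) v z * Y.dif m u z)\<^sup>2) \<le> 2 * A + 14 * L"
      using T1 by linarith
  qed (intro Y.exchange_le saturated_grid | simp)+
  also have "\<dots> = 2 * (2 * A + 14 * L) + 14 * (2 * (\<Sum>n<N. \<Sum>z\<in>grid N. (X.avg (Suc n) u z * X.dif n v z)\<^sup>2) +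
        14 * (\<Sum>n<N. \<Sum>m<N. \<Sum>z\<in>grid N. (EE (Suc n) (Suc m) u z * DD n m v z)\<^sup>2))"
    unfolding sum.distrib sum_distrib_left[symmetric] EE_def DD_def avg_commute dif_commute ..
  also have "\<dots> \<le> 2 * (2 * A + 14 * L) + 14 * (2 * L + 14 * L)"
    using T2 T3 by (intro add_mono mult_left_mono) auto
  finally show ?thesis by (simp add: A_def L_def)
qed

text \<open>Off the enlargement \<open>F\<close> of the set \<open>E\<close> where the maximal function exceeds \<open>l\<close>, every
  rectangle around the point lies at least half outside \<open>E\<close>. There
  the weights of \<open>truncated_energy_le\<close> are bounded below and Chebyshev's inequality applies.\<close>

lemma square_distribution_le:
  fixes l :: real
  assumes l: "0 < l"
  shows "card {z\<in>grid N. l < sqrt (SS N u z)} \<le> 1072 * (\<Sum>z\<in>grid N. min 1 ((MM N u z / l)\<^sup>2))"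
proof -
  define E where "E = {z\<in>grid N. l < MM N u z}"
  define F where "F = {z\<in>grid N. 1 / 2 \<le> MM N (ind E) z}"
  define v where "v z = 1 - ind E z" for z
  have EG: "E \<inter> grid N = E" "E \<subseteq> grid N" "finite E" by (auto simp: E_def)
  have FG: "F \<subseteq> grid N" "finite F" by (auto simp: F_def)
  have F: "card F \<le> 64 * real (card E)" unfolding F_def by (rule card_half_dense_le[OF EG(2)])
  have EEv: "1 / 2 \<le> EE a b v z" if "z \<in> grid N - F" "a \<le> N" "b \<le> N" for a b z
  proof -
    have "EE a b (ind E) z < 1 / 2" using that MM_ge[of a N b "ind E" z] by (auto simp: F_def)
    then show ?thesis unfolding v_def EE_diff EE_const by simp
  qed
  have "(\<Sum>z\<in>grid N - F. SS N u z) \<le> (\<Sum>z\<in>grid N - F. \<Sum>n<N. \<Sum>m<N. 4 * (EE (Suc n) (Suc m) v z * DD n m u z)\<^sup>2)"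
    unfolding SS_def
  proof (intro sum_mono)
    fix z n m assume z: "z \<in> grid N - F" "n \<in> {..<N}" "m \<in> {..<N}"
    have h: "1 / 2 \<le> EE (Suc n) (Suc m) v z" using z by (intro EEv) auto
    have "1 \<le> 4 * (EE (Suc n) (Suc m) v z)\<^sup>2"
      using mult_mono[OF h h] h by (simp add: power2_eq_square)
    then have "1 * (DD n m u z)\<^sup>2 \<le> 4 * (EE (Suc n) (Suc m) v z)\<^sup>2 * (DD n m u z)\<^sup>2"
      by (intro mult_right_mono) auto
    then show "(DD n m u z)\<^sup>2 \<le> 4 * (EE (Suc n) (Suc m) v z * DD n m u z)\<^sup>2"
      by (simp add: power_mult_distrib)
  qed
  also have "\<dots> \<le> (\<Sum>z\<in>grid N. \<Sum>n<N. \<Sum>m<N. 4 * (EE (Suc n) (Suc m) v z * DD n m u z)\<^sup>2)"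
    by (intro sum_mono2) (auto intro!: sum_nonneg)
  also have "\<dots> = 4 * (\<Sum>n<N. \<Sum>m<N. \<Sum>z\<in>grid N. (EE (Suc n) (Suc m) v z * DD n m u z)\<^sup>2)"
    unfolding sum_distrib_left by (subst sum.swap, intro sum.cong refl, rule sum.swap)
  also have "\<dots> \<le> 4 * (4 * (\<Sum>z\<in>grid N. (u z * v z)\<^sup>2) + 252 * (l\<^sup>2 * card E))"
    using truncated_energy_le[of N E u l] unfolding v_def[abs_def] EG(1)
    by (intro mult_left_mono) (auto simp: E_def)
  finally have 1: "(\<Sum>z\<in>grid N - F. SS N u z) \<le> 16 * (\<Sum>z\<in>grid N. (u z * v z)\<^sup>2) + 1008 * (l\<^sup>2 * card E)"
    by simp
  define H where "H = {z\<in>grid N - F. l < sqrt (SS N u z)}"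
  have "l\<^sup>2 * card H = (\<Sum>z\<in>H. l\<^sup>2)" by simp
  also have "\<dots> \<le> (\<Sum>z\<in>H. SS N u z)"
  proof (intro sum_mono)
    fix z assume "z \<in> H"
    then have "l \<le> sqrt (SS N u z)" by (simp add: H_def)
    then have "l\<^sup>2 \<le> (sqrt (SS N u z))\<^sup>2" using l by (intro power_mono) auto
    then show "l\<^sup>2 \<le> SS N u z" by simp
  qed
  also have "\<dots> \<le> (\<Sum>z\<in>grid N - F. SS N u z)"
    by (intro sum_mono2) (auto simp: H_def)
  finally have "l\<^sup>2 * card H \<le> 16 * (\<Sum>z\<in>grid N. (u z * v z)\<^sup>2) + 1008 * (l\<^sup>2 * card E)"
    using 1 by linarith
  also have "\<dots> = l\<^sup>2 * (16 * (\<Sum>z\<in>grid N. (u z * v z / l)\<^sup>2) + 1008 * card E)"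
    using l by (simp add: power_divide sum_divide_distrib[symmetric] field_simps)
  finally have 2: "card H \<le> 16 * (\<Sum>z\<in>grid N. (u z * v z / l)\<^sup>2) + 1008 * card E"
    using l by simp
  have "{z\<in>grid N. l < sqrt (SS N u z)} \<subseteq> F \<union> H" by (auto simp: H_def)
  then have "card {z\<in>grid N. l < sqrt (SS N u z)} \<le> card (F \<union> H)"
    using FG by (intro card_mono) (auto simp: H_def)
  also have "\<dots> \<le> card F + card H" by (rule card_Un_le)
  finally have "real (card {z\<in>grid N. l < sqrt (SS N u z)}) \<le>
      1072 * real (card E) + 16 * (\<Sum>z\<in>grid N. (u z * v z / l)\<^sup>2)"
    using 2 F by linarith
  also have "\<dots> = (\<Sum>z\<in>grid N. 1072 * ind E z + 16 * (u z * v z / l)\<^sup>2)"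
    by (simp add: sum.distrib sum_distrib_left[symmetric] sum_ind EG)
  also have "\<dots> \<le> (\<Sum>z\<in>grid N. 1072 * min 1 ((MM N u z / l)\<^sup>2))"
  proof (intro sum_mono)
    fix z assume z: "z \<in> grid N"
    show "1072 * ind E z + 16 * (u z * v z / l)\<^sup>2 \<le> 1072 * min 1 ((MM N u z / l)\<^sup>2)"
    proof (cases "z \<in> E")
      case True
      then have "1 \<le> MM N u z / l" using l by (simp add: E_def)
      then have "1 \<le> (MM N u z / l)\<^sup>2" by (rule one_le_power)
      then show ?thesis using True by (simp add: v_def ind_def)
    next
      case False
      then have le: "MM N u z / l \<le> 1" using l z by (simp add: E_def)
      have "\<bar>u z / l\<bar> \<le> MM N u z / l" using l abs_le_MM[of u z N] by (simp add: divide_right_mono)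
      then have "(u z / l)\<^sup>2 \<le> (MM N u z / l)\<^sup>2" by (metis abs_ge_zero power2_abs power_mono)
      moreover have "(MM N u z / l)\<^sup>2 \<le> 1" using le l by (intro power_le_one) auto
      moreover have "0 \<le> (MM N u z / l)\<^sup>2" by simp
      moreover have "u z * v z / l = u z / l" "ind E z = 0" using False by (simp_all add: v_def ind_def)
      ultimately show ?thesis by (simp only: min_absorb2)
    qed
  qed
  finally show ?thesis by (simp add: sum_distrib_left)
qed

lemma square_le_maximal_low:
  assumes p: "0 < p" "p < 2"
  shows "(\<Sum>z\<in>grid N. SS N u z powr (p / 2)) \<le> 1072 * layer_const p * (\<Sum>z\<in>grid N. MM N u z powr p)"
proof -
  have "(\<Sum>z\<in>grid N. sqrt (SS N u z) powr p) \<le> 1072 * layer_const p * (\<Sum>z\<in>grid N. MM N u z powr p)"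
    using square_distribution_le by (intro sum_powr_le_of_distribution p) auto
  then show ?thesis by (simp add: powr_half_sqrt[symmetric] powr_powr)
qed

section \<open>The maximal function is controlled by the square function\<close>

text \<open>As \<open>DD n m\<close> is a projection, \<open>T n m\<close> is an arbitrary combination of the Haar functions of the
  rectangles of levels \<open>Suc n\<close> and \<open>Suc m\<close>.\<close>

definition haar_family :: "nat \<Rightarrow> (nat \<Rightarrow> nat \<Rightarrow> int \<times> int \<Rightarrow> real) \<Rightarrow> bool" where
  "haar_family N T \<longleftrightarrow> (\<forall>n<N. \<forall>m<N. DD n m (T n m) = T n m)"

definition haar_sum :: "nat \<Rightarrow> (nat \<Rightarrow> nat \<Rightarrow> int \<times> int \<Rightarrow> real) \<Rightarrow> int \<times> int \<Rightarrow> real" where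
  "haar_sum N T z = (\<Sum>n<N. \<Sum>m<N. T n m z)"

definition square_sum :: "nat \<Rightarrow> (nat \<Rightarrow> nat \<Rightarrow> int \<times> int \<Rightarrow> real) \<Rightarrow> int \<times> int \<Rightarrow> real" where
  "square_sum N T z = (\<Sum>n<N. \<Sum>m<N. (T n m z)\<^sup>2)"

lemma square_sum_nonneg [simp]: "0 \<le> square_sum N T z"
  unfolding square_sum_def by (intro sum_nonneg) auto

lemma haar_familyD: "haar_family N T \<Longrightarrow> n < N \<Longrightarrow> m < N \<Longrightarrow> DD n m (T n m) = T n m"
  by (simp add: haar_family_def)

lemma haar_family_DD: "haar_family N (\<lambda>n m. DD n m u)"
  by (simp add: haar_family_def fun_eq_iff DD_DD)

lemma haar_family_cmult: "haar_family N T \<Longrightarrow> haar_family N (\<lambda>n m z. c n m * T n m z)"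
  by (simp add: haar_family_def fun_eq_iff DD_cmult)

lemma haar_family_mult:
  assumes "haar_family N T" "\<And>n m. n < N \<Longrightarrow> m < N \<Longrightarrow> MEAS (Suc n) (Suc m) (w n m)"
  shows "haar_family N (\<lambda>n m z. w n m z * T n m z)"
  using assms by (simp add: haar_family_def fun_eq_iff DD_MEAS_mult)

lemma EE_haar_family:
  assumes "haar_family N T" "n < N" "m < N"
  shows "EE a b (T n m) z = (if a \<le> n \<and> b \<le> m then T n m z else 0)"
  using EE_DD[of a b n m "T n m" z] haar_familyD[OF assms] by simp

lemma EE_haar_sum:
  assumes "haar_family N T"
  shows "EE a b (haar_sum N T) z = (\<Sum>n<N. \<Sum>m<N. if a \<le> n \<and> b \<le> m then T n m z else 0)"
  unfolding haar_sum_def[abs_def] EE_sum using assms by (intro sum.cong refl EE_haar_family) auto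

lemma DD_haar_sum:
  assumes T: "haar_family N T" and nm: "n < N" "m < N"
  shows "DD n m (haar_sum N T) z = T n m z"
proof -
  have "DD n m (haar_sum N T) z = (\<Sum>i<N. \<Sum>j<N. DD n m (T i j) z)"
    unfolding haar_sum_def[abs_def] DD_sum ..
  also have "\<dots> = (\<Sum>i<N. \<Sum>j<N. if n = i \<and> m = j then T i j z else 0)"
    using DD_DD[of n m] haar_familyD[OF T] by (intro sum.cong refl) (metis lessThan_iff)
  also have "\<dots> = (\<Sum>i<N. if i = n then (\<Sum>j<N. if j = m then T i j z else 0) else 0)"
    by (intro sum.cong refl) auto
  also have "\<dots> = T n m z" using nm by simp
  finally show ?thesis .
qed

lemma SS_haar_sum:
  assumes "haar_family N T"
  shows "SS N (haar_sum N T) z = square_sum N T z"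
  unfolding SS_def square_sum_def using DD_haar_sum[OF assms] by (intro sum.cong refl) auto

text \<open>Plancherel's identity for the Haar system.\<close>

lemma sum_haar_sum_mult:
  assumes T: "haar_family N T"
  shows "(\<Sum>z\<in>grid N. haar_sum N T z * \<phi> z) = (\<Sum>z\<in>grid N. \<Sum>n<N. \<Sum>m<N. T n m z * DD n m \<phi> z)"
proof -
  have "(\<Sum>z\<in>grid N. haar_sum N T z * \<phi> z) = (\<Sum>n<N. \<Sum>m<N. \<Sum>z\<in>grid N. T n m z * \<phi> z)"
    unfolding haar_sum_def sum_distrib_right by (subst sum.swap, intro sum.cong refl, rule sum.swap)
  also have "\<dots> = (\<Sum>n<N. \<Sum>m<N. \<Sum>z\<in>grid N. T n m z * DD n m \<phi> z)"
  proof (rule sum.cong[OF refl], rule sum.cong[OF refl])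
    fix n m assume nm: "n \<in> {..<N}" "m \<in> {..<N}"
    have "(\<Sum>z\<in>grid N. T n m z * DD n m \<phi> z) = (\<Sum>z\<in>grid N. DD n m (T n m) z * \<phi> z)"
      using nm by (intro sum_DD_adjoint) auto
    then show "(\<Sum>z\<in>grid N. T n m z * \<phi> z) = (\<Sum>z\<in>grid N. T n m z * DD n m \<phi> z)"
      using haar_familyD[OF T] nm by simp
  qed
  also have "\<dots> = (\<Sum>z\<in>grid N. \<Sum>n<N. \<Sum>m<N. T n m z * DD n m \<phi> z)"
    by (subst (2) sum.swap, intro sum.cong refl, rule sum.swap)
  finally show ?thesis .
qed

lemma sum_haar_sum_square:
  assumes T: "haar_family N T"
  shows "(\<Sum>z\<in>grid N. (haar_sum N T z)\<^sup>2) = (\<Sum>z\<in>grid N. square_sum N T z)"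
proof -
  have "(\<Sum>z\<in>grid N. (haar_sum N T z)\<^sup>2) = (\<Sum>z\<in>grid N. \<Sum>n<N. \<Sum>m<N. T n m z * DD n m (haar_sum N T) z)"
    unfolding power2_eq_square by (rule sum_haar_sum_mult[OF T])
  also have "\<dots> = (\<Sum>z\<in>grid N. square_sum N T z)"
    unfolding square_sum_def using DD_haar_sum[OF T] by (intro sum.cong refl) (auto simp: power2_eq_square)
  finally show ?thesis .
qed

text \<open>Let \<open>\<Omega>\<close> be the set where the square function exceeds \<open>l\<close>, and call a rectangle bad if \<open>\<Omega>\<close> fills at
  least half of it. The average of a Haar function vanishes over every rectangle that is not properly inside
  its own in both directions; so the bad part has averages only over rectangles inside the enlargement \<open>F\<close> of
  \<open>\<Omega>\<close> and does not change the maximal function elsewhere. The good part is estimated in \<open>\<ell>\<^sup>2\<close>: since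
  at least half of each good rectangle is outside \<open>\<Omega>\<close>, its energy is controlled by the
  square function there.\<close>

lemma maximal_distribution_le:
  fixes l :: real
  assumes T: "haar_family N T" and l: "0 < l"
  shows "card {z\<in>grid N. l < MM N (haar_sum N T) z} \<le>
    64 * (\<Sum>z\<in>grid N. min 1 ((sqrt (square_sum N T z) / l)\<^sup>2))"
proof -
  define \<Omega> where "\<Omega> = {z\<in>grid N. l < sqrt (square_sum N T z)}"
  define F where "F = {z\<in>grid N. 1 / 2 \<le> MM N (ind \<Omega>) z}"
  define good :: "nat \<Rightarrow> nat \<Rightarrow> int \<times> int \<Rightarrow> real"
    where "good n m z = of_bool (EE (Suc n) (Suc m) (ind \<Omega>) z < 1 / 2)" for n m z
  define T' where "T' n m z = good n m z * T n m z" for n m z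
  have \<Omega>: "\<Omega> \<inter> grid N = \<Omega>" "\<Omega> \<subseteq> grid N" by (auto simp: \<Omega>_def)
  have F: "card F \<le> 64 * real (card \<Omega>)" unfolding F_def by (rule card_half_dense_le[OF \<Omega>(2)])
  have good_meas: "MEAS (Suc n) (Suc m) (\<lambda>z. F (good n m z))" for n m and F :: "real \<Rightarrow> real"
    unfolding good_def[abs_def]
    using MEAS_fun[OF MEAS_EE[of "Suc n" "Suc m" "ind \<Omega>"], of "\<lambda>x. F (of_bool (x < 1 / 2))"] .
  have T': "haar_family N T'"
    unfolding T'_def[abs_def] using good_meas[where F = "\<lambda>x. x"] by (intro haar_family_mult T) auto
  have same: "MM N (haar_sum N T) z = MM N (haar_sum N T') z" if z: "z \<in> grid N - F" for z
  proof -
    have eq: "T' n m z = T n m z" if "n < N" "m < N" for n m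
      using MM_ge[of "Suc n" N "Suc m" "ind \<Omega>" z] z that by (auto simp: T'_def good_def F_def)
    have "EE a b (haar_sum N T) z = EE a b (haar_sum N T') z" for a b
      unfolding EE_haar_sum[OF T] EE_haar_sum[OF T'] using eq by (intro sum.cong refl) auto
    then show ?thesis unfolding MM_def fmax_def by simp
  qed
  have "(\<Sum>z\<in>grid N. square_sum N T' z) \<le> 2 * (\<Sum>z\<in>grid N - \<Omega>. square_sum N T z)"
  proof -
    have part: "(\<Sum>z\<in>grid N. (T' n m z)\<^sup>2) \<le> (\<Sum>z\<in>grid N. 2 * ((1 - ind \<Omega> z) * (T n m z)\<^sup>2))"
      if nm: "n < N" "m < N" for n m
    proof -
      let ?w = "\<lambda>z. good n m z * (T n m z)\<^sup>2"
      have m: "MEAS (Suc n) (Suc m) (\<lambda>z. (T n m z)\<^sup>2)"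
        using MEAS_DD_square[of n m "T n m"] haar_familyD[OF T nm] by simp
      have w: "MEAS (Suc n) (Suc m) ?w"
        using MEAS_combine[OF good_meas[where F = "\<lambda>x. x" and n = n and m = m] m, of "(*)"] .
      have "(T' n m z)\<^sup>2 \<le> 2 * (?w z * EE (Suc n) (Suc m) (\<lambda>z. 1 - ind \<Omega> z) z)" for z
        using mult_left_mono[of 1 "2 * (1 - EE (Suc n) (Suc m) (ind \<Omega>) z)" "(T n m z)\<^sup>2"]
        unfolding T'_def good_def EE_diff EE_const by (simp add: algebra_simps)
      then have "(\<Sum>z\<in>grid N. (T' n m z)\<^sup>2) \<le>
         2 * (\<Sum>z\<in>grid N. ?w z * EE (Suc n) (Suc m) (\<lambda>z. 1 - ind \<Omega> z) z)"
        unfolding sum_distrib_left by (intro sum_mono)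
      also have "\<dots> = (\<Sum>z\<in>grid N. 2 * (?w z * (1 - ind \<Omega> z)))"
        using sum_MEAS_EE[OF w, of N] nm by (simp add: sum_distrib_left)
      also have "\<dots> \<le> (\<Sum>z\<in>grid N. 2 * ((1 - ind \<Omega> z) * (T n m z)\<^sup>2))"
        by (intro sum_mono) (auto simp: good_def ind_def)
      finally show ?thesis .
    qed
    have "(\<Sum>z\<in>grid N. square_sum N T' z) = (\<Sum>n<N. \<Sum>m<N. \<Sum>z\<in>grid N. (T' n m z)\<^sup>2)"
      unfolding square_sum_def by (subst sum.swap, intro sum.cong refl, rule sum.swap)
    also have "\<dots> \<le> (\<Sum>n<N. \<Sum>m<N. \<Sum>z\<in>grid N. 2 * ((1 - ind \<Omega> z) * (T n m z)\<^sup>2))"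
      by (intro sum_mono part) auto
    also have "\<dots> = (\<Sum>z\<in>grid N. \<Sum>n<N. \<Sum>m<N. 2 * ((1 - ind \<Omega> z) * (T n m z)\<^sup>2))"
      by (subst (2) sum.swap, intro sum.cong refl, rule sum.swap)
    also have "\<dots> = 2 * (\<Sum>z\<in>grid N. (1 - ind \<Omega> z) * square_sum N T z)"
      unfolding square_sum_def sum_distrib_left ..
    also have "(\<Sum>z\<in>grid N. (1 - ind \<Omega> z) * square_sum N T z) = (\<Sum>z\<in>grid N - \<Omega>. square_sum N T z)"
      by (intro sum.mono_neutral_cong_right) (auto simp: ind_def)
    finally show ?thesis .
  qed
  moreover have "(\<Sum>z\<in>grid N. (MM N (haar_sum N T') z)\<^sup>2) \<le> 16 * (\<Sum>z\<in>grid N. square_sum N T' z)"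
    using strong_maximal_2[of N "haar_sum N T'"] unfolding sum_haar_sum_square[OF T'] .
  ultimately have L2: "(\<Sum>z\<in>grid N. (MM N (haar_sum N T') z)\<^sup>2) \<le> 32 * (\<Sum>z\<in>grid N - \<Omega>. square_sum N T z)"
    by linarith
  define H where "H = {z\<in>grid N - F. l < MM N (haar_sum N T) z}"
  have "l\<^sup>2 * card H = (\<Sum>z\<in>H. l\<^sup>2)" by simp
  also have "\<dots> \<le> (\<Sum>z\<in>H. (MM N (haar_sum N T') z)\<^sup>2)"
    using l same by (intro sum_mono power_mono) (auto simp: H_def)
  also have "\<dots> \<le> (\<Sum>z\<in>grid N. (MM N (haar_sum N T') z)\<^sup>2)"
    by (intro sum_mono2) (auto simp: H_def)
  finally have "l\<^sup>2 * card H \<le> 32 * (\<Sum>z\<in>grid N - \<Omega>. square_sum N T z)" using L2 by linarith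
  also have "\<dots> = l\<^sup>2 * (32 * (\<Sum>z\<in>grid N - \<Omega>. square_sum N T z / l\<^sup>2))"
    using l by (simp add: sum_divide_distrib[symmetric])
  finally have 2: "card H \<le> 32 * (\<Sum>z\<in>grid N - \<Omega>. square_sum N T z / l\<^sup>2)" using l by simp
  have "{z\<in>grid N. l < MM N (haar_sum N T) z} \<subseteq> F \<union> H" by (auto simp: H_def)
  then have "card {z\<in>grid N. l < MM N (haar_sum N T) z} \<le> card (F \<union> H)"
    by (intro card_mono) (auto simp: H_def F_def)
  also have "\<dots> \<le> card F + card H" by (rule card_Un_le)
  finally have "real (card {z\<in>grid N. l < MM N (haar_sum N T) z}) \<le>
      64 * real (card \<Omega>) + 32 * (\<Sum>z\<in>grid N - \<Omega>. square_sum N T z / l\<^sup>2)"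
    using 2 F by linarith
  also have "\<dots> \<le> 64 * (\<Sum>z\<in>\<Omega>. 1) + 64 * (\<Sum>z\<in>grid N - \<Omega>. square_sum N T z / l\<^sup>2)"
    by (simp add: sum_nonneg)
  also have "(\<Sum>z\<in>\<Omega>. 1) = (\<Sum>z\<in>\<Omega>. min 1 ((sqrt (square_sum N T z) / l)\<^sup>2))"
  proof (intro sum.cong refl)
    fix z assume "z \<in> \<Omega>"
    then have "1 \<le> sqrt (square_sum N T z) / l" using l by (simp add: \<Omega>_def)
    then have "1 \<le> (sqrt (square_sum N T z) / l)\<^sup>2" by (rule one_le_power)
    then show "1 = min 1 ((sqrt (square_sum N T z) / l)\<^sup>2)" by simp
  qed
  also have "(\<Sum>z\<in>grid N - \<Omega>. square_sum N T z / l\<^sup>2) =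
     (\<Sum>z\<in>grid N - \<Omega>. min 1 ((sqrt (square_sum N T z) / l)\<^sup>2))"
  proof (intro sum.cong refl)
    fix z assume "z \<in> grid N - \<Omega>"
    then have "sqrt (square_sum N T z) / l \<le> 1" using l by (auto simp: \<Omega>_def)
    then have "(sqrt (square_sum N T z) / l)\<^sup>2 \<le> 1" using l by (intro power_le_one) auto
    then show "square_sum N T z / l\<^sup>2 = min 1 ((sqrt (square_sum N T z) / l)\<^sup>2)"
      by (simp add: power_divide min_def)
  qed
  finally show ?thesis
    using sum.subset_diff[OF \<Omega>(2) finite_grid, of "\<lambda>z. min 1 ((sqrt (square_sum N T z) / l)\<^sup>2)"] by simp
qed

lemma maximal_le_square_low:
  assumes p: "0 < p" "p < 2" and T: "haar_family N T"
  shows "(\<Sum>z\<in>grid N. MM N (haar_sum N T) z powr p) \<le>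
    64 * layer_const p * (\<Sum>z\<in>grid N. square_sum N T z powr (p / 2))"
proof -
  have "(\<Sum>z\<in>grid N. MM N (haar_sum N T) z powr p) \<le>
    64 * layer_const p * (\<Sum>z\<in>grid N. sqrt (square_sum N T z) powr p)"
    using maximal_distribution_le[OF T] by (intro sum_powr_le_of_distribution p) auto
  then show ?thesis by (simp add: powr_half_sqrt[symmetric] powr_powr)
qed

section \<open>Large exponents by duality\<close>

text \<open>The function for which Hoelder's inequality is an equality; tested against \<open>u\<close> it gives the sum of
  the \<open>p\<close>-th powers.\<close>

definition norming :: "real \<Rightarrow> ('a \<Rightarrow> real) \<Rightarrow> 'a \<Rightarrow> real" where
  "norming p u z = sgn (u z) * \<bar>u z\<bar> powr (p - 1)"

lemma mult_norming:
  assumes "1 < p"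
  shows "u z * norming p u z = \<bar>u z\<bar> powr p"
proof -
  have "u z * norming p u z = \<bar>u z\<bar> * \<bar>u z\<bar> powr (p - 1)"
    unfolding norming_def mult.assoc[symmetric] by (simp only: abs_sgn)
  also have "\<dots> = \<bar>u z\<bar> powr p" using assms by (cases "u z = 0") (auto simp: powr_mult_base)
  finally show ?thesis .
qed

lemma abs_norming_powr: "1 < p \<Longrightarrow> \<bar>norming p u z\<bar> powr (p / (p - 1)) = \<bar>u z\<bar> powr p"
  by (cases "u z = 0") (auto simp: norming_def abs_mult powr_powr)

lemma conjugate_exponent:
  fixes p :: real
  assumes "2 < p"
  shows "1 < p / (p - 1)" "p / (p - 1) < 2"
  using assms by (auto simp: field_simps)

definition low_const :: "real \<Rightarrow> real" where
  "low_const s = 1072 * layer_const s * (doob_const s)\<^sup>2"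

lemma square_le_lp_low:
  assumes s: "1 < s" "s < 2"
  shows "(\<Sum>z\<in>grid N. SS N u z powr (s / 2)) \<le> low_const s * (\<Sum>z\<in>grid N. \<bar>u z\<bar> powr s)"
proof -
  have "(\<Sum>z\<in>grid N. SS N u z powr (s / 2)) \<le> 1072 * layer_const s * (\<Sum>z\<in>grid N. MM N u z powr s)"
    using s by (intro square_le_maximal_low) auto
  also have "\<dots> \<le> 1072 * layer_const s * ((doob_const s)\<^sup>2 * (\<Sum>z\<in>grid N. \<bar>u z\<bar> powr s))"
    using s layer_const_pos[of s] by (intro mult_left_mono strong_maximal) auto
  finally show ?thesis by (simp add: low_const_def)
qed

text \<open>By Plancherel and the inequalities of Cauchy-Schwarz and Hoelder, the bound is dual to the bound of
  the square function by the maximal function for the conjugate exponent, which is below two.\<close>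

lemma lp_le_square_high:
  assumes p: "2 < p" and T: "haar_family N T"
  shows "(\<Sum>z\<in>grid N. \<bar>haar_sum N T z\<bar> powr p) \<le>
    low_const (p / (p - 1)) powr (p - 1) * (\<Sum>z\<in>grid N. square_sum N T z powr (p / 2))"
proof -
  define s where "s = p / (p - 1)"
  have s: "1 < s" "s < 2" unfolding s_def using conjugate_exponent[OF p] by auto
  have e: "p * (1 - 1 / p) = p - 1" using p by (simp add: field_simps)
  define u where "u = haar_sum N T"
  define \<phi> where "\<phi> = norming p u"
  define U where "U = (\<Sum>z\<in>grid N. \<bar>u z\<bar> powr p)"
  define Q where "Q = (\<Sum>z\<in>grid N. square_sum N T z powr (p / 2))"
  have K0: "0 < low_const s"
    unfolding low_const_def doob_const_def using layer_const_pos[of s] s by simp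
  have "U = (\<Sum>z\<in>grid N. u z * \<phi> z)" unfolding U_def \<phi>_def using p by (simp add: mult_norming)
  also have "\<dots> = (\<Sum>z\<in>grid N. \<Sum>n<N. \<Sum>m<N. T n m z * DD n m \<phi> z)"
    unfolding u_def by (rule sum_haar_sum_mult[OF T])
  also have "\<dots> \<le> (\<Sum>z\<in>grid N. sqrt (square_sum N T z) * sqrt (SS N \<phi> z))"
  proof (intro sum_mono)
    fix z
    have "(\<Sum>n<N. \<Sum>m<N. T n m z * DD n m \<phi> z) = (\<Sum>i\<in>{..<N} \<times> {..<N}. T (fst i) (snd i) z * DD (fst i) (snd i) \<phi> z)"
      by (simp add: sum.cartesian_product')
    also have "\<dots>\<^sup>2 \<le> (\<Sum>i\<in>{..<N} \<times> {..<N}. (T (fst i) (snd i) z)\<^sup>2) * (\<Sum>i\<in>{..<N} \<times> {..<N}. (DD (fst i) (snd i) \<phi> z)\<^sup>2)"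
      by (rule Cauchy_Schwarz_ineq_sum)
    also have "\<dots> = square_sum N T z * SS N \<phi> z"
      by (simp add: sum.cartesian_product' square_sum_def SS_def)
    finally show "(\<Sum>n<N. \<Sum>m<N. T n m z * DD n m \<phi> z) \<le> sqrt (square_sum N T z) * sqrt (SS N \<phi> z)"
      unfolding real_sqrt_mult[symmetric] by (rule real_le_rsqrt)
  qed
  also have "\<dots> \<le> (\<Sum>z\<in>grid N. sqrt (square_sum N T z) powr p) powr (1 / p) *
     (\<Sum>z\<in>grid N. sqrt (SS N \<phi> z) powr (p / (p - 1))) powr (1 - 1 / p)"
    using p by (intro Hoelder_sum_conjugate) auto
  also have "(\<Sum>z\<in>grid N. sqrt (square_sum N T z) powr p) = Q"
    unfolding Q_def by (simp add: powr_half_sqrt[symmetric] powr_powr)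
  also have "(\<Sum>z\<in>grid N. sqrt (SS N \<phi> z) powr (p / (p - 1))) = (\<Sum>z\<in>grid N. SS N \<phi> z powr (s / 2))"
    unfolding s_def by (simp add: powr_half_sqrt[symmetric] powr_powr mult.commute)
  also have "Q powr (1 / p) * (\<Sum>z\<in>grid N. SS N \<phi> z powr (s / 2)) powr (1 - 1 / p) \<le>
      Q powr (1 / p) * (low_const s * U) powr (1 - 1 / p)"
  proof (intro mult_left_mono powr_mono2)
    show "(\<Sum>z\<in>grid N. SS N \<phi> z powr (s / 2)) \<le> low_const s * U"
      using square_le_lp_low[OF s, of N \<phi>] abs_norming_powr[of p u] p by (simp add: U_def \<phi>_def s_def)
  qed (use p in \<open>auto intro: sum_nonneg\<close>)
  also have "(low_const s * U) powr (1 - 1 / p) = low_const s powr (1 - 1 / p) * U powr (1 - 1 / p)"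
    by (simp add: powr_mult)
  finally have "U \<le> (Q powr (1 / p) * low_const s powr (1 - 1 / p)) * U powr (1 - 1 / p)"
    by (simp only: mult.assoc)
  then have "U powr (1 - (1 - 1 / p)) \<le> Q powr (1 / p) * low_const s powr (1 - 1 / p)"
    using p by (intro powr_absorb) (auto simp: U_def intro: sum_nonneg)
  then have "(U powr (1 / p)) powr p \<le> (Q powr (1 / p) * low_const s powr (1 - 1 / p)) powr p"
    using p by (intro powr_mono2) auto
  moreover have "0 \<le> U" "0 \<le> Q" unfolding U_def Q_def by (auto intro: sum_nonneg)
  ultimately have "U \<le> low_const s powr (p - 1) * Q"
    using p e by (simp add: powr_mult powr_powr mult.commute)
  then show ?thesis unfolding U_def Q_def u_def s_def .
qed

text \<open>Random signs are orthogonal.\<close>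

lemma sum_signs_square:
  assumes "finite I"
  shows "(\<Sum>A\<in>Pow I. (\<Sum>i\<in>I. (if i \<in> A then 1 else -1) * a i)\<^sup>2) = 2 ^ card I * (\<Sum>i\<in>I. (a i)\<^sup>2 :: real)"
  using assms
proof (induction I)
  case (insert x I)
  define s where "s A = (\<Sum>i\<in>I. (if i \<in> A then 1 else -1) * a i)" for A
  have inj: "inj_on (insert x) (Pow I)" using insert.hyps by (auto simp: inj_on_def)
  have 1: "(\<Sum>i\<in>insert x I. (if i \<in> A then 1 else -1) * a i) = s A - a x" if "A \<in> Pow I" for A
    using that insert.hyps by (auto simp: s_def)
  have "s (insert x A) = s A" for A
    unfolding s_def using insert.hyps by (intro sum.cong) auto
  then have 2: "(\<Sum>i\<in>insert x I. (if i \<in> insert x A then 1 else -1) * a i) = s A + a x" for A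
    using insert.hyps unfolding s_def by simp
  have "(\<Sum>A\<in>Pow (insert x I). (\<Sum>i\<in>insert x I. (if i \<in> A then 1 else -1) * a i)\<^sup>2) =
     (\<Sum>A\<in>Pow I. (s A - a x)\<^sup>2) + (\<Sum>A\<in>Pow I. (s A + a x)\<^sup>2)"
    unfolding Pow_insert
  proof (subst sum.union_disjoint)
    show "(\<Sum>A\<in>Pow I. (\<Sum>i\<in>insert x I. (if i \<in> A then 1 else - 1) * a i)\<^sup>2) +
      (\<Sum>A\<in>insert x ` Pow I. (\<Sum>i\<in>insert x I. (if i \<in> A then 1 else - 1) * a i)\<^sup>2) =
      (\<Sum>A\<in>Pow I. (s A - a x)\<^sup>2) + (\<Sum>A\<in>Pow I. (s A + a x)\<^sup>2)"
      unfolding sum.reindex[OF inj] o_def 2 using 1 by simp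
  qed (use insert.hyps in auto)
  also have "\<dots> = (\<Sum>A\<in>Pow I. 2 * (s A)\<^sup>2 + 2 * (a x)\<^sup>2)"
    unfolding sum.distrib[symmetric] by (intro sum.cong refl) (simp add: power2_eq_square algebra_simps)
  also have "\<dots> = 2 * (\<Sum>A\<in>Pow I. (s A)\<^sup>2) + 2 ^ card I * (2 * (a x)\<^sup>2)"
    using insert.hyps by (simp add: sum.distrib sum_distrib_left card_Pow)
  also have "\<dots> = 2 ^ card (insert x I) * (\<Sum>i\<in>insert x I. (a i)\<^sup>2)"
    using insert unfolding s_def by (simp add: algebra_simps)
  finally show ?case .
qed simp

definition signed :: "nat \<Rightarrow> (nat \<times> nat) set \<Rightarrow> (int \<times> int \<Rightarrow> real) \<Rightarrow> nat \<Rightarrow> nat \<Rightarrow> int \<times> int \<Rightarrow> real" where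
  "signed N A u n m z = (if (n, m) \<in> A then 1 else -1) * DD n m u z"

lemma haar_family_signed: "haar_family N (signed N A u)"
  unfolding signed_def[abs_def] by (intro haar_family_cmult haar_family_DD)

lemma square_sum_signed: "square_sum N (signed N A u) z = SS N u z"
  unfolding square_sum_def SS_def signed_def by (intro sum.cong refl) auto

lemma signed_lp_le_low:
  assumes s: "1 < s" "s < 2"
  shows "(\<Sum>z\<in>grid N. \<bar>haar_sum N (signed N A u) z\<bar> powr s) \<le>
    64 * layer_const s * low_const s * (\<Sum>z\<in>grid N. \<bar>u z\<bar> powr s)"
proof -
  have "(\<Sum>z\<in>grid N. \<bar>haar_sum N (signed N A u) z\<bar> powr s) \<le> (\<Sum>z\<in>grid N. MM N (haar_sum N (signed N A u)) z powr s)"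
    using s abs_le_MM by (intro sum_mono powr_mono2) auto
  also have "\<dots> \<le> 64 * layer_const s * (\<Sum>z\<in>grid N. SS N u z powr (s / 2))"
    using maximal_le_square_low[OF _ s(2) haar_family_signed, of N A u] s by (simp add: square_sum_signed)
  also have "\<dots> \<le> 64 * layer_const s * (low_const s * (\<Sum>z\<in>grid N. \<bar>u z\<bar> powr s))"
    using s layer_const_pos[of s] by (intro mult_left_mono square_le_lp_low) auto
  finally show ?thesis by simp
qed

text \<open>Changing the signs of Haar coefficients preserves the square function. So it is a bounded operation for
  exponents below two, where the equivalence is proved, and above two because it is self-adjoint.\<close>

lemma signed_lp_le_high:
  assumes p: "2 < p"
  defines "s \<equiv> p / (p - 1)"
  defines "K \<equiv> 64 * layer_const s * low_const s"
  shows "(\<Sum>z\<in>grid N. \<bar>haar_sum N (signed N A u) z\<bar> powr p) \<le> K powr (p - 1) * (\<Sum>z\<in>grid N. \<bar>u z\<bar> powr p)"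
proof -
  have s: "1 < s" "s < 2" unfolding s_def using conjugate_exponent[OF p] by auto
  have e: "p * (1 - 1 / p) = p - 1" using p by (simp add: field_simps)
  define t where "t = haar_sum N (signed N A u)"
  define \<phi> where "\<phi> = norming p t"
  define V where "V = (\<Sum>z\<in>grid N. \<bar>t z\<bar> powr p)"
  define U where "U = (\<Sum>z\<in>grid N. \<bar>u z\<bar> powr p)"
  have K0: "0 < K"
    unfolding K_def low_const_def doob_const_def using layer_const_pos[of s] s by simp
  have "V = (\<Sum>z\<in>grid N. t z * \<phi> z)" unfolding V_def \<phi>_def using p by (simp add: mult_norming)
  also have "\<dots> = (\<Sum>z\<in>grid N. \<Sum>n<N. \<Sum>m<N. signed N A u n m z * DD n m \<phi> z)"
    unfolding t_def by (rule sum_haar_sum_mult[OF haar_family_signed])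
  also have "\<dots> = (\<Sum>z\<in>grid N. \<Sum>n<N. \<Sum>m<N. signed N A \<phi> n m z * DD n m u z)"
    unfolding signed_def by (simp only: mult_ac)
  also have "\<dots> = (\<Sum>z\<in>grid N. haar_sum N (signed N A \<phi>) z * u z)"
    by (rule sum_haar_sum_mult[OF haar_family_signed, symmetric])
  also have "\<dots> \<le> (\<Sum>z\<in>grid N. \<bar>u z\<bar> * \<bar>haar_sum N (signed N A \<phi>) z\<bar>)"
    by (intro sum_mono) (metis abs_ge_self abs_mult mult.commute)
  also have "\<dots> \<le> U powr (1 / p) * (\<Sum>z\<in>grid N. \<bar>haar_sum N (signed N A \<phi>) z\<bar> powr s) powr (1 - 1 / p)"
    unfolding U_def s_def using p by (intro Hoelder_sum_conjugate) auto
  also have "\<dots> \<le> U powr (1 / p) * (K * V) powr (1 - 1 / p)"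
  proof (intro mult_left_mono powr_mono2)
    show "(\<Sum>z\<in>grid N. \<bar>haar_sum N (signed N A \<phi>) z\<bar> powr s) \<le> K * V"
      using signed_lp_le_low[OF s, of N A \<phi>] abs_norming_powr[of p t] p by (simp add: V_def \<phi>_def s_def K_def)
  qed (use p in \<open>auto intro: sum_nonneg\<close>)
  also have "(K * V) powr (1 - 1 / p) = K powr (1 - 1 / p) * V powr (1 - 1 / p)"
    by (simp add: powr_mult)
  finally have "V \<le> (U powr (1 / p) * K powr (1 - 1 / p)) * V powr (1 - 1 / p)"
    by (simp only: mult.assoc)
  then have "V powr (1 - (1 - 1 / p)) \<le> U powr (1 / p) * K powr (1 - 1 / p)"
    using p by (intro powr_absorb) (auto simp: V_def intro: sum_nonneg)
  then have "(V powr (1 / p)) powr p \<le> (U powr (1 / p) * K powr (1 - 1 / p)) powr p"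
    using p by (intro powr_mono2) auto
  moreover have "0 \<le> U" "0 \<le> V" unfolding U_def V_def by (auto intro: sum_nonneg)
  ultimately have "V \<le> K powr (p - 1) * U"
    using p e by (simp add: powr_mult powr_powr mult.commute)
  then show ?thesis unfolding U_def V_def t_def .
qed

lemma SS_eq_mean_signed:
  "SS N u z = (\<Sum>A\<in>Pow ({..<N} \<times> {..<N}). (haar_sum N (signed N A u) z)\<^sup>2) / card (Pow ({..<N} \<times> {..<N}))"
proof -
  let ?I = "{..<N} \<times> {..<N}"
  have "haar_sum N (signed N A u) z = (\<Sum>i\<in>?I. (if i \<in> A then 1 else -1) * DD (fst i) (snd i) u z)" for A
    unfolding haar_sum_def signed_def by (simp add: sum.cartesian_product')
  then have "(\<Sum>A\<in>Pow ?I. (haar_sum N (signed N A u) z)\<^sup>2) = 2 ^ card ?I * (\<Sum>i\<in>?I. (DD (fst i) (snd i) u z)\<^sup>2)"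
    using sum_signs_square[of ?I "\<lambda>i. DD (fst i) (snd i) u z"] by simp
  also have "(\<Sum>i\<in>?I. (DD (fst i) (snd i) u z)\<^sup>2) = SS N u z"
    unfolding SS_def by (simp add: sum.cartesian_product')
  finally show ?thesis by (simp add: card_Pow)
qed

text \<open>The square function is a quadratic mean over all choices of signs. As \<open>p / 2 \<ge> 1\<close>, its power is
  at most the mean of the powers.\<close>

lemma square_le_lp_high:
  assumes p: "2 < p"
  defines "s \<equiv> p / (p - 1)"
  shows "(\<Sum>z\<in>grid N. SS N u z powr (p / 2)) \<le>
    (64 * layer_const s * low_const s) powr (p - 1) * (\<Sum>z\<in>grid N. \<bar>u z\<bar> powr p)"
proof -
  let ?P = "Pow ({..<N} \<times> {..<N})"
  let ?R = "(64 * layer_const s * low_const s) powr (p - 1) * (\<Sum>z\<in>grid N. \<bar>u z\<bar> powr p)"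
  have c: "0 < card ?P" by (simp add: card_Pow)
  have ne: "?P \<noteq> {}" by blast
  have e: "(x\<^sup>2) powr (p / 2) = \<bar>x\<bar> powr p" for x :: real
  proof -
    have "x\<^sup>2 = \<bar>x\<bar> powr 2" by (simp add: powr_numeral)
    then show ?thesis by (simp only: powr_powr) simp
  qed
  have "(\<Sum>z\<in>grid N. SS N u z powr (p / 2)) \<le>
     (\<Sum>z\<in>grid N. (\<Sum>A\<in>?P. \<bar>haar_sum N (signed N A u) z\<bar> powr p) / card ?P)"
  proof (intro sum_mono)
    fix z
    have "SS N u z powr (p / 2) \<le> (\<Sum>A\<in>?P. ((haar_sum N (signed N A u) z)\<^sup>2) powr (p / 2)) / card ?P"
      unfolding SS_eq_mean_signed using p c by (intro sum_powr_mean_le) (auto simp: ne simp del: Pow_iff)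
    also have "\<dots> = (\<Sum>A\<in>?P. \<bar>haar_sum N (signed N A u) z\<bar> powr p) / card ?P"
      by (simp only: e)
    finally show "SS N u z powr (p / 2) \<le> (\<Sum>A\<in>?P. \<bar>haar_sum N (signed N A u) z\<bar> powr p) / card ?P" .
  qed
  also have "\<dots> = (\<Sum>A\<in>?P. \<Sum>z\<in>grid N. \<bar>haar_sum N (signed N A u) z\<bar> powr p) / card ?P"
    unfolding sum_divide_distrib[symmetric] by (subst sum.swap) (rule refl)
  also have "\<dots> \<le> (\<Sum>A\<in>?P. ?R) / card ?P"
    unfolding s_def by (intro divide_right_mono sum_mono signed_lp_le_high p) auto
  also have "\<dots> = ?R" using c ne by simp
  finally show ?thesis .
qed

section \<open>Equivalence of the maximal function and the square function\<close>

theorem square_le_maximal: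
  assumes p: "0 < p"
  shows "\<exists>C>0. \<forall>N u. (\<Sum>z\<in>grid N. SS N u z powr (p / 2)) \<le> C * (\<Sum>z\<in>grid N. MM N u z powr p)"
proof -
  have lp: "(\<Sum>z\<in>grid N. \<bar>u z\<bar> powr p) \<le> (\<Sum>z\<in>grid N. MM N u z powr p)" for N u
    using p abs_le_MM by (intro sum_mono powr_mono2) auto
  consider "p < 2" | "p = 2" | "2 < p" by linarith
  then show ?thesis
  proof cases
    case 1
    then show ?thesis using square_le_maximal_low[OF p 1] layer_const_pos[OF p 1]
      by (intro exI[of _ "1072 * layer_const p"]) auto
  next
    case 2
    have "(\<Sum>z\<in>grid N. SS N u z powr (p / 2)) \<le> 1 * (\<Sum>z\<in>grid N. MM N u z powr p)" for N u
      using sum_SS_le[of N u] lp[where N = N and u = u] by (simp add: 2 powr_numeral)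
    then show ?thesis by (intro exI[of _ 1]) auto
  next
    case 3
    define K where "K = (64 * layer_const (p / (p - 1)) * low_const (p / (p - 1))) powr (p - 1)"
    have "0 < layer_const (p / (p - 1))" using conjugate_exponent[OF 3] by (intro layer_const_pos) auto
    then have K: "0 < K" unfolding K_def low_const_def doob_const_def using conjugate_exponent[OF 3] 3 by simp
    have "(\<Sum>z\<in>grid N. SS N u z powr (p / 2)) \<le> K * (\<Sum>z\<in>grid N. MM N u z powr p)" for N u
      using square_le_lp_high[OF 3, of N u] mult_left_mono[OF lp[where N = N and u = u], of K] K unfolding K_def by linarith
    then show ?thesis using K by blast
  qed
qed

theorem maximal_le_square:
  assumes p: "0 < p"
  shows "\<exists>C>0. \<forall>N T. haar_family N T \<longrightarrow>
    (\<Sum>z\<in>grid N. MM N (haar_sum N T) z powr p) \<le> C * (\<Sum>z\<in>grid N. square_sum N T z powr (p / 2))"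
proof -
  consider "p < 2" | "p = 2" | "2 < p" by linarith
  then show ?thesis
  proof cases
    case 1
    then show ?thesis using maximal_le_square_low[OF p 1] layer_const_pos[OF p 1]
      by (intro exI[of _ "64 * layer_const p"]) auto
  next
    case 2
    have "(\<Sum>z\<in>grid N. MM N (haar_sum N T) z powr p) \<le> 16 * (\<Sum>z\<in>grid N. square_sum N T z powr (p / 2))"
      if "haar_family N T" for N T
      using strong_maximal_2[of N "haar_sum N T"] sum_haar_sum_square[OF that] by (simp add: 2 powr_numeral)
    then show ?thesis by (intro exI[of _ 16]) auto
  next
    case 3
    define K where "K = low_const (p / (p - 1)) powr (p - 1)"
    have "0 < layer_const (p / (p - 1))" using conjugate_exponent[OF 3] by (intro layer_const_pos) auto
    then have K: "0 < K" unfolding K_def low_const_def doob_const_def using conjugate_exponent[OF 3] 3 by simp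
    have d: "0 < (doob_const p)\<^sup>2" unfolding doob_const_def using 3 by simp
    have "(\<Sum>z\<in>grid N. MM N (haar_sum N T) z powr p) \<le>
      (doob_const p)\<^sup>2 * K * (\<Sum>z\<in>grid N. square_sum N T z powr (p / 2))" if T: "haar_family N T" for N T
    proof -
      have "(\<Sum>z\<in>grid N. MM N (haar_sum N T) z powr p) \<le> (doob_const p)\<^sup>2 * (\<Sum>z\<in>grid N. \<bar>haar_sum N T z\<bar> powr p)"
        using 3 by (intro strong_maximal) auto
      also have "\<dots> \<le> (doob_const p)\<^sup>2 * (K * (\<Sum>z\<in>grid N. square_sum N T z powr (p / 2)))"
        unfolding K_def using d by (intro mult_left_mono lp_le_square_high[OF 3 T]) auto
      finally show ?thesis by simp
    qed
    then show ?thesis using K d by (intro exI[of _ "(doob_const p)\<^sup>2 * K"]) auto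
  qed
qed

section \<open>The discrete paraproduct: upper bounds\<close>

definition paraproduct :: "(int \<times> int \<Rightarrow> real) \<Rightarrow> (nat \<Rightarrow> nat \<Rightarrow> int \<times> int \<Rightarrow> real) \<Rightarrow> nat \<Rightarrow> nat \<Rightarrow> int \<times> int \<Rightarrow> real" where
  "paraproduct g T n m z = EE (Suc n) (Suc m) g z * T n m z"

lemma haar_family_paraproduct: "haar_family N T \<Longrightarrow> haar_family N (paraproduct g T)"
  unfolding paraproduct_def[abs_def] by (intro haar_family_mult MEAS_EE)

lemma square_sum_paraproduct_le:
  assumes "\<And>n m. n < N \<Longrightarrow> m < N \<Longrightarrow> \<bar>EE (Suc n) (Suc m) g z\<bar> \<le> B"
  shows "square_sum N (paraproduct g T) z \<le> B\<^sup>2 * square_sum N T z"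
  unfolding square_sum_def sum_distrib_left paraproduct_def
proof (intro sum_mono)
  fix n m assume "n \<in> {..<N}" "m \<in> {..<N}"
  then have "\<bar>EE (Suc n) (Suc m) g z\<bar> \<le> B" using assms by auto
  then have "(EE (Suc n) (Suc m) g z)\<^sup>2 \<le> B\<^sup>2" by (metis abs_ge_zero power2_abs power_mono)
  then show "(EE (Suc n) (Suc m) g z * T n m z)\<^sup>2 \<le> B\<^sup>2 * (T n m z)\<^sup>2"
    unfolding power_mult_distrib by (intro mult_right_mono) auto
qed

lemma square_sum_DD: "square_sum N (\<lambda>n m. DD n m f) z = SS N f z"
  by (simp add: square_sum_def SS_def)

text \<open>The square function of the paraproduct is pointwise at most the product of a bound for the averages of
  \<open>g\<close> and the square function of \<open>f\<close>.\<close>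

theorem paraproduct_upper_bounded:
  assumes p: "0 < p"
  shows "\<exists>C>0. \<forall>N f g B. 0 \<le> B \<longrightarrow> (\<forall>n m z. \<bar>EE n m g z\<bar> \<le> B) \<longrightarrow>
    (\<Sum>z\<in>grid N. MM N (haar_sum N (paraproduct g (\<lambda>n m. DD n m f))) z powr p) \<le>
    C * B powr p * (\<Sum>z\<in>grid N. MM N f z powr p)"
proof -
  obtain C1 where C1: "0 < C1" "\<And>N u. (\<Sum>z\<in>grid N. SS N u z powr (p / 2)) \<le> C1 * (\<Sum>z\<in>grid N. MM N u z powr p)"
    using square_le_maximal[OF p] by blast
  obtain C2 where C2: "0 < C2" "\<And>N T. haar_family N T \<Longrightarrow>
    (\<Sum>z\<in>grid N. MM N (haar_sum N T) z powr p) \<le> C2 * (\<Sum>z\<in>grid N. square_sum N T z powr (p / 2))"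
    using maximal_le_square[OF p] by blast
  have "(\<Sum>z\<in>grid N. MM N (haar_sum N (paraproduct g (\<lambda>n m. DD n m f))) z powr p) \<le>
    (C2 * C1) * B powr p * (\<Sum>z\<in>grid N. MM N f z powr p)"
    if B: "0 \<le> B" "\<And>n m z. \<bar>EE n m g z\<bar> \<le> B" for N f g B
  proof -
    let ?T = "paraproduct g (\<lambda>n m. DD n m f)"
    have "square_sum N ?T z powr (p / 2) \<le> B powr p * SS N f z powr (p / 2)" for z
    proof -
      have "square_sum N ?T z powr (p / 2) \<le> (B\<^sup>2 * SS N f z) powr (p / 2)"
        using square_sum_paraproduct_le[of N g z B "\<lambda>n m. DD n m f"] B p
        by (intro powr_mono2) (auto simp: square_sum_DD)
      also have "\<dots> = (B\<^sup>2) powr (p / 2) * SS N f z powr (p / 2)" by (simp add: powr_mult)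
      also have "(B\<^sup>2) powr (p / 2) = (B powr 2) powr (p / 2)" using B by (simp add: powr_numeral)
      also have "\<dots> = B powr p" unfolding powr_powr by simp
      finally show ?thesis .
    qed
    then have "(\<Sum>z\<in>grid N. square_sum N ?T z powr (p / 2)) \<le> B powr p * (\<Sum>z\<in>grid N. SS N f z powr (p / 2))"
      unfolding sum_distrib_left by (intro sum_mono)
    also have "\<dots> \<le> B powr p * (C1 * (\<Sum>z\<in>grid N. MM N f z powr p))"
      by (intro mult_left_mono C1) auto
    finally have "C2 * (\<Sum>z\<in>grid N. square_sum N ?T z powr (p / 2)) \<le> C2 * (B powr p * (C1 * (\<Sum>z\<in>grid N. MM N f z powr p)))"
      using C2 by (intro mult_left_mono) auto
    moreover have "(\<Sum>z\<in>grid N. MM N (haar_sum N ?T) z powr p) \<le> C2 * (\<Sum>z\<in>grid N. square_sum N ?T z powr (p / 2))"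
      by (intro C2 haar_family_paraproduct haar_family_DD)
    ultimately show ?thesis by (simp add: mult_ac)
  qed
  then show ?thesis using C1(1) C2(1) by (intro exI[of _ "C2 * C1"]) auto
qed

text \<open>The averages of \<open>g\<close> around a point are bounded by its maximal function there; Hoelder's
  inequality separates the two factors.\<close>

theorem paraproduct_upper:
  assumes p: "0 < p" "0 < q" "0 < r" "1 / q = 1 / p + 1 / r"
  shows "\<exists>C>0. \<forall>N f g.
    (\<Sum>z\<in>grid N. MM N (haar_sum N (paraproduct g (\<lambda>n m. DD n m f))) z powr q) \<le>
    C * (\<Sum>z\<in>grid N. MM N g z powr r) powr (q / r) * (\<Sum>z\<in>grid N. MM N f z powr p) powr (q / p)"
proof -
  obtain C1 where C1: "0 < C1" "\<And>N u. (\<Sum>z\<in>grid N. SS N u z powr (p / 2)) \<le> C1 * (\<Sum>z\<in>grid N. MM N u z powr p)"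
    using square_le_maximal[OF p(1)] by blast
  obtain C2 where C2: "0 < C2" "\<And>N T. haar_family N T \<Longrightarrow>
    (\<Sum>z\<in>grid N. MM N (haar_sum N T) z powr q) \<le> C2 * (\<Sum>z\<in>grid N. square_sum N T z powr (q / 2))"
    using maximal_le_square[OF p(2)] by blast
  have ab: "0 < q / r" "0 < q / p" "q / r + q / p = 1"
  proof -
    have "q * (1 / q) = q * (1 / p + 1 / r)" by (simp only: p(4))
    also have "\<dots> = q / r + q / p" by (simp add: distrib_left)
    finally show "q / r + q / p = 1" using p(2) by simp
  qed (use p in auto)
  have "(\<Sum>z\<in>grid N. MM N (haar_sum N (paraproduct g (\<lambda>n m. DD n m f))) z powr q) \<le>
    C2 * C1 powr (q / p) * (\<Sum>z\<in>grid N. MM N g z powr r) powr (q / r) * (\<Sum>z\<in>grid N. MM N f z powr p) powr (q / p)"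
    for N f g
  proof -
    let ?T = "paraproduct g (\<lambda>n m. DD n m f)"
    define G where "G = (\<Sum>z\<in>grid N. MM N g z powr r)"
    define F where "F = (\<Sum>z\<in>grid N. MM N f z powr p)"
    have "square_sum N ?T z powr (q / 2) \<le> (MM N g z powr r) powr (q / r) * (SS N f z powr (p / 2)) powr (q / p)" for z
    proof -
      have "square_sum N ?T z powr (q / 2) \<le> ((MM N g z)\<^sup>2 * SS N f z) powr (q / 2)"
        using square_sum_paraproduct_le[of N g z "MM N g z" "\<lambda>n m. DD n m f"] p MM_ge
        by (intro powr_mono2) (auto simp: square_sum_DD)
      also have "\<dots> = ((MM N g z)\<^sup>2) powr (q / 2) * SS N f z powr (q / 2)" by (simp add: powr_mult)
      also have "((MM N g z)\<^sup>2) powr (q / 2) = (MM N g z powr 2) powr (q / 2)" by (simp add: powr_numeral)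
      finally show ?thesis using p(1-3) by (simp only: powr_powr) simp
    qed
    then have "(\<Sum>z\<in>grid N. square_sum N ?T z powr (q / 2)) \<le>
      (\<Sum>z\<in>grid N. (MM N g z powr r) powr (q / r) * (SS N f z powr (p / 2)) powr (q / p))"
      by (intro sum_mono)
    also have "\<dots> \<le> G powr (q / r) * (\<Sum>z\<in>grid N. SS N f z powr (p / 2)) powr (q / p)"
      unfolding G_def using ab by (intro Hoelder_sum) auto
    also have "\<dots> \<le> G powr (q / r) * (C1 * F) powr (q / p)"
      unfolding F_def using ab by (intro mult_left_mono powr_mono2 C1) (auto intro: sum_nonneg)
    also have "\<dots> = C1 powr (q / p) * G powr (q / r) * F powr (q / p)" by (simp add: powr_mult)
    finally have "C2 * (\<Sum>z\<in>grid N. square_sum N ?T z powr (q / 2)) \<le> C2 * (C1 powr (q / p) * G powr (q / r) * F powr (q / p))"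
      using C2 by (intro mult_left_mono) auto
    moreover have "(\<Sum>z\<in>grid N. MM N (haar_sum N ?T) z powr q) \<le> C2 * (\<Sum>z\<in>grid N. square_sum N ?T z powr (q / 2))"
      by (intro C2 haar_family_paraproduct haar_family_DD)
    ultimately show ?thesis by (simp add: mult_ac G_def F_def)
  qed
  then show ?thesis using C1(1) C2(1) by (intro exI[of _ "C2 * C1 powr (q / p)"]) auto
qed

section \<open>Selecting sparse rectangles\<close>

text \<open>Go through the sets in any order and keep a set if less than half of it is covered by those kept before;
  the part that was not covered then is its share \<open>D i\<close>. A set that is not kept is half covered.\<close>

lemma sparse_selection:
  fixes S :: "'i \<Rightarrow> 'a set"
  assumes "finite J" "\<And>i. i \<in> J \<Longrightarrow> finite (S i)"
  shows "\<exists>I\<subseteq>J. \<exists>D. (\<forall>i\<in>I. D i \<subseteq> S i \<and> card (S i) \<le> 2 * card (D i)) \<and> disjoint_family_on D I \<and>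
    (\<forall>i\<in>J. card (S i) \<le> 2 * card (S i \<inter> (\<Union>i\<in>I. S i)))"
  using assms
proof (induction J)
  case (insert j J)
  then obtain I D where ID: "I \<subseteq> J" "\<And>i. i \<in> I \<Longrightarrow> D i \<subseteq> S i \<and> card (S i) \<le> 2 * card (D i)"
    "disjoint_family_on D I" "\<And>i. i \<in> J \<Longrightarrow> card (S i) \<le> 2 * card (S i \<inter> (\<Union>i\<in>I. S i))"
  proof -
    have "\<exists>I\<subseteq>J. \<exists>D. (\<forall>i\<in>I. D i \<subseteq> S i \<and> card (S i) \<le> 2 * card (D i)) \<and> disjoint_family_on D I \<and>
        (\<forall>i\<in>J. card (S i) \<le> 2 * card (S i \<inter> (\<Union>i\<in>I. S i)))"
      using insert.IH insert.prems by blast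
    then show ?thesis using that by blast
  qed
  define U where "U = (\<Union>i\<in>I. S i)"
  show ?case
  proof (cases "card (S j) \<le> 2 * card (S j \<inter> U)")
    case True
    then show ?thesis using ID by (intro exI[of _ I] conjI exI[of _ D]) (auto simp: U_def)
  next
    case False
    define D' where "D' = D(j := S j - U)"
    have fin: "finite (S j)" using insert.prems by simp
    have "card (S j) = card (S j \<inter> U) + card (S j - U)"
      using card_Diff_subset_Int[of "S j" U] card_mono[of "S j" "S j \<inter> U"] fin by simp
    then have dj: "card (S j) \<le> 2 * card (S j - U)" using False by linarith
    have jI: "j \<notin> I" using ID(1) insert.hyps by auto
    show ?thesis
    proof (intro exI[of _ "insert j I"] conjI exI[of _ D'] ballI)
      show "insert j I \<subseteq> insert j J" using ID(1) by auto
      fix i assume i: "i \<in> insert j I"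
      show "D' i \<subseteq> S i" "card (S i) \<le> 2 * card (D' i)" using i dj jI ID(2) by (auto simp: D'_def)
    next
      have "D i \<inter> (S j - U) = {}" if "i \<in> I" for i using ID(2)[OF that] that by (auto simp: U_def)
      then show "disjoint_family_on D' (insert j I)"
        using ID(3) jI unfolding disjoint_family_on_def D'_def by auto
    next
      fix i assume i: "i \<in> insert j J"
      then have fi: "finite (S i)" using insert.prems by simp
      show "card (S i) \<le> 2 * card (S i \<inter> (\<Union>i\<in>insert j I. S i))"
      proof (cases "i = j")
        case True
        then have "S i \<inter> (\<Union>i\<in>insert j I. S i) = S i" by auto
        then show ?thesis by simp
      next
        case False
        then have "card (S i) \<le> 2 * card (S i \<inter> (\<Union>i\<in>I. S i))" using ID(4) i by auto
        also have "\<dots> \<le> 2 * card (S i \<inter> (\<Union>i\<in>insert j I. S i))"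
          using fi by (intro mult_left_mono card_mono) auto
        finally show ?thesis .
      qed
    qed
  qed
qed (auto simp: disjoint_family_on_def)

lemma powr_sum_subadditive:
  fixes a :: "'a \<Rightarrow> real"
  assumes s: "0 < s" "s \<le> 1" and nn: "\<And>i. i \<in> I \<Longrightarrow> 0 \<le> a i"
  shows "(\<Sum>i\<in>I. a i) powr s \<le> (\<Sum>i\<in>I. a i powr s)"
proof -
  have two: "(x + y) powr s \<le> x powr s + y powr s" if "0 \<le> x" "0 \<le> y" for x y :: real
  proof (cases "x + y = 0")
    case False
    then have xy: "0 < x + y" using that by simp
    have le: "t \<le> t powr s" if "0 \<le> t" "t \<le> 1" for t :: real
      using powr_mono'[of s 1 t] s that by simp
    have "1 = x / (x + y) + y / (x + y)" using xy by (simp add: add_divide_distrib[symmetric])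
    also have "\<dots> \<le> (x / (x + y)) powr s + (y / (x + y)) powr s"
      using xy that by (intro add_mono le) auto
    also have "\<dots> = (x powr s + y powr s) / (x + y) powr s"
      using xy that by (simp add: powr_divide add_divide_distrib)
    finally show ?thesis using xy by simp
  qed simp
  show ?thesis
    using nn
  proof (induction I rule: infinite_finite_induct)
    case (insert i I)
    have "(a i + (\<Sum>i\<in>I. a i)) powr s \<le> a i powr s + (\<Sum>i\<in>I. a i) powr s"
      using insert by (intro two) (auto intro: sum_nonneg)
    also have "\<dots> \<le> a i powr s + (\<Sum>i\<in>I. a i powr s)" using insert by simp
    finally show ?case using insert by simp
  qed auto
qed

section \<open>A Haar function with prescribed levels\<close>

definition rademacher :: "nat \<Rightarrow> int \<Rightarrow> real" where
  "rademacher n x = (if even (x div 2 ^ n) then 1 else -1)"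

lemma sum_rademacher_cell: "(\<Sum>t | t div 2 ^ Suc n = q. rademacher n t) = 0"
proof -
  have eq: "t div 2 ^ Suc n = t div 2 ^ n div 2" for t :: int
    by (simp add: mult.commute[of 2] zdiv_zmult2_eq del: mult_2)
  have "{t. t div 2 ^ Suc n = q} = {t. t div 2 ^ n = 2 * q} \<union> {t. t div 2 ^ n = 2 * q + 1}"
    unfolding eq by auto
  then have "(\<Sum>t | t div 2 ^ Suc n = q. rademacher n t) =
    (\<Sum>t | t div 2 ^ n = 2 * q. rademacher n t) + (\<Sum>t | t div 2 ^ n = 2 * q + 1. rademacher n t)"
    using finite_cell by (simp only:) (intro sum.union_disjoint, auto)
  also have "\<dots> = (\<Sum>t | t div 2 ^ n = 2 * q. 1) + (\<Sum>t | t div 2 ^ n = 2 * q + 1. -1)"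
    by (intro arg_cong2[of _ _ _ _ "(+)"] sum.cong refl) (auto simp: rademacher_def)
  also have "\<dots> = 0" by (simp add: card_cell)
  finally show ?thesis .
qed

lemma X_dif_rademacher: "X.dif n (\<lambda>z. rademacher n (fst z) * c (snd z)) z = rademacher n (fst z) * c (snd z)"
proof -
  have "X.meas n (\<lambda>z. rademacher n (fst z) * c (snd z))"
    unfolding X.meas_def blk1_def by (auto simp: rademacher_def)
  moreover have "X.avg (Suc n) (\<lambda>z. rademacher n (fst z) * c (snd z)) z = 0"
    using sum_rademacher_cell[of n "fst z div 2 ^ Suc n"]
    by (cases z) (simp add: X_avg_eq sum_distrib_right[symmetric])
  ultimately show ?thesis by (simp add: X.dif_def X.avg_meas)
qed

lemma Y_dif_rademacher: "Y.dif n (\<lambda>z. c (fst z) * rademacher n (snd z)) z = c (fst z) * rademacher n (snd z)"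
proof -
  have "Y.meas n (\<lambda>z. c (fst z) * rademacher n (snd z))"
    unfolding Y.meas_def blk2_def by (auto simp: rademacher_def)
  moreover have "Y.avg (Suc n) (\<lambda>z. c (fst z) * rademacher n (snd z)) z = 0"
    using sum_rademacher_cell[of n "snd z div 2 ^ Suc n"]
    by (cases z) (simp add: Y_avg_eq sum_distrib_left[symmetric])
  ultimately show ?thesis by (simp add: Y.dif_def Y.avg_meas)
qed

lemma DD_rademacher:
  "DD n m (\<lambda>z. rademacher n (fst z) * rademacher m (snd z)) = (\<lambda>z. rademacher n (fst z) * rademacher m (snd z))"
proof -
  let ?f = "\<lambda>z. rademacher n (fst z) * rademacher m (snd z)"
  have "Y.dif m ?f = ?f" "X.dif n ?f = ?f"
    by (rule ext, rule Y_dif_rademacher) (rule ext, rule X_dif_rademacher)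
  then show ?thesis by (simp only: DD_def)
qed

lemma haar_family_rademacher:
  assumes "\<And>n m. n < N \<Longrightarrow> m < N \<Longrightarrow> MEAS (Suc n) (Suc m) (w n m)"
  shows "haar_family N (\<lambda>n m z. w n m z * (rademacher n (fst z) * rademacher m (snd z)))"
  using assms haar_family_mult[of N "\<lambda>n m z. rademacher n (fst z) * rademacher m (snd z)" w]
  by (simp add: haar_family_def DD_rademacher)

lemma rademacher_square [simp]: "(rademacher n x)\<^sup>2 = 1"
  by (simp add: rademacher_def)

section \<open>The discrete paraproduct: lower bound\<close>

lemma sum_levels_le:
  fixes r :: real
  assumes "0 < r" "finite (K :: int set)"
  shows "(\<Sum>k\<in>K. 2 powr (k * r) * card {z\<in>grid N. 2 powr k < MM N g z}) \<le>
    1 / (1 - 2 powr (- r)) * (\<Sum>z\<in>grid N. MM N g z powr r)"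
proof -
  have "(\<Sum>k\<in>K. 2 powr (k * r) * card {z\<in>grid N. 2 powr k < MM N g z}) =
     (\<Sum>k\<in>K. \<Sum>z\<in>grid N. if 2 powr k < MM N g z then 2 powr (k * r) else 0)"
    by (intro sum.cong refl) (simp add: sum.If_cases Int_def mult.commute)
  also have "\<dots> = (\<Sum>z\<in>grid N. \<Sum>k\<in>K. if 2 powr k < MM N g z then 2 powr (k * r) else 0)"
    by (rule sum.swap)
  also have "\<dots> = (\<Sum>z\<in>grid N. \<Sum>k\<in>{k\<in>K. 2 powr k < MM N g z}. 2 powr (k * r))"
    using assms(2) by (intro sum.cong[OF refl] sum.inter_filter[symmetric])
  also have "\<dots> \<le> (\<Sum>z\<in>grid N. 1 / (1 - 2 powr (- r)) * MM N g z powr r)"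
    using assms by (intro sum_mono dyadic_powr_sum_le) auto
  finally show ?thesis by (simp add: sum_distrib_left)
qed

text \<open>A selected rectangle is recorded as a pair of levels and a set of points, because the summand
  of a Haar series depends on the levels.\<close>

definition points :: "nat \<times> nat \<times> 'a set \<Rightarrow> 'a set" where
  "points i = snd (snd i)"

definition sparse_family ::
  "nat \<Rightarrow> (int \<times> int \<Rightarrow> real) \<Rightarrow> real \<Rightarrow> (nat \<times> nat \<times> (int \<times> int) set) set \<Rightarrow>
    (nat \<times> nat \<times> (int \<times> int) set \<Rightarrow> (int \<times> int) set) \<Rightarrow> bool" where
  "sparse_family N g \<kappa> I D \<longleftrightarrow>
    finite I \<and>
    (\<forall>i\<in>I. \<exists>n m z. i = (n, m, rect n m z) \<and> 0 < n \<and> n \<le> N \<and> 0 < m \<and> m \<le> N \<and> z \<in> grid N \<and> \<kappa> < \<bar>EE n m g z\<bar>) \<and>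
    (\<forall>i\<in>I. D i \<subseteq> points i \<and> card (points i) \<le> 2 * card (D i)) \<and> disjoint_family_on D I"

lemma sparse_family_subset:
  assumes "sparse_family N g \<kappa> I D"
  shows "(\<Union>i\<in>I. points i) \<subseteq> {z\<in>grid N. \<kappa> < MM N g z}"
proof
  fix w assume "w \<in> (\<Union>i\<in>I. points i)"
  then obtain i where i: "i \<in> I" "w \<in> points i" by blast
  obtain n m z where z: "i = (n, m, rect n m z)" "n \<le> N" "m \<le> N" "z \<in> grid N" "\<kappa> < \<bar>EE n m g z\<bar>"
    using assms i(1) unfolding sparse_family_def by blast
  have w: "w \<in> rect n m z" using i(2) z(1) by (simp add: points_def)
  have "w \<in> grid N" using w rect_grid[OF z(4,2,3)] by blast
  moreover have "\<kappa> < MM N g w" using z(5) MM_ge[OF z(2,3), of g w] EE_const_on_rect[OF w, of g] by simp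
  ultimately show "w \<in> {z\<in>grid N. \<kappa> < MM N g z}" by simp
qed

text \<open>The rectangles on which the average of \<open>g\<close> exceeds \<open>\<kappa>\<close> cover the set where its maximal
  function does. The selected ones fill half of each of them, so their union is of comparable
  size by the weak type estimate. Positive levels are required since a rectangle of level zero
  has no Haar function on the lattice.\<close>

lemma level_selection:
  fixes N :: nat and g :: "int \<times> int \<Rightarrow> real" and \<kappa> :: real
  assumes max: "\<And>z. z \<in> grid N \<Longrightarrow> \<exists>n m. 0 < n \<and> n \<le> N \<and> 0 < m \<and> m \<le> N \<and> MM N g z = \<bar>EE n m g z\<bar>"
  shows "\<exists>I D. sparse_family N g \<kappa> I D \<and>
    card {z\<in>grid N. \<kappa> < MM N g z} \<le> 64 * real (card (\<Union>i\<in>I. points i))"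
proof -
  define J where "J = {(n, m, rect n m z) | n m z. 0 < n \<and> n \<le> N \<and> 0 < m \<and> m \<le> N \<and> z \<in> grid N \<and> \<kappa> < \<bar>EE n m g z\<bar>}"
  have "J \<subseteq> (\<lambda>(n, m, z). (n, m, rect n m z)) ` ({..N} \<times> {..N} \<times> grid N)"
  proof
    fix i assume "i \<in> J"
    then obtain n m z where i: "i = (n, m, rect n m z)" "n \<le> N" "m \<le> N" "z \<in> grid N" by (auto simp: J_def)
    then show "i \<in> (\<lambda>(n, m, z). (n, m, rect n m z)) ` ({..N} \<times> {..N} \<times> grid N)"
      by (intro image_eqI[of _ _ "(n, m, z)"]) auto
  qed
  then have J: "finite J" by (rule finite_subset) auto
  have fin: "finite (points i)" if "i \<in> J" for i using that by (auto simp: J_def points_def)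
  obtain I D where I: "I \<subseteq> J" and D: "\<forall>i\<in>I. D i \<subseteq> points i \<and> card (points i) \<le> 2 * card (D i)"
    "disjoint_family_on D I" and cover: "\<forall>i\<in>J. card (points i) \<le> 2 * card (points i \<inter> (\<Union>i\<in>I. points i))"
    using sparse_selection[of J points, OF J fin] by metis
  define A where "A = (\<Union>i\<in>I. points i)"
  have sparse: "sparse_family N g \<kappa> I D"
    unfolding sparse_family_def
  proof (intro conjI ballI)
    show "finite I" using I J finite_subset by blast
    fix i assume "i \<in> I"
    then have "i \<in> J" using I by blast
    then show "\<exists>n m z. i = (n, m, rect n m z) \<and> 0 < n \<and> n \<le> N \<and> 0 < m \<and> m \<le> N \<and> z \<in> grid N \<and> \<kappa> < \<bar>EE n m g z\<bar>"
      unfolding J_def by blast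
  qed (use D in auto)
  show ?thesis
  proof (intro exI conjI)
    show "sparse_family N g \<kappa> I D" by (fact sparse)
    define \<Omega> where "\<Omega> = {z\<in>grid N. \<kappa> < MM N g z}"
    have "\<Omega> \<subseteq> {z\<in>grid N. 1 / 2 \<le> MM N (ind A) z}"
    proof
      fix z assume "z \<in> \<Omega>"
      then have z: "z \<in> grid N" "\<kappa> < MM N g z" by (auto simp: \<Omega>_def)
      obtain n m where nm: "0 < n" "n \<le> N" "0 < m" "m \<le> N" "MM N g z = \<bar>EE n m g z\<bar>" using max[OF z(1)] by blast
      have "(n, m, rect n m z) \<in> J" using nm(1-4) z(1) z(2)[unfolded nm(5)] unfolding J_def by blast
      then have "card (points (n, m, rect n m z)) \<le> 2 * card (points (n, m, rect n m z) \<inter> A)"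
        using cover unfolding A_def by blast
      then have "2 ^ (n + m) \<le> 2 * card (rect n m z \<inter> A)" by (simp add: points_def card_rect)
      then have "real (2 ^ (n + m)) \<le> real (2 * card (rect n m z \<inter> A))" by (rule of_nat_mono)
      then have "1 / 2 \<le> card (rect n m z \<inter> A) / 2 ^ (n + m)" by (simp add: field_simps)
      also have "card (rect n m z \<inter> A) / 2 ^ (n + m) = EE n m (ind A) z"
        unfolding EE_eq_sum_rect using sum_ind[of "rect n m z" A] by (simp add: Int_commute)
      also have "\<dots> \<le> MM N (ind A) z" using MM_ge[OF nm(2,4), of "ind A" z] by simp
      finally show "z \<in> {z\<in>grid N. 1 / 2 \<le> MM N (ind A) z}" using z by simp
    qed
    then have "card \<Omega> \<le> card {z\<in>grid N. 1 / 2 \<le> MM N (ind A) z}" by (intro card_mono) auto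
    also have "real \<dots> \<le> 64 * real (card A)"
      unfolding A_def using sparse_family_subset[OF sparse] by (intro card_half_dense_le) auto
    finally show "card {z\<in>grid N. \<kappa> < MM N g z} \<le> 64 * real (card (\<Union>i\<in>I. points i))"
      unfolding A_def \<Omega>_def by simp
  qed
qed

definition selection_const :: "real \<Rightarrow> real \<Rightarrow> real \<Rightarrow> real" where
  "selection_const s \<beta> r = (if s \<le> 1 then 2 / (1 - 2 powr (- r))
     else (2 / (1 - 2 powr (- \<beta>))) powr s * (doob_const (s / (s - 1)))\<^sup>2 powr (s - 1))"

text \<open>The sum of the selected rectangles, weighted by level, behaves as if those of one level were disjoint.
  For exponents up to one, a count dominates its powers and the total count is at most twice the
  size of the disjoint shares. Above one, the sum is tested against a function; the integral over a
  rectangle is at most twice the integral of the maximal function of the test function over its share.\<close>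

lemma sum_selected_powr_le:
  fixes s \<beta> r :: real and N :: nat and g :: "int \<times> int \<Rightarrow> real"
  assumes s: "0 < s" and \<beta>: "0 < \<beta>" "\<beta> * s = r" and K: "finite (K :: int set)"
    and sparse: "\<And>k. k \<in> K \<Longrightarrow> sparse_family N g (2 powr k) (I k) (D k)"
  defines "G \<equiv> \<lambda>z. \<Sum>k\<in>K. 2 powr (k * \<beta>) * (\<Sum>i\<in>I k. ind (points i) z)"
  shows "(\<Sum>z\<in>grid N. G z powr s) \<le> selection_const s \<beta> r * (\<Sum>z\<in>grid N. MM N g z powr r)"
proof -
  define \<Omega> where "\<Omega> k = {z\<in>grid N. 2 powr (real_of_int k) < MM N g z}" for k :: int
  define W where "W = (\<Sum>z\<in>grid N. MM N g z powr r)"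
  have r: "0 < r" using s \<beta> by (metis mult_pos_pos)
  have fin: "finite (I k)" if "k \<in> K" for k
    using sparse[OF that] unfolding sparse_family_def by blast
  have rep: "\<exists>n m z. i = (n, m, rect n m z) \<and> n \<le> N \<and> m \<le> N \<and> z \<in> grid N" if "k \<in> K" "i \<in> I k" for k i
    using sparse[OF that(1)] that(2) unfolding sparse_family_def by blast
  have D: "D k i \<subseteq> points i" "card (points i) \<le> 2 * card (D k i)" if "k \<in> K" "i \<in> I k" for k i
    using sparse[OF that(1)] that(2) unfolding sparse_family_def by blast+
  have D_disj: "disjoint_family_on (D k) (I k)" if "k \<in> K" for k
    using sparse[OF that] unfolding sparse_family_def by blast
  have sub: "(\<Union>i\<in>I k. points i) \<subseteq> {z\<in>grid N. 2 powr k < MM N g z}" if "k \<in> K" for k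
    by (rule sparse_family_subset[OF sparse[OF that]])
  have finS: "finite (points i)" if "k \<in> K" "i \<in> I k" for k i
    using rep[OF that] by (auto simp: points_def)
  have inG: "points i \<subseteq> grid N" if "k \<in> K" "i \<in> I k" for k i
    using sub[OF that(1)] that(2) by blast
  have finD: "finite (D k i)" if "k \<in> K" "i \<in> I k" for k i
    using D(1)[OF that] finS[OF that] by (rule finite_subset)
  have D\<Omega>: "(\<Union>i\<in>I k. D k i) \<subseteq> \<Omega> k" if "k \<in> K" for k
  proof -
    have "(\<Union>i\<in>I k. D k i) \<subseteq> (\<Union>i\<in>I k. points i)" using D(1)[OF that] by (rule UN_mono[OF order_refl])
    then show ?thesis using sub[OF that] unfolding \<Omega>_def by (rule order_trans)
  qed
  have fin\<Omega>: "finite (\<Omega> k)" for k unfolding \<Omega>_def by simp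
  have DD_card: "(\<Sum>i\<in>I k. real (card (D k i))) \<le> card (\<Omega> k)" if k: "k \<in> K" for k
  proof -
    have "(\<Sum>i\<in>I k. card (D k i)) = card (\<Union>i\<in>I k. D k i)"
      using D_disj[OF k] finD[OF k] fin[OF k]
      by (intro card_UN_disjoint[symmetric]) (auto simp: disjoint_family_on_def)
    also have "\<dots> \<le> card (\<Omega> k)"
      by (intro card_mono fin\<Omega> D\<Omega> k)
    finally show ?thesis by (metis of_nat_le_iff of_nat_sum)
  qed
  show ?thesis
  proof (cases "s \<le> 1")
    case True
    have "G z powr s \<le> (\<Sum>k\<in>K. 2 powr (k * r) * (\<Sum>i\<in>I k. ind (points i) z))" for z
    proof -
      have "G z powr s \<le> (\<Sum>k\<in>K. (2 powr (k * \<beta>) * (\<Sum>i\<in>I k. ind (points i) z)) powr s)"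
        unfolding G_def using s True by (intro powr_sum_subadditive) (auto intro!: mult_nonneg_nonneg sum_nonneg simp: ind_def)
      also have "\<dots> \<le> (\<Sum>k\<in>K. 2 powr (k * r) * (\<Sum>i\<in>I k. ind (points i) z))"
      proof (intro sum_mono)
        fix k assume k: "k \<in> K"
        define c where "c = card {i\<in>I k. z \<in> points i}"
        have c: "(\<Sum>i\<in>I k. ind (points i) z) = real c"
          unfolding ind_def of_bool_def c_def using fin[OF k] by (simp add: sum.If_cases Int_def)
        have "real c powr s \<le> real c"
          using powr_mono[of s 1 "real c"] True by (cases "c = 0") auto
        then have "2 powr (k * \<beta> * s) * real c powr s \<le> 2 powr (k * r) * real c"
          using \<beta>(2) by (simp add: mult.assoc)
        then show "(2 powr (k * \<beta>) * (\<Sum>i\<in>I k. ind (points i) z)) powr s \<le> 2 powr (k * r) * (\<Sum>i\<in>I k. ind (points i) z)"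
          unfolding c by (simp add: powr_mult powr_powr)
      qed
      finally show ?thesis .
    qed
    then have "(\<Sum>z\<in>grid N. G z powr s) \<le> (\<Sum>z\<in>grid N. \<Sum>k\<in>K. 2 powr (k * r) * (\<Sum>i\<in>I k. ind (points i) z))"
      by (intro sum_mono)
    also have "\<dots> = (\<Sum>k\<in>K. 2 powr (k * r) * (\<Sum>i\<in>I k. \<Sum>z\<in>grid N. ind (points i) z))"
      unfolding sum_distrib_left by (subst sum.swap, intro sum.cong refl, rule sum.swap)
    also have "\<dots> \<le> (\<Sum>k\<in>K. 2 powr (k * r) * (2 * card (\<Omega> k)))"
    proof (intro sum_mono mult_left_mono)
      fix k assume k: "k \<in> K"
      have "(\<Sum>i\<in>I k. \<Sum>z\<in>grid N. ind (points i) z) = (\<Sum>i\<in>I k. real (card (points i)))"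
        using inG[OF k] by (intro sum.cong refl) (simp add: sum_ind Int_absorb2)
      also have "\<dots> \<le> (\<Sum>i\<in>I k. 2 * real (card (D k i)))"
        using D(2)[OF k] by (intro sum_mono) (metis of_nat_le_iff of_nat_mult of_nat_numeral)
      also have "\<dots> \<le> 2 * card (\<Omega> k)" using DD_card[OF k] by (simp add: sum_distrib_left[symmetric])
      finally show "(\<Sum>i\<in>I k. \<Sum>z\<in>grid N. ind (points i) z) \<le> 2 * card (\<Omega> k)" .
    qed auto
    also have "\<dots> = 2 * (\<Sum>k\<in>K. 2 powr (k * r) * card (\<Omega> k))" by (simp add: sum_distrib_left mult_ac)
    also have "\<dots> \<le> 2 * (1 / (1 - 2 powr (- r)) * W)"
      unfolding \<Omega>_def W_def by (intro mult_left_mono sum_levels_le r K) auto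
    finally show ?thesis using True by (simp add: W_def selection_const_def)
  next
    case False
    then have s1: "1 < s" by simp
    define s' where "s' = s / (s - 1)"
    have s': "1 < s'" unfolding s'_def using s1 by simp
    define \<phi> where "\<phi> z = G z powr (s - 1)" for z
    define c where "c = 1 / (1 - 2 powr (- \<beta>))"
    have c0: "0 < c" unfolding c_def using two_powr_minus_less_1[OF \<beta>(1)] by simp
    define V where "V = (\<Sum>z\<in>grid N. G z powr s)"
    have G0: "0 \<le> G z" for z unfolding G_def by (auto intro!: sum_nonneg mult_nonneg_nonneg simp: ind_def)
    have \<phi>0: "0 \<le> \<phi> z" for z by (simp add: \<phi>_def)
    have \<phi>s: "\<bar>\<phi> z\<bar> powr s' = G z powr s" for z using s1 by (simp add: \<phi>_def s'_def powr_powr)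
    have rectsum: "(\<Sum>z\<in>points i. \<phi> z) \<le> 2 * (\<Sum>z\<in>D k i. MM N \<phi> z)" if k: "k \<in> K" "i \<in> I k" for k i
    proof -
      obtain n m z where z: "i = (n, m, rect n m z)" "n \<le> N" "m \<le> N" using rep[OF k] by blast
      have i: "points i = rect n m z" using z by (simp add: points_def)
      have "(\<Sum>w\<in>points i. \<phi> w) = card (points i) * EE n m \<phi> z"
        unfolding i EE_eq_sum_rect by (simp add: card_rect)
      also have "\<dots> \<le> real (2 * card (D k i)) * EE n m \<phi> z"
        using D(2)[OF k] by (intro mult_right_mono EE_nonneg \<phi>0 of_nat_mono)
      also have "\<dots> = 2 * (\<Sum>w\<in>D k i. EE n m \<phi> z)" by simp
      also have "\<dots> \<le> 2 * (\<Sum>w\<in>D k i. MM N \<phi> w)"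
      proof (intro mult_left_mono sum_mono)
        fix w assume "w \<in> D k i"
        then have "w \<in> rect n m z" using D(1)[OF k] i by auto
        then have "EE n m \<phi> z = EE n m \<phi> w" by (simp add: EE_const_on_rect)
        also have "\<dots> \<le> MM N \<phi> w" using MM_ge[OF z(2,3), of \<phi> w] by simp
        finally show "EE n m \<phi> z \<le> MM N \<phi> w" .
      qed auto
      finally show ?thesis .
    qed
    have "V = (\<Sum>z\<in>grid N. G z * \<phi> z)"
      unfolding V_def \<phi>_def using G0 s1 powr_mult_base[OF G0, of _ "s - 1"] by (intro sum.cong refl) simp
    also have "\<dots> = (\<Sum>k\<in>K. 2 powr (k * \<beta>) * (\<Sum>i\<in>I k. \<Sum>z\<in>grid N. ind (points i) z * \<phi> z))"
      unfolding G_def sum_distrib_left sum_distrib_right mult.assoc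
      by (subst sum.swap, intro sum.cong refl, rule sum.swap)
    also have "\<dots> \<le> (\<Sum>k\<in>K. 2 powr (k * \<beta>) * (2 * (\<Sum>z\<in>\<Omega> k. MM N \<phi> z)))"
    proof (intro sum_mono mult_left_mono)
      fix k assume k: "k \<in> K"
      have "(\<Sum>i\<in>I k. \<Sum>z\<in>grid N. ind (points i) z * \<phi> z) = (\<Sum>i\<in>I k. \<Sum>z\<in>points i. \<phi> z)"
        using inG[OF k] by (intro sum.cong[OF refl] sum.mono_neutral_cong_right) (auto simp: ind_def)
      also have "\<dots> \<le> (\<Sum>i\<in>I k. 2 * (\<Sum>z\<in>D k i. MM N \<phi> z))"
        by (intro sum_mono rectsum k)
      also have "\<dots> = 2 * (\<Sum>z\<in>(\<Union>i\<in>I k. D k i). MM N \<phi> z)"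
        unfolding sum_distrib_left[symmetric] using D_disj[OF k] finD[OF k] fin[OF k]
        by (subst sum.UNION_disjoint) (auto simp: disjoint_family_on_def)
      also have "\<dots> \<le> 2 * (\<Sum>z\<in>\<Omega> k. MM N \<phi> z)"
        by (intro mult_left_mono sum_mono2 fin\<Omega> D\<Omega> k) auto
      finally show "(\<Sum>i\<in>I k. \<Sum>z\<in>grid N. ind (points i) z * \<phi> z) \<le> 2 * (\<Sum>z\<in>\<Omega> k. MM N \<phi> z)" .
    qed auto
    also have "\<dots> = 2 * (\<Sum>k\<in>K. \<Sum>z\<in>grid N. if 2 powr k < MM N g z then 2 powr (k * \<beta>) * MM N \<phi> z else 0)"
      unfolding \<Omega>_def by (simp add: sum_distrib_left sum.inter_filter[symmetric] mult_ac)
    also have "(\<Sum>k\<in>K. \<Sum>z\<in>grid N. if 2 powr k < MM N g z then 2 powr (k * \<beta>) * MM N \<phi> z else 0) =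
      (\<Sum>z\<in>grid N. (\<Sum>k\<in>{k\<in>K. 2 powr k < MM N g z}. 2 powr (k * \<beta>)) * MM N \<phi> z)"
      using K by (subst sum.swap) (auto simp: sum_distrib_right sum.inter_filter intro!: sum.cong)
    also have "\<dots> \<le> (\<Sum>z\<in>grid N. (c * MM N g z powr \<beta>) * MM N \<phi> z)"
      unfolding c_def using K \<beta> by (intro sum_mono mult_right_mono dyadic_powr_sum_le) auto
    also have "\<dots> = c * (\<Sum>z\<in>grid N. MM N g z powr \<beta> * MM N \<phi> z)" by (simp add: sum_distrib_left mult.assoc)
    also have "(\<Sum>z\<in>grid N. MM N g z powr \<beta> * MM N \<phi> z) \<le>
       (\<Sum>z\<in>grid N. (MM N g z powr \<beta>) powr s) powr (1 / s) * (\<Sum>z\<in>grid N. MM N \<phi> z powr s') powr (1 - 1 / s)"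
      unfolding s'_def by (intro Hoelder_sum_conjugate s1) auto
    also have "(\<Sum>z\<in>grid N. (MM N g z powr \<beta>) powr s) = W" unfolding W_def using \<beta> by (simp add: powr_powr)
    finally have V1: "V \<le> 2 * (c * (W powr (1 / s) * (\<Sum>z\<in>grid N. MM N \<phi> z powr s') powr (1 - 1 / s)))"
      using c0 by simp
    define d where "d = (doob_const s')\<^sup>2"
    have d0: "0 \<le> d" by (simp add: d_def)
    have "(\<Sum>z\<in>grid N. MM N \<phi> z powr s') \<le> d * V"
      using strong_maximal[OF s', of N \<phi>] unfolding d_def V_def \<phi>s .
    then have "(\<Sum>z\<in>grid N. MM N \<phi> z powr s') powr (1 - 1 / s) \<le> (d * V) powr (1 - 1 / s)"
      using s1 by (intro powr_mono2) (auto intro: sum_nonneg)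
    also have "\<dots> = d powr (1 - 1 / s) * V powr (1 - 1 / s)" by (simp add: powr_mult)
    finally have "2 * (c * (W powr (1 / s) * (\<Sum>z\<in>grid N. MM N \<phi> z powr s') powr (1 - 1 / s))) \<le>
        2 * (c * (W powr (1 / s) * (d powr (1 - 1 / s) * V powr (1 - 1 / s))))"
      using c0 by (intro mult_left_mono) auto
    then have "V \<le> (2 * c * W powr (1 / s) * d powr (1 - 1 / s)) * V powr (1 - 1 / s)"
      using V1 by (simp only: mult.assoc)
    then have "V powr (1 - (1 - 1 / s)) \<le> 2 * c * W powr (1 / s) * d powr (1 - 1 / s)"
      using s1 c0 by (intro powr_absorb) (auto simp: V_def intro!: sum_nonneg)
    then have "(V powr (1 / s)) powr s \<le> (2 * c * W powr (1 / s) * d powr (1 - 1 / s)) powr s"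
      using s1 by (intro powr_mono2) auto
    moreover have "0 \<le> V" "0 \<le> W" unfolding V_def W_def by (auto intro: sum_nonneg)
    moreover have "(1 - 1 / s) * s = s - 1" using s1 by (simp add: field_simps)
    ultimately have "V \<le> (2 * c) powr s * W * d powr (s - 1)"
      using s1 by (simp add: powr_mult powr_powr)
    then show ?thesis using False by (simp add: V_def W_def selection_const_def c_def d_def s'_def mult_ac)
  qed
qed

text \<open>Choose sparse rectangles at each level \<open>k\<close> of the maximal function of \<open>g\<close>, and let \<open>T\<close> have the squared
  coefficient \<open>2\<^bsup>k\<beta>\<^esup>\<close> on each of them. The \<open>p\<close>-th power of its square function is then of the size of the sum of
  \<open>2\<^bsup>kr\<^esup>\<close> over the levels present, that is, of the \<open>r\<close>-th power of the maximal function. The paraproduct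
  multiplies the squared coefficients of level \<open>k\<close> by at least \<open>2\<^bsup>2k\<^esup>\<close>, so the \<open>q\<close>-th power of its square function is at least
  \<open>2\<^bsup>kr\<^esup>\<close> on every selected rectangle of level \<open>k\<close>. Both exponents come out as \<open>r\<close> for \<open>\<beta> = 2 r / p\<close>.\<close>

theorem paraproduct_lower:
  fixes p q r :: real
  assumes p: "0 < p" "0 < q" "0 < r" "1 / q = 1 / p + 1 / r"
  shows "\<exists>C>0. \<forall>N g.
    (\<forall>z\<in>grid N. \<exists>n m. 0 < n \<and> n \<le> N \<and> 0 < m \<and> m \<le> N \<and> MM N g z = \<bar>EE n m g z\<bar>) \<longrightarrow>
    (\<exists>T. haar_family N T \<and>
      (\<Sum>z\<in>grid N. MM N (haar_sum N T) z powr p) \<le> C * (\<Sum>z\<in>grid N. MM N g z powr r) \<and>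
      (\<Sum>z\<in>grid N. MM N g z powr r) \<le> C * (\<Sum>z\<in>grid N. MM N (haar_sum N (paraproduct g T)) z powr q))"
proof -
  define \<beta> where "\<beta> = 2 * r / p"
  have \<beta>: "0 < \<beta>" "\<beta> * (p / 2) = r" using p(1-3) by (auto simp: \<beta>_def)
  have exponent: "(\<beta> + 2) * (q / 2) = r"
  proof -
    have "(\<beta> + 2) * (q / 2) = q * (r * (1 / p + 1 / r))" using p(1-3) by (simp add: \<beta>_def field_simps)
    also have "\<dots> = r" unfolding p(4)[symmetric] using p(1-3) by simp
    finally show ?thesis .
  qed
  obtain C1 where C1: "0 < C1" "\<And>N u. (\<Sum>z\<in>grid N. SS N u z powr (q / 2)) \<le> C1 * (\<Sum>z\<in>grid N. MM N u z powr q)"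
    using square_le_maximal[OF p(2)] by blast
  obtain C2 where C2: "0 < C2" "\<And>N T. haar_family N T \<Longrightarrow>
    (\<Sum>z\<in>grid N. MM N (haar_sum N T) z powr p) \<le> C2 * (\<Sum>z\<in>grid N. square_sum N T z powr (p / 2))"
    using maximal_le_square[OF p(1)] by blast
  define c where "c = 1 / (1 - 2 powr (- r))"
  have c0: "0 < c" unfolding c_def using two_powr_minus_less_1[OF p(3)] by simp
  define A1 where "A1 = C2 * selection_const (p / 2) \<beta> r"
  define A2 where "A2 = 2 powr r * (64 * (c * 2 powr r * C1))"
  have A2: "0 < A2" unfolding A2_def using c0 C1(1) by simp
  show ?thesis
  proof (intro exI[of _ "max \<bar>A1\<bar> A2"] conjI allI impI)
    show "0 < max \<bar>A1\<bar> A2" using A2 by simp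
    fix N g assume max: "\<forall>z\<in>grid N. \<exists>n m. 0 < n \<and> n \<le> N \<and> 0 < m \<and> m \<le> N \<and> MM N g z = \<bar>EE n m g z\<bar>"
    define W where "W = (\<Sum>z\<in>grid N. MM N g z powr r)"
    have W0: "0 \<le> W" unfolding W_def by (auto intro: sum_nonneg)
    define \<Omega> where "\<Omega> k = {z\<in>grid N. 2 powr (real_of_int k) < MM N g z}" for k :: int
    obtain K :: "int set" where K0: "finite K \<and>
      (\<forall>z\<in>grid N. MM N g z powr r \<le> 2 powr r * (\<Sum>k\<in>K. 2 powr (k * r) * of_bool (2 powr k < MM N g z)))"
      by (rule exE[OF powr_le_dyadic_layers[of r "grid N" "MM N g", OF p(3) finite_grid MM_nonneg]])
    note K = conjunct1[OF K0] conjunct2[OF K0]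
    define P where "P k x \<longleftrightarrow> sparse_family N g (2 powr (real_of_int k)) (fst x) (snd x) \<and>
        card (\<Omega> k) \<le> 64 * real (card (\<Union>i\<in>fst x. points i))" for k x
    have "\<forall>k. \<exists>x. P k x"
    proof
      fix k
      obtain I D where "sparse_family N g (2 powr (real_of_int k)) I D"
        "card {z\<in>grid N. 2 powr (real_of_int k) < MM N g z} \<le> 64 * real (card (\<Union>i\<in>I. points i))"
        using level_selection[of N g "2 powr (real_of_int k)"] max by blast
      then have "P k (I, D)" by (simp add: P_def \<Omega>_def)
      then show "\<exists>x. P k x" by blast
    qed
    then obtain S where S: "\<forall>k. P k (S k)" by (rule choice[THEN exE])
    define I where "I k = fst (S k)" for k
    define D where "D k = snd (S k)" for k
    have sparse: "sparse_family N g (2 powr (real_of_int k)) (I k) (D k)" for k using S by (simp add: I_def D_def P_def)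
    have I7: "card (\<Omega> k) \<le> 64 * real (card (\<Union>i\<in>I k. points i))" for k using S by (simp add: I_def P_def)
    have I1: "finite (I k)" for k using sparse[of k] by (simp add: sparse_family_def)
    have I2: "\<exists>n m z. i = (n, m, rect n m z) \<and> 0 < n \<and> n \<le> N \<and> 0 < m \<and> m \<le> N \<and> z \<in> grid N \<and>
      2 powr (real_of_int k) < \<bar>EE n m g z\<bar>" if "i \<in> I k" for k i
      using sparse[of k] that unfolding sparse_family_def by blast
    have I6: "(\<Union>i\<in>I k. points i) \<subseteq> \<Omega> k" for k unfolding \<Omega>_def by (rule sparse_family_subset[OF sparse])
    define t where "t n m z = (\<Sum>k\<in>K. 2 powr (k * \<beta>) * of_bool ((n, m, rect n m z) \<in> I k))" for n m z
    define T where "T n m z = sqrt (t (Suc n) (Suc m) z) * (rademacher n (fst z) * rademacher m (snd z))" for n m z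
    have t0: "0 \<le> t n m z" for n m z unfolding t_def by (auto intro!: sum_nonneg)
    have rect_meas: "MEAS n m (\<lambda>z. H (rect n m z))" for n m and H :: "(int \<times> int) set \<Rightarrow> real"
      unfolding MEAS_def X.meas_def Y.meas_def blk1_def blk2_def rect_def by auto
    have T: "haar_family N T"
      unfolding T_def[abs_def] t_def
      by (intro haar_family_rademacher rect_meas[where H = "\<lambda>R. sqrt (\<Sum>k\<in>K. 2 powr (k * \<beta>) * of_bool ((_, _, R) \<in> I k))"])
    have T2: "(T n m z)\<^sup>2 = t (Suc n) (Suc m) z" for n m z
      by (simp add: T_def power_mult_distrib t0)
    have count: "(\<Sum>n<N. \<Sum>m<N. of_bool ((Suc n, Suc m, rect (Suc n) (Suc m) z) \<in> I k)) = (\<Sum>i\<in>I k. ind (points i) z)" for k z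
    proof -
      let ?h = "\<lambda>x. (Suc (fst x), Suc (snd x), rect (Suc (fst x)) (Suc (snd x)) z)"
      let ?B = "{x \<in> {..<N} \<times> {..<N}. ?h x \<in> I k}"
      have "?h ` ?B = {i\<in>I k. z \<in> points i}"
      proof (intro subset_antisym subsetI)
        fix i assume "i \<in> ?h ` ?B"
        then show "i \<in> {i\<in>I k. z \<in> points i}" by (auto simp: points_def rect_self)
      next
        fix i assume i: "i \<in> {i\<in>I k. z \<in> points i}"
        then obtain n m w where nm: "i = (n, m, rect n m w)" "0 < n" "n \<le> N" "0 < m" "m \<le> N" using I2 by blast
        have "z \<in> rect n m w" using i nm(1) by (simp add: points_def)
        then have "rect n m z = rect n m w" by (rule rect_eq)
        then have e: "?h (n - 1, m - 1) = i" using nm(1,2,4) by simp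
        have "n - 1 < N" "m - 1 < N" using nm by linarith+
        then have "(n - 1, m - 1) \<in> ?B" using e i by simp
        then have "?h (n - 1, m - 1) \<in> ?h ` ?B" by (rule imageI)
        then show "i \<in> ?h ` ?B" unfolding e .
      qed
      moreover have "card (?h ` ?B) = card ?B" by (rule card_image) (auto simp: inj_on_def)
      ultimately have "card ?B = card {i\<in>I k. z \<in> points i}" by simp
      moreover have "(\<Sum>n<N. \<Sum>m<N. of_bool ((Suc n, Suc m, rect (Suc n) (Suc m) z) \<in> I k)) = real (card ?B)"
      proof -
        have "(\<Sum>n<N. \<Sum>m<N. of_bool ((Suc n, Suc m, rect (Suc n) (Suc m) z) \<in> I k)) =
          (\<Sum>x\<in>{..<N} \<times> {..<N}. of_bool (?h x \<in> I k) :: real)" by (simp add: sum.cartesian_product')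
        also have "\<dots> = card ?B" by (simp add: of_bool_def sum.If_cases Int_def)
        finally show ?thesis .
      qed
      moreover have "(\<Sum>i\<in>I k. ind (points i) z) = real (card {i\<in>I k. z \<in> points i})"
        unfolding ind_def of_bool_def using I1[of k] by (simp add: sum.If_cases Int_def)
      ultimately show ?thesis by simp
    qed
    have sq: "square_sum N T z = (\<Sum>k\<in>K. 2 powr (k * \<beta>) * (\<Sum>i\<in>I k. ind (points i) z))" for z
    proof -
      have "square_sum N T z = (\<Sum>n<N. \<Sum>k\<in>K. \<Sum>m<N. 2 powr (k * \<beta>) * of_bool ((Suc n, Suc m, rect (Suc n) (Suc m) z) \<in> I k))"
        unfolding square_sum_def T2 t_def by (intro sum.cong[OF refl] sum.swap)
      also have "\<dots> = (\<Sum>k\<in>K. \<Sum>n<N. \<Sum>m<N. 2 powr (k * \<beta>) * of_bool ((Suc n, Suc m, rect (Suc n) (Suc m) z) \<in> I k))"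
        by (rule sum.swap)
      also have "\<dots> = (\<Sum>k\<in>K. 2 powr (k * \<beta>) * (\<Sum>n<N. \<Sum>m<N. of_bool ((Suc n, Suc m, rect (Suc n) (Suc m) z) \<in> I k)))"
        by (simp only: sum_distrib_left)
      finally show ?thesis unfolding count .
    qed
    have "(\<Sum>z\<in>grid N. square_sum N T z powr (p / 2)) \<le> selection_const (p / 2) \<beta> r * W"
      unfolding sq W_def
      by (rule sum_selected_powr_le[where D = D]) (use p(1-3) \<beta> K(1) sparse in auto)
    then have "C2 * (\<Sum>z\<in>grid N. square_sum N T z powr (p / 2)) \<le> A1 * W"
      unfolding A1_def using C2(1) by (simp add: mult.assoc)
    also have "\<dots> \<le> max \<bar>A1\<bar> A2 * W" using W0 by (intro mult_right_mono) auto
    finally have upper: "(\<Sum>z\<in>grid N. MM N (haar_sum N T) z powr p) \<le> max \<bar>A1\<bar> A2 * W"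
      using C2(2)[OF T] by linarith
    define Q where "Q = square_sum N (paraproduct g T)"
    have Qge: "2 powr (k * r) \<le> Q z powr (q / 2)" if k: "k \<in> K" and z: "z \<in> (\<Union>i\<in>I k. points i)" for k z
    proof -
      obtain i where i: "i \<in> I k" "z \<in> points i" using z by blast
      obtain n m w where nm: "i = (n, m, rect n m w)" "0 < n" "n \<le> N" "0 < m" "m \<le> N" "2 powr (real_of_int k) < \<bar>EE n m g w\<bar>"
        using I2[OF i(1)] by blast
      have zw: "z \<in> rect n m w" using i nm(1) by (simp add: points_def)
      have "2 powr (real_of_int k) < \<bar>EE n m g z\<bar>" using nm(6) EE_const_on_rect[OF zw, of g] by simp
      then have "(2 powr (real_of_int k))\<^sup>2 \<le> \<bar>EE n m g z\<bar>\<^sup>2" by (intro power_mono) auto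
      moreover have "2 powr (k * \<beta>) \<le> t n m z"
      proof -
        have "2 powr (k * \<beta>) = 2 powr (k * \<beta>) * of_bool ((n, m, rect n m z) \<in> I k)"
          using i(1) nm(1) rect_eq[OF zw] by simp
        also have "\<dots> \<le> t n m z" unfolding t_def using k K(1) by (intro member_le_sum) auto
        finally show ?thesis .
      qed
      ultimately have "(2 powr (real_of_int k))\<^sup>2 * 2 powr (k * \<beta>) \<le> \<bar>EE n m g z\<bar>\<^sup>2 * t n m z"
        by (intro mult_mono) auto
      also have "\<dots> = (paraproduct g T (n - 1) (m - 1) z)\<^sup>2"
        unfolding paraproduct_def power_mult_distrib T2 using nm by simp
      also have "\<dots> \<le> (\<Sum>m<N. (paraproduct g T (n - 1) m z)\<^sup>2)"
        using nm by (intro member_le_sum[of _ _ "\<lambda>m. (paraproduct g T (n - 1) m z)\<^sup>2"]) auto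
      also have "\<dots> \<le> Q z"
        unfolding Q_def square_sum_def using nm
        by (intro member_le_sum[of _ _ "\<lambda>n. \<Sum>m<N. (paraproduct g T n m z)\<^sup>2"]) (auto intro: sum_nonneg)
      finally have le: "(2 powr (real_of_int k))\<^sup>2 * 2 powr (k * \<beta>) \<le> Q z" .
      have "(2 powr (real_of_int k))\<^sup>2 * 2 powr (k * \<beta>) = 2 powr (k * (\<beta> + 2))"
        unfolding power2_eq_square powr_add[symmetric] by (simp add: algebra_simps)
      then have "(2 powr (k * (\<beta> + 2))) powr (q / 2) \<le> Q z powr (q / 2)"
        using le p(1-3) by (intro powr_mono2) auto
      then show ?thesis unfolding powr_powr mult.assoc exponent .
    qed
    have "W \<le> (\<Sum>z\<in>grid N. 2 powr r * (\<Sum>k\<in>K. 2 powr (k * r) * of_bool (2 powr k < MM N g z)))"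
      unfolding W_def using K(2) by (intro sum_mono) auto
    also have "\<dots> = 2 powr r * (\<Sum>k\<in>K. 2 powr (k * r) * (\<Sum>z\<in>grid N. of_bool (2 powr k < MM N g z)))"
      unfolding sum_distrib_left by (rule sum.swap)
    also have "\<dots> = 2 powr r * (\<Sum>k\<in>K. 2 powr (k * r) * card (\<Omega> k))"
      unfolding \<Omega>_def by (simp add: of_bool_def sum.If_cases Int_def)
    also have "\<dots> \<le> 2 powr r * (\<Sum>k\<in>K. 2 powr (k * r) * (64 * real (card (\<Union>i\<in>I k. points i))))"
      by (intro mult_left_mono sum_mono I7) auto
    also have "\<dots> = 2 powr r * (64 * (\<Sum>k\<in>K. \<Sum>z\<in>grid N. if z \<in> (\<Union>i\<in>I k. points i) then 2 powr (k * r) else 0))"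
    proof -
      have pt: "real (card (\<Union>i\<in>I k. points i)) * x = (\<Sum>z\<in>grid N. if z \<in> (\<Union>i\<in>I k. points i) then x else 0)" for k and x :: real
      proof -
        have "grid N \<inter> (\<Union>i\<in>I k. points i) = (\<Union>i\<in>I k. points i)" using I6[of k] unfolding \<Omega>_def by auto
        then show ?thesis by (subst sum.inter_restrict[symmetric]) auto
      qed
      have "2 powr (k * r) * (64 * real (card (\<Union>i\<in>I k. points i))) =
          64 * (\<Sum>z\<in>grid N. if z \<in> (\<Union>i\<in>I k. points i) then 2 powr (k * r) else 0)" for k
        unfolding pt[of k, symmetric] by simp
      then show ?thesis by (simp only: sum_distrib_left[symmetric])
    qed
    also have "(\<Sum>k\<in>K. \<Sum>z\<in>grid N. if z \<in> (\<Union>i\<in>I k. points i) then 2 powr (k * r) else 0) =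
       (\<Sum>z\<in>grid N. \<Sum>k\<in>{k\<in>K. z \<in> (\<Union>i\<in>I k. points i)}. 2 powr (k * r))"
      by (subst sum.swap, intro sum.cong[OF refl] sum.inter_filter[symmetric] K)
    also have "\<dots> \<le> (\<Sum>z\<in>grid N. c * 2 powr r * Q z powr (q / 2))"
    proof (intro sum_mono)
      fix z
      define b where "b = 2 * (Q z powr (q / 2)) powr (1 / r)"
      have "(\<Sum>k\<in>{k\<in>K. z \<in> (\<Union>i\<in>I k. points i)}. 2 powr (k * r)) \<le> c * b powr r"
        unfolding c_def
      proof (intro dyadic_powr_sum_le)
        fix k assume "k \<in> {k\<in>K. z \<in> (\<Union>i\<in>I k. points i)}"
        then have "2 powr (k * r) \<le> Q z powr (q / 2)" using Qge by blast
        then have "(2 powr (k * r)) powr (1 / r) \<le> (Q z powr (q / 2)) powr (1 / r)"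
          using p(1-3) by (intro powr_mono2) auto
        then have "2 powr (real_of_int k) \<le> (Q z powr (q / 2)) powr (1 / r)" using p(1-3) by (simp add: powr_powr)
        moreover have "(0::real) < 2 powr (real_of_int k)" by simp
        ultimately show "2 powr (real_of_int k) < b" unfolding b_def by linarith
      qed (use p(1-3) K(1) in \<open>auto simp: b_def\<close>)
      also have "b powr r = 2 powr r * Q z powr (q / 2)"
        unfolding b_def using p(1-3) by (simp add: powr_mult powr_powr)
      finally show "(\<Sum>k\<in>{k\<in>K. z \<in> (\<Union>i\<in>I k. points i)}. 2 powr (k * r)) \<le> c * 2 powr r * Q z powr (q / 2)"
        by (simp add: mult.assoc)
    qed
    also have "\<dots> = c * 2 powr r * (\<Sum>z\<in>grid N. SS N (haar_sum N (paraproduct g T)) z powr (q / 2))"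
      unfolding Q_def SS_haar_sum[OF haar_family_paraproduct[OF T]] by (simp add: sum_distrib_left)
    also have "\<dots> \<le> c * 2 powr r * (C1 * (\<Sum>z\<in>grid N. MM N (haar_sum N (paraproduct g T)) z powr q))"
      using c0 by (intro mult_left_mono C1) auto
    finally have "W \<le> A2 * (\<Sum>z\<in>grid N. MM N (haar_sum N (paraproduct g T)) z powr q)"
      by (simp add: A2_def mult.assoc)
    also have "\<dots> \<le> max \<bar>A1\<bar> A2 * (\<Sum>z\<in>grid N. MM N (haar_sum N (paraproduct g T)) z powr q)"
      by (intro mult_right_mono sum_nonneg) auto
    finally show "\<exists>T. haar_family N T \<and>
      (\<Sum>z\<in>grid N. MM N (haar_sum N T) z powr p) \<le> max \<bar>A1\<bar> A2 * (\<Sum>z\<in>grid N. MM N g z powr r) \<and>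
      (\<Sum>z\<in>grid N. MM N g z powr r) \<le> max \<bar>A1\<bar> A2 * (\<Sum>z\<in>grid N. MM N (haar_sum N (paraproduct g T)) z powr q)"
      using T upper unfolding W_def by blast
  qed
qed

section \<open>Sampling functions of the plane on a lattice\<close>

lemma mem_dyadic_interval_iff: "s \<in> dyadic_interval n k \<longleftrightarrow> \<lfloor>s / 2 powi n\<rfloor> = k"
  unfolding dyadic_interval_def floor_eq_iff by (simp add: pos_le_divide_eq pos_divide_less_eq)

lemma measure_dyadic_interval: "measure lborel (dyadic_interval n k) = 2 powi n"
proof -
  have "of_int k * 2 powi n \<le> (of_int k + 1) * (2 powi n :: real)" by (intro mult_right_mono) auto
  then show ?thesis unfolding dyadic_interval_def by (simp add: measure_def algebra_simps)
qed

lemma emeasure_dyadic_interval: "emeasure lborel (dyadic_interval n k) = ennreal (2 powi n)"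
proof -
  have "of_int k * 2 powi n \<le> (of_int k + 1) * (2 powi n :: real)" by (intro mult_right_mono) auto
  then show ?thesis unfolding dyadic_interval_def by (simp add: algebra_simps)
qed

lemma dyadic_interval_borel [measurable, simp]: "dyadic_interval n k \<in> sets borel"
  by (simp add: dyadic_interval_def)

lemma emeasure_lborel_Times:
  fixes A B :: "real set"
  assumes "A \<in> sets borel" "B \<in> sets borel"
  shows "emeasure lborel (A \<times> B) = emeasure lborel A * emeasure lborel B"
  unfolding lborel_prod[symmetric] using assms by (intro lborel.emeasure_pair_measure_Times) auto

lemma measure_lborel_Times:
  fixes A B :: "real set"
  assumes "A \<in> sets borel" "B \<in> sets borel"
  shows "measure lborel (A \<times> B) = measure lborel A * measure lborel B"
  by (simp add: measure_def emeasure_lborel_Times[OF assms] enn2real_mult)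

definition sample :: "nat \<Rightarrow> real \<Rightarrow> int" where
  "sample L s = \<lfloor>s * 2 ^ L\<rfloor>"

lemma mem_dyadic_interval_sample: "s \<in> dyadic_interval (int a - int L) k \<longleftrightarrow> sample L s div 2 ^ a = k"
proof -
  have "s / 2 powi (int a - int L) = s * 2 ^ L / real_of_int (2 ^ a)"
    by (simp add: power_int_diff)
  then have "\<lfloor>s / 2 powi (int a - int L)\<rfloor> = sample L s div 2 ^ a"
    unfolding sample_def by (simp only:) (intro floor_divide_real_eq_div, simp)
  then show ?thesis by (simp add: mem_dyadic_interval_iff)
qed

lemma sample_in_fine_interval:
  assumes "s \<in> dyadic_interval (- int L - int d) k"
  shows "sample L s = k div 2 ^ d"
proof -
  have "\<lfloor>s * 2 ^ (L + d)\<rfloor> = k"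
    using assms mem_dyadic_interval_sample[of s 0 "L + d" k] by (simp add: sample_def)
  moreover have "s * 2 ^ L = s * 2 ^ (L + d) / real_of_int (2 ^ d)" by (simp add: power_add)
  ultimately show ?thesis
    unfolding sample_def by (metis floor_divide_real_eq_div zero_le_numeral zero_le_power)
qed

lemma sample_fibre: "{s. sample L s = x} = dyadic_interval (- int L) x"
  using mem_dyadic_interval_sample[of _ 0 L x] by auto

lemma sample_dyadic_const:
  assumes "s \<in> dyadic_interval n k" "t \<in> dyadic_interval n k"
  shows "sample L s div 2 ^ nat (n + int L) = sample L t div 2 ^ nat (n + int L)"
proof (cases "0 \<le> n + int L")
  case True
  then have "n = int (nat (n + int L)) - int L" by simp
  then show ?thesis using assms mem_dyadic_interval_sample by metis
next
  case False
  then have n: "n = - int L - int (nat (- int L - n))" by simp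
  have "sample L s = sample L t"
    using assms sample_in_fine_interval[of _ L "nat (- int L - n)" k] n by metis
  then show ?thesis by simp
qed

lemma measure_fibre_dyadic:
  assumes s: "s \<in> dyadic_interval n k" and x: "x div 2 ^ nat (n + int L) = sample L s div 2 ^ nat (n + int L)"
  shows "measure lborel (dyadic_interval n k \<inter> {t. sample L t = x}) = 2 powi n / 2 ^ nat (n + int L)"
proof (cases "0 \<le> n + int L")
  case True
  define a where "a = nat (n + int L)"
  have n: "n = int a - int L" using True by (simp add: a_def)
  have "{t. sample L t = x} \<subseteq> dyadic_interval n k"
    using s x mem_dyadic_interval_sample[of _ a L k] unfolding n a_def[symmetric] by auto
  then have "dyadic_interval n k \<inter> {t. sample L t = x} = dyadic_interval (- int L) x"
    by (simp add: sample_fibre Int_absorb1)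
  then show ?thesis
    unfolding a_def[symmetric] by (simp add: measure_dyadic_interval n power_int_diff power_int_minus divide_inverse)
next
  case False
  then have n: "n = - int L - int (nat (- int L - n))" by simp
  have "sample L t = sample L s" if "t \<in> dyadic_interval n k" for t
    using that s sample_in_fine_interval[of _ L "nat (- int L - n)" k] n by metis
  then have "dyadic_interval n k \<inter> {t. sample L t = x} = dyadic_interval n k"
    using x False by auto
  then show ?thesis using False by (simp add: measure_dyadic_interval)
qed

definition cell :: "nat \<Rightarrow> real \<times> real \<Rightarrow> int \<times> int" where
  "cell L z = (sample L (fst z), sample L (snd z))"

definition lift :: "nat \<Rightarrow> (int \<times> int \<Rightarrow> real) \<Rightarrow> real \<times> real \<Rightarrow> real" where
  "lift L h z = h (cell L z)"

lemma cell_fibre: "{z. cell L z = w} = dyadic_interval (- int L) (fst w) \<times> dyadic_interval (- int L) (snd w)"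
  unfolding sample_fibre[symmetric] cell_def by (cases w) auto

lemma emeasure_cell_fibre: "emeasure lborel {z. cell L z = w} = ennreal (1 / 4 ^ L)"
proof -
  have "(2::real) powi (- int L) * 2 powi (- int L) = 1 / 4 ^ L"
    by (simp add: power_int_minus divide_inverse power_mult_distrib[symmetric] flip: inverse_mult_distrib)
  then show ?thesis
    unfolding cell_fibre by (simp add: emeasure_lborel_Times emeasure_dyadic_interval ennreal_mult[symmetric])
qed

lemma cell_fibre_sets [measurable, simp]: "{z. cell L z = w} \<in> sets borel"
  unfolding cell_fibre by (simp add: borel_prod[symmetric])

text \<open>The conversion \<open>nat\<close> covers rectangles finer than the lattice: the
  function is constant across them in the fine direction, and level zero is the right one.\<close>

lemma average_lift:
  assumes z: "z \<in> dyadic_interval n k \<times> dyadic_interval m l"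
  shows "average (lift L h) (dyadic_interval n k \<times> dyadic_interval m l) =
    EE (nat (n + int L)) (nat (m + int L)) h (cell L z)"
proof -
  define a where "a = nat (n + int L)"
  define b where "b = nat (m + int L)"
  let ?R = "dyadic_interval n k \<times> dyadic_interval m l"
  define Q where "Q = rect a b (cell L z)"
  define B where "B w = (dyadic_interval n k \<inter> {t. sample L t = fst w}) \<times> (dyadic_interval m l \<inter> {t. sample L t = snd w})" for w
  have zz: "fst z \<in> dyadic_interval n k" "snd z \<in> dyadic_interval m l" using z by auto
  have mB: "measure lborel (B w) = (2 powi n / 2 ^ a) * (2 powi m / 2 ^ b)" if "w \<in> Q" for w
  proof -
    have "measure lborel (B w) = measure lborel (dyadic_interval n k \<inter> {t. sample L t = fst w}) *
        measure lborel (dyadic_interval m l \<inter> {t. sample L t = snd w})"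
      unfolding B_def by (intro measure_lborel_Times) (simp_all add: sample_fibre)
    also have "\<dots> = (2 powi n / 2 ^ a) * (2 powi m / 2 ^ b)"
      using that measure_fibre_dyadic[OF zz(1), of "fst w" L] measure_fibre_dyadic[OF zz(2), of "snd w" L]
      by (simp add: Q_def rect_def cell_def a_def b_def)
    finally show ?thesis .
  qed
  have sB: "B w \<in> sets lborel" for w unfolding B_def by (simp add: sample_fibre borel_prod[symmetric])
  have fB: "emeasure lborel (B w) < \<infinity>" for w
  proof -
    have "emeasure lborel (B w) \<le> emeasure lborel ?R"
      by (intro emeasure_mono) (auto simp: B_def borel_prod[symmetric])
    also have "\<dots> < \<infinity>" by (simp add: emeasure_lborel_Times emeasure_dyadic_interval ennreal_mult[symmetric])
    finally show ?thesis .
  qed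
  have eq: "indicator ?R z' *\<^sub>R lift L h z' = (\<Sum>w\<in>Q. h w * indicator (B w) z')" for z'
  proof (cases "z' \<in> ?R")
    case True
    have "cell L z' \<in> Q"
      using True zz sample_dyadic_const[of "fst z'" n k "fst z" L] sample_dyadic_const[of "snd z'" m l "snd z" L]
      by (auto simp: Q_def rect_def cell_def a_def b_def)
    moreover have "indicator (B w) z' = (if w = cell L z' then 1 else 0 :: real)" for w
      using True by (cases w) (auto simp: B_def cell_def indicator_def)
    ultimately show ?thesis using True by (simp add: lift_def Q_def mult_delta_right)
  next
    case False
    then have "indicator (B w) z' = (0 :: real)" for w by (auto simp: B_def indicator_def)
    then show ?thesis using False by simp
  qed
  have "(LINT z:?R|lborel. lift L h z) = (\<Sum>w\<in>Q. h w * measure lborel (B w))"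
    unfolding set_lebesgue_integral_def eq using sB fB
    by (subst Bochner_Integration.integral_sum) auto
  also have "\<dots> = (\<Sum>w\<in>Q. h w) * ((2 powi n / 2 ^ a) * (2 powi m / 2 ^ b))"
    unfolding sum_distrib_right by (intro sum.cong refl) (simp only: mB)
  finally show ?thesis
    unfolding average_def EE_eq_sum_rect a_def[symmetric] b_def[symmetric] Q_def
    by (simp add: measure_lborel_Times measure_dyadic_interval power_add)
qed

section \<open>Representation of simple functions\<close>

lemma cell_corner: "cell L (real_of_int x / 2 ^ L, real_of_int y / 2 ^ L) = (x, y)"
  by (simp add: cell_def sample_def)

lemma dyadic_simple_lift:
  assumes "finite {w. h w \<noteq> 0}"
  shows "dyadic_simple (lift L h)"
proof -
  define C where "C w = dyadic_interval (- int L) (fst w) \<times> dyadic_interval (- int L) (snd w)" for w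
  define c where "c Q = h (the_inv C Q)" for Q
  have mem: "z \<in> C w \<longleftrightarrow> cell L z = w" for z w
    unfolding C_def cell_fibre[symmetric] by simp
  have inj: "inj C"
  proof (rule injI)
    fix w w' assume "C w = C w'"
    let ?z = "(real_of_int (fst w) / 2 ^ L, real_of_int (snd w) / 2 ^ L)"
    have "cell L ?z = w" using cell_corner[of L "fst w" "snd w"] by simp
    moreover have "cell L ?z = w'" using mem[of ?z w] mem[of ?z w'] calculation \<open>C w = C w'\<close> by blast
    ultimately show "w = w'" by simp
  qed
  let ?S = "C ` {w. h w \<noteq> 0}"
  have "lift L h z = (\<Sum>Q\<in>?S. c Q * indicator Q z)" for z
  proof -
    have "(\<Sum>Q\<in>?S. c Q * indicator Q z) = (\<Sum>w | h w \<noteq> 0. h w * indicator (C w) z)"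
      using inj inj_on_subset[OF inj subset_UNIV] by (subst sum.reindex) (auto simp: c_def the_inv_f_f)
    also have "\<dots> = (\<Sum>w | h w \<noteq> 0. if w = cell L z then h w else 0)"
      by (intro sum.cong refl) (auto simp: indicator_def mem)
    also have "\<dots> = lift L h z" using assms by (simp add: lift_def)
    finally show ?thesis by simp
  qed
  moreover have "?S \<subseteq> dyadic_squares" unfolding C_def dyadic_squares_def by blast
  ultimately show ?thesis
    unfolding dyadic_simple_def using assms by (intro exI[of _ ?S] exI[of _ c]) auto
qed

text \<open>Sampling on a lattice at least one level finer than the smallest square makes the sampled
  function measurable for level one of both filtrations, so that levels from one on suffice for its
  maximal function.\<close>

lemma dyadic_simple_imp_lift:
  assumes "dyadic_simple f"
  obtains L0 where "\<And>L. L0 \<le> L \<Longrightarrow> \<exists>h. finite {w. h w \<noteq> 0} \<and> f = lift L h \<and> EE 1 1 h = h"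
proof -
  obtain S c where S: "finite S" "S \<subseteq> dyadic_squares" and f: "f = (\<lambda>z. \<Sum>Q\<in>S. c Q * indicator Q z)"
    using assms unfolding dyadic_simple_def by blast
  have "\<forall>Q\<in>S. \<exists>n k l. Q = dyadic_interval n k \<times> dyadic_interval n l"
    using S(2) unfolding dyadic_squares_def by blast
  then obtain n k l where Q: "\<And>Q. Q \<in> S \<Longrightarrow> Q = dyadic_interval (n Q) (k Q) \<times> dyadic_interval (n Q) (l Q)"
    by metis
  define L0 where "L0 = Max (insert 0 ((\<lambda>Q. nat (1 - n Q)) ` S))"
  show thesis
  proof (rule that[of L0])
    fix L assume L: "L0 \<le> L"
    define a where "a Q = nat (n Q + int L)" for Q
    have a: "n Q = int (a Q) - int L \<and> 1 \<le> a Q" if "Q \<in> S" for Q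
    proof -
      have "nat (1 - n Q) \<le> L0" unfolding L0_def using S(1) that by (intro Max_ge) auto
      then have "1 \<le> n Q + int L" using L by linarith
      then show ?thesis unfolding a_def by linarith
    qed
    have mem: "z \<in> Q \<longleftrightarrow> fst (cell L z) div 2 ^ a Q = k Q \<and> snd (cell L z) div 2 ^ a Q = l Q" if "Q \<in> S" for Q z
    proof -
      have "z \<in> Q \<longleftrightarrow> fst z \<in> dyadic_interval (int (a Q) - int L) (k Q) \<and> snd z \<in> dyadic_interval (int (a Q) - int L) (l Q)"
        using Q[OF that] a[OF that] by (metis mem_Times_iff)
      then show ?thesis unfolding mem_dyadic_interval_sample cell_def by simp
    qed
    define h where "h w = (\<Sum>Q\<in>S. c Q * of_bool (fst w div 2 ^ a Q = k Q \<and> snd w div 2 ^ a Q = l Q))" for w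
    show "\<exists>h. finite {w. h w \<noteq> 0} \<and> f = lift L h \<and> EE 1 1 h = h"
    proof (intro exI conjI)
      have "{w. h w \<noteq> 0} \<subseteq> (\<Union>Q\<in>S. {t. t div 2 ^ a Q = k Q} \<times> {t. t div 2 ^ a Q = l Q})"
      proof
        fix w assume "w \<in> {w. h w \<noteq> 0}"
        then obtain Q where "Q \<in> S" "c Q * of_bool (fst w div 2 ^ a Q = k Q \<and> snd w div 2 ^ a Q = l Q) \<noteq> 0"
          unfolding h_def mem_Collect_eq by (rule sum.not_neutral_contains_not_neutral)
        then show "w \<in> (\<Union>Q\<in>S. {t. t div 2 ^ a Q = k Q} \<times> {t. t div 2 ^ a Q = l Q})"
          by (cases w) (auto split: if_splits)
      qed
      then show "finite {w. h w \<noteq> 0}"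
        by (rule finite_subset) (use S(1) finite_cell in blast)
      show "f = lift L h"
        unfolding f lift_def h_def using mem by (intro ext sum.cong refl) (auto simp: indicator_def)
      show "EE 1 1 h = h"
      proof
        fix z
        have "h w = h z" if "w \<in> rect 1 1 z" for w
          unfolding h_def
        proof (intro sum.cong refl)
          fix Q assume "Q \<in> S"
          then have "fst w div 2 ^ a Q = fst z div 2 ^ a Q" "snd w div 2 ^ a Q = snd z div 2 ^ a Q"
            using that div_power_mono[of _ 1 _ "a Q"] a unfolding rect_def by blast+
          then show "c Q * of_bool (fst w div 2 ^ a Q = k Q \<and> snd w div 2 ^ a Q = l Q) =
            c Q * of_bool (fst z div 2 ^ a Q = k Q \<and> snd z div 2 ^ a Q = l Q)" by simp
        qed
        then show "EE 1 1 h z = h z" using EE_cong[of 1 1 z h "\<lambda>_. h z"] by (simp add: EE_const)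
      qed
    qed
  qed
qed

section \<open>Hardy norms as sums over the lattice\<close>

text \<open>The function \<open>pi2 g f\<close> is determined up to a null set only, but its averages are determined, and they are all
  that its Hardy norm depends on.\<close>

definition has_averages :: "nat \<Rightarrow> (real \<times> real \<Rightarrow> real) \<Rightarrow> (nat \<Rightarrow> nat \<Rightarrow> int \<times> int \<Rightarrow> real) \<Rightarrow> bool" where
  "has_averages L F e \<longleftrightarrow> (\<forall>n k m l z. z \<in> dyadic_interval n k \<times> dyadic_interval m l \<longrightarrow>
     average F (dyadic_interval n k \<times> dyadic_interval m l) = e (nat (n + int L)) (nat (m + int L)) (cell L z))"

lemma has_averages_lift: "has_averages L (lift L h) (\<lambda>n m. EE n m h)"
  unfolding has_averages_def by (intro allI impI average_lift)

lemma has_averagesD: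
  assumes "has_averages L F e" "z \<in> dyadic_interval n k \<times> dyadic_interval m l"
  shows "average F (dyadic_interval n k \<times> dyadic_interval m l) = e (nat (n + int L)) (nat (m + int L)) (cell L z)"
  by (rule assms(1)[unfolded has_averages_def, rule_format, OF assms(2)])

lemma fmax_mono: "N \<le> M \<Longrightarrow> fmax N e z \<le> fmax M e z"
  by (rule fmax_le) (rule fmax_ge, auto)

lemma strong_maximal_eq_SUP:
  assumes "has_averages L F e"
  shows "dyadic_strong_maximal F z = (SUP N. ennreal (fmax N e (cell L z)))"
  unfolding dyadic_strong_maximal_def
proof (intro antisym SUP_least)
  fix R assume "R \<in> {R \<in> dyadic_rectangles. z \<in> R}"
  then obtain n k m l where R: "R = dyadic_interval n k \<times> dyadic_interval m l" "z \<in> R"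
    unfolding dyadic_rectangles_def dyadic_intervals_def by blast
  define a where "a = nat (n + int L)"
  define b where "b = nat (m + int L)"
  have "average F R = e a b (cell L z)"
    using has_averagesD[OF assms R(2)[unfolded R(1)]] by (simp only: R(1) a_def b_def)
  then have "\<bar>average F R\<bar> \<le> fmax (max a b) e (cell L z)" using fmax_ge[of a "max a b" b e "cell L z"] by simp
  then have "ennreal \<bar>average F R\<bar> \<le> ennreal (fmax (max a b) e (cell L z))" by (rule ennreal_leI)
  also have "\<dots> \<le> (SUP N. ennreal (fmax N e (cell L z)))" by (rule SUP_upper) simp
  finally show "ennreal \<bar>average F R\<bar> \<le> (SUP N. ennreal (fmax N e (cell L z)))" .
next
  fix N :: nat
  obtain a b where ab: "fmax N e (cell L z) = \<bar>e a b (cell L z)\<bar>" using fmax_attained[of N e "cell L z"] by blast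
  define k where "k = sample L (fst z) div 2 ^ a"
  define l where "l = sample L (snd z) div 2 ^ b"
  let ?R = "dyadic_interval (int a - int L) k \<times> dyadic_interval (int b - int L) l"
  have z: "z \<in> ?R" unfolding mem_Times_iff mem_dyadic_interval_sample k_def l_def by simp
  have "average F ?R = e (nat (int a - int L + int L)) (nat (int b - int L + int L)) (cell L z)"
    by (rule has_averagesD[OF assms z])
  then have "ennreal (fmax N e (cell L z)) = ennreal \<bar>average F ?R\<bar>" using ab by simp
  also have "\<dots> \<le> (SUP R\<in>{R \<in> dyadic_rectangles. z \<in> R}. ennreal \<bar>average F R\<bar>)"
  proof (rule SUP_upper)
    have "?R \<in> dyadic_rectangles" unfolding dyadic_rectangles_def dyadic_intervals_def by blast
    then show "?R \<in> {R \<in> dyadic_rectangles. z \<in> R}" using z by simp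
  qed
  finally show "ennreal (fmax N e (cell L z)) \<le> (SUP R\<in>{R \<in> dyadic_rectangles. z \<in> R}. ennreal \<bar>average F R\<bar>)" .
qed

lemma epowr_ennreal: "0 \<le> x \<Longrightarrow> epowr (ennreal x) a = ennreal (x powr a)"
  by (simp add: epowr_def)

lemma epowr_mono: "0 < a \<Longrightarrow> x \<le> y \<Longrightarrow> epowr x a \<le> epowr y a"
  by (cases x; cases y) (auto simp: epowr_def intro!: ennreal_leI powr_mono2 simp: top_unique)

lemma epowr_epowr: "0 < a \<Longrightarrow> 0 < b \<Longrightarrow> epowr (epowr x a) b = epowr x (a * b)"
  by (cases x) (auto simp: epowr_def powr_powr)

lemma epowr_1 [simp]: "epowr x 1 = x"
  by (cases x) (auto simp: epowr_def)

lemma epowr_inverse: "0 < a \<Longrightarrow> epowr (epowr x a) (1 / a) = x" "0 < a \<Longrightarrow> epowr (epowr x (1 / a)) a = x"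
  by (simp_all add: epowr_epowr)

text \<open>Taking powers is an order isomorphism of the extended half-line.\<close>

lemma epowr_SUP:
  assumes a: "0 < a"
  shows "epowr (SUP i\<in>A. f i) a = (SUP i\<in>A. epowr (f i) a)"
proof (rule antisym)
  let ?S = "SUP i\<in>A. epowr (f i) a"
  have "f i \<le> epowr ?S (1 / a)" if "i \<in> A" for i
  proof -
    have "epowr (epowr (f i) a) (1 / a) \<le> epowr ?S (1 / a)"
      using a that by (intro epowr_mono SUP_upper) auto
    then show ?thesis using a by (simp add: epowr_inverse)
  qed
  then have "epowr (SUP i\<in>A. f i) a \<le> epowr (epowr ?S (1 / a)) a"
    using a by (intro epowr_mono SUP_least) auto
  then show "epowr (SUP i\<in>A. f i) a \<le> ?S" using a by (simp add: epowr_inverse)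
  show "?S \<le> epowr (SUP i\<in>A. f i) a" using a by (intro SUP_least epowr_mono SUP_upper) auto
qed

definition grid_sum :: "real \<Rightarrow> nat \<Rightarrow> (nat \<Rightarrow> nat \<Rightarrow> int \<times> int \<Rightarrow> real) \<Rightarrow> real" where
  "grid_sum p N e = (\<Sum>w\<in>grid N. fmax N e w powr p)"

lemma grid_sum_nonneg [simp]: "0 \<le> grid_sum p N e"
  unfolding grid_sum_def by (auto intro: sum_nonneg)

lemma grid_exhaust: "\<exists>N. w \<in> grid N"
proof -
  define N where "N = nat (max \<bar>fst w\<bar> \<bar>snd w\<bar>) + 1"
  have N: "int N < 2 ^ N" by (rule of_nat_less_two_power)
  have "\<bar>fst w\<bar> < int N" "\<bar>snd w\<bar> < int N" unfolding N_def by auto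
  with N have "\<bar>fst w\<bar> < 2 ^ N" "\<bar>snd w\<bar> < 2 ^ N" by linarith+
  then have "w \<in> grid N" unfolding grid_def by (cases w) auto
  then show ?thesis ..
qed

text \<open>Arbitrarily large rectangles and an unbounded plane are reached by monotone convergence from the levels up
  to \<open>N\<close> on the grid of size \<open>N\<close>.\<close>

theorem hardy_norm_eq_SUP:
  assumes p: "0 < p" and F: "has_averages L F e"
  shows "hardy_norm p F = epowr (ennreal (1 / 4 ^ L) * (SUP N. ennreal (grid_sum p N e))) (1 / p)"
proof -
  define \<psi> where "\<psi> N w = ennreal (fmax N e w powr p * ind (grid N) w)" for N w
  have inc: "incseq (\<lambda>N. \<psi> N w)" for w
  proof (rule incseq_SucI)
    fix N
    have "ind (grid N) w \<le> ind (grid (Suc N)) w" using grid_mono[of N "Suc N"] by (auto simp: ind_def)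
    then show "\<psi> N w \<le> \<psi> (Suc N) w"
      unfolding \<psi>_def using p fmax_nonneg[of N e w] by (intro ennreal_leI mult_mono powr_mono2 fmax_mono) (auto simp: ind_def)
  qed
  have "epowr (dyadic_strong_maximal F z) p = (SUP N. \<psi> N (cell L z))" for z
  proof -
    have "epowr (dyadic_strong_maximal F z) p = (SUP N. ennreal (fmax N e (cell L z) powr p))"
      unfolding strong_maximal_eq_SUP[OF F] epowr_SUP[OF p] by (simp add: epowr_ennreal fmax_nonneg)
    also have "\<dots> = (SUP N. \<psi> N (cell L z))"
    proof (rule antisym)
      show "(SUP N. \<psi> N (cell L z)) \<le> (SUP N. ennreal (fmax N e (cell L z) powr p))"
        by (intro SUP_mono) (auto simp: \<psi>_def ind_def intro!: exI ennreal_leI)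
      obtain M where M: "cell L z \<in> grid M" using grid_exhaust by blast
      show "(SUP N. ennreal (fmax N e (cell L z) powr p)) \<le> (SUP N. \<psi> N (cell L z))"
      proof (rule SUP_mono)
        fix N :: nat
        have "cell L z \<in> grid (max N M)" using M grid_mono[of M "max N M"] by auto
        moreover have "fmax N e (cell L z) powr p \<le> fmax (max N M) e (cell L z) powr p"
          using p by (intro powr_mono2 fmax_mono fmax_nonneg) auto
        ultimately show "\<exists>K\<in>UNIV. ennreal (fmax N e (cell L z) powr p) \<le> \<psi> K (cell L z)"
          by (intro bexI[of _ "max N M"]) (auto simp: \<psi>_def ind_def intro!: ennreal_leI)
      qed
    qed
    finally show ?thesis .
  qed
  moreover have \<psi>_sum: "\<psi> N (cell L z) = (\<Sum>w\<in>grid N. ennreal (fmax N e w powr p) * indicator {z. cell L z = w} z)" for N z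
  proof -
    have "(\<Sum>w\<in>grid N. ennreal (fmax N e w powr p) * indicator {z. cell L z = w} z) =
      (\<Sum>w\<in>grid N. if w = cell L z then ennreal (fmax N e w powr p) else 0)"
      by (intro sum.cong refl) (auto simp: indicator_def)
    then show ?thesis by (simp add: \<psi>_def ind_def)
  qed
  ultimately have "(\<integral>\<^sup>+z. epowr (dyadic_strong_maximal F z) p \<partial>lborel) = (\<integral>\<^sup>+z. (SUP N. \<psi> N (cell L z)) \<partial>lborel)"
    by simp
  also have "\<dots> = (SUP N. \<integral>\<^sup>+z. \<psi> N (cell L z) \<partial>lborel)"
  proof (rule nn_integral_monotone_convergence_SUP)
    show "incseq (\<lambda>N z. \<psi> N (cell L z))" using inc by (auto simp: incseq_def le_fun_def)
    show "(\<lambda>z. \<psi> N (cell L z)) \<in> borel_measurable lborel" for N unfolding \<psi>_sum by measurable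
  qed
  also have "(\<lambda>N. \<integral>\<^sup>+z. \<psi> N (cell L z) \<partial>lborel) = (\<lambda>N. ennreal (1 / 4 ^ L) * ennreal (grid_sum p N e))"
  proof
    fix N
    have "(\<integral>\<^sup>+z. \<psi> N (cell L z) \<partial>lborel) = (\<Sum>w\<in>grid N. ennreal (fmax N e w powr p) * ennreal (1 / 4 ^ L))"
      unfolding \<psi>_sum by (subst nn_integral_sum) (auto simp: nn_integral_cmult_indicator emeasure_cell_fibre)
    also have "\<dots> = ennreal (1 / 4 ^ L) * ennreal (grid_sum p N e)"
      unfolding grid_sum_def by (simp add: sum_distrib_right[symmetric] mult.commute)
    finally show "(\<integral>\<^sup>+z. \<psi> N (cell L z) \<partial>lborel) = ennreal (1 / 4 ^ L) * ennreal (grid_sum p N e)" .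
  qed
  also have "(SUP N. ennreal (1 / 4 ^ L) * ennreal (grid_sum p N e)) = ennreal (1 / 4 ^ L) * (SUP N. ennreal (grid_sum p N e))"
    by (rule SUP_mult_left_ennreal[symmetric])
  finally show ?thesis unfolding hardy_norm_def by simp
qed

section \<open>Haar functions on the lattice\<close>

lemma haar_eq:
  "haar (dyadic_interval n k) s = (if s \<in> dyadic_interval n k
     then (if s \<in> dyadic_interval (n - 1) (2 * k) then 1 else -1) / sqrt (2 powi n) else 0)"
proof -
  define h :: real where "h = 2 powi (n - 1)"
  have h: "0 < h" by (simp add: h_def)
  have n: "(2::real) powi n = 2 * h" unfolding h_def using power_int_add[of "2::real" "n - 1" 1] by simp
  have I: "dyadic_interval n k = {2 * of_int k * h ..< (2 * of_int k + 2) * h}"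
    unfolding dyadic_interval_def n by (simp add: algebra_simps)
  have I': "dyadic_interval (n - 1) (2 * k) = {2 * of_int k * h ..< (2 * of_int k + 1) * h}"
    unfolding dyadic_interval_def h_def by simp
  have lt: "2 * of_int k * h < (2 * of_int k + 2) * h" using h by (intro mult_strict_right_mono) auto
  have mid: "(Inf (dyadic_interval n k) + Sup (dyadic_interval n k)) / 2 = (2 * of_int k + 1) * h"
    unfolding I using lt by (simp add: algebra_simps)
  show ?thesis
  proof (cases "s \<in> dyadic_interval n k")
    case True
    then have "s < (2 * of_int k + 1) * h \<longleftrightarrow> s \<in> dyadic_interval (n - 1) (2 * k)" unfolding I I' by auto
    then show ?thesis unfolding haar_def mid measure_dyadic_interval using True by simp
  qed (simp add: haar_def)
qed

text \<open>On a lattice that resolves the halves of its sides, a Haar function is a normalised product of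
  two Rademacher functions, cut off to a rectangle.\<close>

definition haar_sample :: "int \<Rightarrow> int \<Rightarrow> int \<Rightarrow> int \<Rightarrow> nat \<Rightarrow> nat \<Rightarrow> int \<times> int \<Rightarrow> real" where
  "haar_sample n k m l a b w = (1 / sqrt (2 powi n) * (1 / sqrt (2 powi m)) *
     of_bool (fst w div 2 ^ Suc a = k \<and> snd w div 2 ^ Suc b = l)) * (rademacher a (fst w) * rademacher b (snd w))"

lemma haar_eq_rademacher:
  assumes n: "n = int a + 1 - int L"
  shows "haar (dyadic_interval n k) s = of_bool (sample L s div 2 ^ Suc a = k) / sqrt (2 powi n) * rademacher a (sample L s)"
proof -
  have "s \<in> dyadic_interval n k \<longleftrightarrow> sample L s div 2 ^ Suc a = k"
    using mem_dyadic_interval_sample[of s "Suc a" L k] by (simp add: n algebra_simps)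
  moreover have "s \<in> dyadic_interval (n - 1) (2 * k) \<longleftrightarrow> sample L s div 2 ^ a = 2 * k"
    using mem_dyadic_interval_sample[of s a L "2 * k"] by (simp add: n)
  moreover have "sample L s div 2 ^ a = 2 * k \<longleftrightarrow> even (sample L s div 2 ^ a)" if "sample L s div 2 ^ Suc a = k"
  proof -
    have "sample L s div 2 ^ Suc a = sample L s div 2 ^ a div 2"
      unfolding power_Suc mult.commute[of 2] by (simp add: zdiv_zmult2_eq)
    then show ?thesis using that by (metis dvd_mult_div_cancel dvd_triv_left)
  qed
  ultimately show ?thesis unfolding haar_eq rademacher_def by auto
qed

lemma haar2_eq_lift:
  assumes n: "n = int a + 1 - int L" and m: "m = int b + 1 - int L"
  shows "haar2 (dyadic_interval n k) (dyadic_interval m l) = lift L (haar_sample n k m l a b)"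
  unfolding haar2_def[abs_def] lift_def cell_def haar_sample_def haar_eq_rademacher[OF n] haar_eq_rademacher[OF m]
  by (auto simp: fun_eq_iff)

lemma DD_haar_sample: "DD a b (haar_sample n k m l a b) = haar_sample n k m l a b"
proof -
  have "MEAS (Suc a) (Suc b) (\<lambda>w. 1 / sqrt (2 powi n) * (1 / sqrt (2 powi m)) *
     of_bool (fst w div 2 ^ Suc a = k \<and> snd w div 2 ^ Suc b = l))"
    unfolding MEAS_def X.meas_def Y.meas_def blk1_def blk2_def by (auto simp del: power_Suc)
  then show ?thesis
    unfolding haar_sample_def[abs_def] by (simp only: fun_eq_iff DD_MEAS_mult DD_rademacher) simp
qed

lemma finite_haar_sample: "finite {w. haar_sample n k m l a b w \<noteq> 0}"
proof (rule finite_subset)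
  show "{w. haar_sample n k m l a b w \<noteq> 0} \<subseteq> {t. t div 2 ^ Suc a = k} \<times> {t. t div 2 ^ Suc b = l}"
    unfolding haar_sample_def by (auto simp del: power_Suc split: if_splits)
qed (simp add: finite_cell del: power_Suc)

text \<open>A Haar function has mean zero in each variable and is constant on the halves of its sides. On a lattice
  that is fine enough, this is the formula for the averages of \<open>DD\<close>.\<close>

lemma average_haar2:
  assumes z: "z \<in> dyadic_interval n' k' \<times> dyadic_interval m' l'"
  shows "average (haar2 (dyadic_interval n k) (dyadic_interval m l)) (dyadic_interval n' k' \<times> dyadic_interval m' l') =
    (if n' < n \<and> m' < m then haar2 (dyadic_interval n k) (dyadic_interval m l) z else 0)"
proof -
  define L where "L = nat (max (1 - n) (1 - m))"
  define a where "a = nat (n - 1 + int L)"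
  define b where "b = nat (m - 1 + int L)"
  have n: "n = int a + 1 - int L" and m: "m = int b + 1 - int L" unfolding a_def b_def L_def by auto
  let ?h = "haar_sample n k m l a b"
  have "average (lift L ?h) (dyadic_interval n' k' \<times> dyadic_interval m' l') =
    EE (nat (n' + int L)) (nat (m' + int L)) ?h (cell L z)"
    by (rule average_lift[OF z])
  also have "\<dots> = (if nat (n' + int L) \<le> a \<and> nat (m' + int L) \<le> b then ?h (cell L z) else 0)"
    using EE_DD[of "nat (n' + int L)" "nat (m' + int L)" a b ?h "cell L z"] by (simp only: DD_haar_sample)
  also have "nat (n' + int L) \<le> a \<longleftrightarrow> n' < n" using n by auto
  also have "nat (m' + int L) \<le> b \<longleftrightarrow> m' < m" using m by auto
  finally show ?thesis
    unfolding haar2_eq_lift[OF n m] lift_def[of L ?h z] .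
qed

section \<open>Integrals of sampled functions\<close>

lemma lift_eq_sum:
  assumes "finite A" "{w. h w \<noteq> 0} \<subseteq> A"
  shows "lift L h z = (\<Sum>w\<in>A. h w * indicator {z. cell L z = w} z)"
proof -
  have "(\<Sum>w\<in>A. h w * indicator {z. cell L z = w} z) = (\<Sum>w\<in>A. if w = cell L z then h w else 0)"
    by (intro sum.cong refl) (auto simp: indicator_def)
  also have "\<dots> = lift L h z" using assms by (auto simp: lift_def)
  finally show ?thesis by simp
qed

lemma has_bochner_integral_lift:
  assumes "finite A" "{w. h w \<noteq> 0} \<subseteq> A"
  shows "has_bochner_integral lborel (lift L h) ((\<Sum>w\<in>A. h w) / 4 ^ L)"
proof -
  have "has_bochner_integral lborel (\<lambda>z. \<Sum>w\<in>A. h w * indicator {z. cell L z = w} z) (\<Sum>w\<in>A. h w * (1 / 4 ^ L))"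
  proof (intro has_bochner_integral_sum has_bochner_integral_mult_right)
    fix w
    have "measure lborel {z. cell L z = w} = 1 / 4 ^ L" by (simp add: measure_def emeasure_cell_fibre)
    then show "has_bochner_integral lborel (indicator {z. cell L z = w} :: _ \<Rightarrow> real) (1 / 4 ^ L)"
      using has_bochner_integral_real_indicator[of "{z. cell L z = w}" lborel] by (simp add: emeasure_cell_fibre)
  qed
  moreover have "(\<lambda>z. \<Sum>w\<in>A. h w * indicator {z. cell L z = w} z) = lift L h"
    using lift_eq_sum[OF assms] by (simp add: fun_eq_iff)
  ultimately show ?thesis by (simp add: sum_divide_distrib)
qed

lemma integrable_lift: "finite {w. h w \<noteq> 0} \<Longrightarrow> integrable lborel (lift L h)"
  using has_bochner_integral_lift[of "{w. h w \<noteq> 0}" h L] by (simp add: has_bochner_integral_iff)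

lemma lift_mult: "lift L f z * lift L g z = lift L (\<lambda>w. f w * g w) z"
  by (simp add: lift_def)

lemma integrable_lift_mult:
  assumes "finite {w. f w \<noteq> 0}"
  shows "integrable lborel (\<lambda>z. lift L f z * lift L g z)"
proof -
  have "finite {w. f w * g w \<noteq> 0}" using assms by (rule finite_subset[rotated]) auto
  then show ?thesis unfolding lift_mult by (rule integrable_lift)
qed

lemma finite_subset_grid: "finite A \<Longrightarrow> \<exists>N. A \<subseteq> grid N"
proof (induction A rule: finite_induct)
  case (insert w A)
  then obtain N M where "A \<subseteq> grid N" "w \<in> grid M" using grid_exhaust by blast
  then have "insert w A \<subseteq> grid (max N M)" using grid_mono[of N "max N M"] grid_mono[of M "max N M"] by auto
  then show ?case by blast
qed simp

lemma powi_nat_diff: "(2::real) powi (int a + 1 - int L) = 2 ^ Suc a / 2 ^ L"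
proof -
  have e: "int a + 1 - int L = int (Suc a) - int L" by simp
  show ?thesis unfolding e by (subst power_int_diff) (simp_all del: of_nat_Suc add: power_int_of_nat)
qed

lemma haar2_orthonormal_dyadic:
  "integrable lborel (\<lambda>z. haar2 (dyadic_interval n k) (dyadic_interval m l) z * haar2 (dyadic_interval n' k') (dyadic_interval m' l') z) \<and>
   (LINT z|lborel. haar2 (dyadic_interval n k) (dyadic_interval m l) z * haar2 (dyadic_interval n' k') (dyadic_interval m' l') z) =
     of_bool (n = n' \<and> k = k' \<and> m = m' \<and> l = l')"
proof -
  define L where "L = nat \<bar>1 - n\<bar> + nat \<bar>1 - m\<bar> + nat \<bar>1 - n'\<bar> + nat \<bar>1 - m'\<bar>"
  define a where "a = nat (n - 1 + int L)"
  define b where "b = nat (m - 1 + int L)"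
  define a' where "a' = nat (n' - 1 + int L)"
  define b' where "b' = nat (m' - 1 + int L)"
  have n: "n = int a + 1 - int L" and m: "m = int b + 1 - int L" and n': "n' = int a' + 1 - int L" and m': "m' = int b' + 1 - int L"
  proof -
    have "1 - n \<le> int L" "1 - m \<le> int L" "1 - n' \<le> int L" "1 - m' \<le> int L"
      unfolding L_def by auto
    then show "n = int a + 1 - int L" "m = int b + 1 - int L" "n' = int a' + 1 - int L" "m' = int b' + 1 - int L"
      unfolding a_def b_def a'_def b'_def by simp_all
  qed
  have ab: "a = a' \<and> b = b' \<longleftrightarrow> n = n' \<and> m = m'"
  proof
    assume "a = a' \<and> b = b'"
    then show "n = n' \<and> m = m'" using n m n' m' by (intro conjI) linarith+
  next
    assume "n = n' \<and> m = m'"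
    then show "a = a' \<and> b = b'" by (simp add: a_def a'_def b_def b'_def)
  qed
  let ?h = "haar_sample n k m l a b" and ?h' = "haar_sample n' k' m' l' a' b'"
  have fin: "finite {w. ?h w * ?h' w \<noteq> 0}"
    by (rule finite_subset[OF _ finite_haar_sample[of n k m l a b]]) auto
  obtain N0 where N0: "{w. ?h w \<noteq> 0} \<subseteq> grid N0" using finite_subset_grid[OF finite_haar_sample] by blast
  define N where "N = max N0 (Suc (max a b))"
  have N: "{w. ?h w * ?h' w \<noteq> 0} \<subseteq> grid N" "a < N" "b < N" using N0 grid_mono[of N0 N] by (auto simp: N_def)
  have int: "(LINT z|lborel. lift L ?h z * lift L ?h' z) = (\<Sum>w\<in>grid N. ?h w * ?h' w) / 4 ^ L"
    unfolding lift_mult using has_bochner_integral_lift[OF finite_grid N(1)] by (rule has_bochner_integral_integral_eq)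
  have "(\<Sum>w\<in>grid N. ?h w * ?h' w) = of_bool (n = n' \<and> k = k' \<and> m = m' \<and> l = l') * 4 ^ L"
  proof (cases "a = a' \<and> b = b'")
    case False
    have "(\<Sum>w\<in>grid N. ?h w * ?h' w) = (\<Sum>w\<in>grid N. DD a b ?h w * ?h' w)" by (simp only: DD_haar_sample)
    also have "\<dots> = (\<Sum>w\<in>grid N. ?h w * DD a b (DD a' b' ?h') w)"
      unfolding DD_haar_sample[of a' b'] by (rule sum_DD_adjoint[OF N(2,3), symmetric])
    also have "\<dots> = 0" by (simp only: DD_DD if_not_P[OF False] mult_zero_right sum.neutral_const)
    finally show ?thesis using False unfolding ab by auto
  next
    case True
    then have nm: "n' = n" "m' = m" using ab by auto
    show ?thesis
    proof (cases "k = k' \<and> l = l'")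
      case False
      then have "?h w * ?h' w = 0" for w using True by (auto simp: haar_sample_def simp del: power_Suc)
      then have "(\<Sum>w\<in>grid N. ?h w * ?h' w) = 0" by (simp only: sum.neutral_const)
      moreover have "\<not> (n = n' \<and> k = k' \<and> m = m' \<and> l = l')" using False by blast
      ultimately show ?thesis by (simp only: of_bool_eq mult_zero_left)
    next
      case kl: True
      let ?Q = "{t. t div 2 ^ Suc a = k} \<times> {t. t div 2 ^ Suc b = l}"
      define c where "c = (1 / sqrt (2 powi n) * (1 / sqrt (2 powi m)))\<^sup>2"
      have c: "c = 4 ^ L / (2 ^ Suc a * 2 ^ Suc b)"
      proof -
        have "c = 1 / (2 powi n * 2 powi m)" unfolding c_def by (simp add: power_mult_distrib power_divide)
        also have "2 powi n = (2 ^ Suc a / 2 ^ L :: real)"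
          unfolding n by (rule powi_nat_diff)
        also have "2 powi m = (2 ^ Suc b / 2 ^ L :: real)"
          unfolding m by (rule powi_nat_diff)
        also have "1 / ((2 ^ Suc a / 2 ^ L :: real) * (2 ^ Suc b / 2 ^ L)) = (2 ^ L * 2 ^ L) / (2 ^ Suc a * 2 ^ Suc b)" by simp
        also have "(2 ^ L * 2 ^ L :: real) = 4 ^ L" unfolding power_mult_distrib[symmetric] by simp
        finally show ?thesis .
      qed
      have sq: "?h w * ?h' w = (if w \<in> ?Q then c else 0)" for w
      proof -
        have "?h w * ?h' w = (?h w)\<^sup>2" using True nm kl by (simp add: power2_eq_square)
        also have "\<dots> = (if w \<in> ?Q then c else 0)"
          unfolding haar_sample_def c_def power_mult_distrib rademacher_square by (cases w) (simp add: of_bool_def del: power_Suc)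
        finally show ?thesis .
      qed
      have c0: "c \<noteq> 0" unfolding c by simp
      have "{w. ?h w * ?h' w \<noteq> 0} = ?Q" unfolding sq using c0 by auto
      then have Q: "?Q \<subseteq> grid N" using N(1) by simp
      have "(\<Sum>w\<in>grid N. ?h w * ?h' w) = (\<Sum>w\<in>?Q. c)"
        unfolding sq using Q by (subst sum.inter_restrict[symmetric]) (auto simp: Int_absorb1)
      also have "\<dots> = 2 ^ Suc a * 2 ^ Suc b * c"
        by (simp add: card_cartesian_product card_cell del: power_Suc)
      also have "\<dots> = 4 ^ L" unfolding c by simp
      finally show ?thesis using kl nm by simp
    qed
  qed
  then have "(LINT z|lborel. lift L ?h z * lift L ?h' z) = of_bool (n = n' \<and> k = k' \<and> m = m' \<and> l = l')"
    unfolding int by simp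
  then show ?thesis
    unfolding haar2_eq_lift[OF n m] haar2_eq_lift[OF n' m'] using integrable_lift_mult[OF finite_haar_sample] by blast
qed

lemma dyadic_interval_eq_iff: "dyadic_interval n k = dyadic_interval n' k' \<longleftrightarrow> n = n' \<and> k = k'"
proof
  assume eq: "dyadic_interval n k = dyadic_interval n' k'"
  then have "(2::real) powi n = 2 powi n'" using measure_dyadic_interval by metis
  then have "(2::real) powr n = 2 powr n'" by (simp add: powr_real_of_int' powr_int)
  then have n: "n = n'" by (simp add: powr_inj)
  define s :: real where "s = of_int k * 2 powi n"
  have "\<lfloor>s / 2 powi n\<rfloor> = k" by (simp add: s_def)
  then have "s \<in> dyadic_interval n k" by (simp add: mem_dyadic_interval_iff)
  then have "s \<in> dyadic_interval n k'" using eq n by simp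
  then show "n = n' \<and> k = k'" using n \<open>\<lfloor>s / 2 powi n\<rfloor> = k\<close> by (simp add: mem_dyadic_interval_iff)
qed auto

lemma haar2_orthonormal:
  assumes "i \<in> dyadic_intervals \<times> dyadic_intervals" "j \<in> dyadic_intervals \<times> dyadic_intervals"
  shows "integrable lborel (\<lambda>z. haar2 (fst i) (snd i) z * haar2 (fst j) (snd j) z)"
    and "(LINT z|lborel. haar2 (fst i) (snd i) z * haar2 (fst j) (snd j) z) = of_bool (i = j)"
proof -
  obtain n k m l n' k' m' l' where ij: "i = (dyadic_interval n k, dyadic_interval m l)" "j = (dyadic_interval n' k', dyadic_interval m' l')"
    using assms unfolding dyadic_intervals_def by blast
  have "i = j \<longleftrightarrow> n = n' \<and> k = k' \<and> m = m' \<and> l = l'" unfolding ij by (auto simp: dyadic_interval_eq_iff)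
  then show "integrable lborel (\<lambda>z. haar2 (fst i) (snd i) z * haar2 (fst j) (snd j) z)"
    "(LINT z|lborel. haar2 (fst i) (snd i) z * haar2 (fst j) (snd j) z) = of_bool (i = j)"
    using haar2_orthonormal_dyadic[of n k m l n' k' m' l'] unfolding ij by simp_all
qed

section \<open>Haar coefficients are second differences of averages\<close>

text \<open>The choice of sign in the Haar function cancels in products.\<close>

lemma haar_mult_haar:
  assumes s: "s \<in> dyadic_interval n k" and s': "s \<in> dyadic_interval (n - 1) k'"
  shows "haar (dyadic_interval n k) s * haar (dyadic_interval n k) t =
    indicator (dyadic_interval (n - 1) k') t / 2 powi (n - 1) - indicator (dyadic_interval n k) t / 2 powi n"
proof -
  define L where "L = nat (1 - n)"
  define a where "a = nat (n - 1 + int L)"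
  have n: "n = int a + 1 - int L" unfolding a_def L_def by auto
  have n1: "(2::real) powi n = 2 * 2 powi (n - 1)" using power_int_add[of "2::real" "n - 1" 1] by simp
  have up: "x div 2 ^ Suc a = x div 2 ^ a div 2" for x :: int
    unfolding power_Suc mult.commute[of 2] by (simp add: zdiv_zmult2_eq)
  have I: "x \<in> dyadic_interval n k \<longleftrightarrow> sample L x div 2 ^ a div 2 = k" for x
    using mem_dyadic_interval_sample[of x "Suc a" L k] up by (simp add: n algebra_simps del: power_Suc)
  have I': "x \<in> dyadic_interval (n - 1) j \<longleftrightarrow> sample L x div 2 ^ a = j" for x j
    using mem_dyadic_interval_sample[of x a L j] by (simp add: n)
  define x where "x = sample L s div 2 ^ a"
  define y where "y = sample L t div 2 ^ a"
  have x: "x div 2 = k" "x = k'" using s s' unfolding I I' x_def by auto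
  have sgn: "j = 2 * k \<longleftrightarrow> even j" if "j div 2 = k" for j :: int
    using that by (metis dvd_mult_div_cancel dvd_triv_left)
  have "haar (dyadic_interval n k) s * haar (dyadic_interval n k) t =
      (if y div 2 = k then (if even x then 1 else -1) * (if even y then 1 else -1) / 2 powi n else 0)"
    unfolding haar_eq I I' x_def[symmetric] y_def[symmetric] using x sgn by (simp add: real_sqrt_mult_self)
  also have "\<dots> = (if y div 2 = k then (if y = x then 1 else -1) / 2 powi n else 0)"
  proof (cases "y div 2 = k")
    case True
    have "y = x \<longleftrightarrow> (even x \<longleftrightarrow> even y)" using True x(1) by presburger
    then show ?thesis by auto
  qed simp
  also have "\<dots> = (if y = x then 1 else 0) / 2 powi (n - 1) - (if y div 2 = k then 1 else 0) / 2 powi n"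
    using x by (auto simp: n1)
  also have "\<dots> = indicator (dyadic_interval (n - 1) k') t / 2 powi (n - 1) - indicator (dyadic_interval n k) t / 2 powi n"
    unfolding indicator_def I I' y_def[symmetric] using x(2) by auto
  finally show ?thesis .
qed

text \<open>A term of the Haar series is a second difference of averages. Rectangles with a side no longer than
  the mesh of the lattice contribute nothing.\<close>

lemma haar_coeff_mult_haar2:
  assumes fin: "finite {w. h w \<noteq> 0}" and z: "z \<in> dyadic_interval n k \<times> dyadic_interval m l"
  shows "haar_coeff (lift L h) (dyadic_interval n k) (dyadic_interval m l) * haar2 (dyadic_interval n k) (dyadic_interval m l) z =
    (if 0 < n + int L \<and> 0 < m + int L then DD (nat (n - 1 + int L)) (nat (m - 1 + int L)) h (cell L z) else 0)"
proof -
  define k' where "k' = \<lfloor>fst z / 2 powi (n - 1)\<rfloor>"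
  define l' where "l' = \<lfloor>snd z / 2 powi (m - 1)\<rfloor>"
  define I where "I = dyadic_interval n k"
  define I' where "I' = dyadic_interval (n - 1) k'"
  define J where "J = dyadic_interval m l"
  define J' where "J' = dyadic_interval (m - 1) l'"
  have zz: "fst z \<in> I" "snd z \<in> J" "fst z \<in> I'" "snd z \<in> J'"
    using z unfolding I_def J_def I'_def J'_def k'_def l'_def by (auto simp: mem_dyadic_interval_iff)
  let ?f = "lift L h"
  define A where "A S = (LINT w|lborel. indicator S w * ?f w)" for S :: "(real \<times> real) set"
  have avg: "average ?f (P \<times> Q) = A (P \<times> Q) / (measure lborel P * measure lborel Q)"
    if "P \<in> sets borel" "Q \<in> sets borel" for P Q
    unfolding average_def A_def set_lebesgue_integral_def using that by (simp add: measure_lborel_Times)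
  have int: "integrable lborel (\<lambda>w. indicator S w * ?f w)" if "S \<in> sets borel" for S
    using integrable_mult_indicator[of S lborel ?f] integrable_lift[OF fin, of L] that by simp
  have sets: "I \<in> sets borel" "J \<in> sets borel" "I' \<in> sets borel" "J' \<in> sets borel"
    by (simp_all add: I_def J_def I'_def J'_def)
  have sets2: "P \<times> Q \<in> sets borel" if "P \<in> sets borel" "Q \<in> sets borel" for P Q :: "real set"
    using that by (simp add: borel_prod[symmetric])
  have meas: "measure lborel I = 2 powi n" "measure lborel J = 2 powi m" "measure lborel I' = 2 powi (n - 1)" "measure lborel J' = 2 powi (m - 1)"
    by (simp_all add: I_def J_def I'_def J'_def measure_dyadic_interval)
  have "haar_coeff ?f I J * haar2 I J z = (LINT w|lborel. ?f w * haar2 I J w * haar2 I J z)"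
    unfolding haar_coeff_def by simp
  also have "\<dots> = (LINT w|lborel. indicator (I' \<times> J') w * ?f w / (2 powi (n - 1) * 2 powi (m - 1))
      - indicator (I \<times> J') w * ?f w / (2 powi n * 2 powi (m - 1))
      - indicator (I' \<times> J) w * ?f w / (2 powi (n - 1) * 2 powi m)
      + indicator (I \<times> J) w * ?f w / (2 powi n * 2 powi m))"
  proof (intro Bochner_Integration.integral_cong refl)
    fix w
    have "?f w * haar2 I J w * haar2 I J z = ?f w * (haar I (fst z) * haar I (fst w)) * (haar J (snd z) * haar J (snd w))"
      unfolding haar2_def by (simp only: mult_ac)
    also have "haar I (fst z) * haar I (fst w) = indicator I' (fst w) / 2 powi (n - 1) - indicator I (fst w) / 2 powi n"
      unfolding I_def I'_def using zz by (intro haar_mult_haar) (auto simp: I_def I'_def)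
    also have "haar J (snd z) * haar J (snd w) = indicator J' (snd w) / 2 powi (m - 1) - indicator J (snd w) / 2 powi m"
      unfolding J_def J'_def using zz by (intro haar_mult_haar) (auto simp: J_def J'_def)
    finally show "?f w * haar2 I J w * haar2 I J z = indicator (I' \<times> J') w * ?f w / (2 powi (n - 1) * 2 powi (m - 1))
      - indicator (I \<times> J') w * ?f w / (2 powi n * 2 powi (m - 1))
      - indicator (I' \<times> J) w * ?f w / (2 powi (n - 1) * 2 powi m)
      + indicator (I \<times> J) w * ?f w / (2 powi n * 2 powi m)"
      by (cases w) (auto simp: indicator_def algebra_simps)
  qed
  also have "\<dots> = A (I' \<times> J') / (2 powi (n - 1) * 2 powi (m - 1)) - A (I \<times> J') / (2 powi n * 2 powi (m - 1))
      - A (I' \<times> J) / (2 powi (n - 1) * 2 powi m) + A (I \<times> J) / (2 powi n * 2 powi m)"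
    unfolding A_def using int[OF sets2] sets by simp
  also have "\<dots> = average ?f (I' \<times> J') - average ?f (I \<times> J') - average ?f (I' \<times> J) + average ?f (I \<times> J)"
    using avg sets meas by simp
  also have "\<dots> = EE (nat (n - 1 + int L)) (nat (m - 1 + int L)) h (cell L z) - EE (nat (n + int L)) (nat (m - 1 + int L)) h (cell L z)
     - EE (nat (n - 1 + int L)) (nat (m + int L)) h (cell L z) + EE (nat (n + int L)) (nat (m + int L)) h (cell L z)"
    using zz unfolding I_def J_def I'_def J'_def
    by (intro arg_cong2[of _ _ _ _ "(+)"] arg_cong2[of _ _ _ _ "(-)"] average_lift) (auto simp: mem_Times_iff)
  also have "\<dots> = (if 0 < n + int L \<and> 0 < m + int L then DD (nat (n - 1 + int L)) (nat (m - 1 + int L)) h (cell L z) else 0)"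
  proof (cases "0 < n + int L \<and> 0 < m + int L")
    case True
    then have "nat (n + int L) = Suc (nat (n - 1 + int L))" "nat (m + int L) = Suc (nat (m - 1 + int L))" by auto
    then show ?thesis using True unfolding DD_eq_EE by simp
  next
    case False
    then have "nat (n + int L) = nat (n - 1 + int L) \<or> nat (m + int L) = nat (m - 1 + int L)" by auto
    then show ?thesis using False by auto
  qed
  finally show ?thesis unfolding I_def J_def .
qed

section \<open>Orthonormal expansions in \<open>L\<^sup>2\<close>\<close>

locale orthonormal_family =
  fixes M :: "'a measure" and \<Lambda> :: "'i set" and e :: "'i \<Rightarrow> 'a \<Rightarrow> real"
  assumes e_meas: "i \<in> \<Lambda> \<Longrightarrow> e i \<in> borel_measurable M"
    and e_int: "i \<in> \<Lambda> \<Longrightarrow> j \<in> \<Lambda> \<Longrightarrow> integrable M (\<lambda>z. e i z * e j z)"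
    and e_orth: "i \<in> \<Lambda> \<Longrightarrow> j \<in> \<Lambda> \<Longrightarrow> (LINT z|M. e i z * e j z) = of_bool (i = j)"
begin

lemma finite_expansion:
  assumes A: "finite A" "A \<subseteq> \<Lambda>"
  shows "integrable M (\<lambda>z. (\<Sum>i\<in>A. d i * e i z)\<^sup>2)" "(LINT z|M. (\<Sum>i\<in>A. d i * e i z)\<^sup>2) = (\<Sum>i\<in>A. (d i)\<^sup>2)"
proof -
  have eq: "(\<Sum>i\<in>A. d i * e i z)\<^sup>2 = (\<Sum>i\<in>A. \<Sum>j\<in>A. d i * d j * (e i z * e j z))" for z
    unfolding power2_eq_square sum_product by (simp only: mult_ac)
  have int: "integrable M (\<lambda>z. d i * d j * (e i z * e j z))" if "i \<in> A" "j \<in> A" for i j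
    using that A e_int by (intro integrable_mult_right) auto
  show "integrable M (\<lambda>z. (\<Sum>i\<in>A. d i * e i z)\<^sup>2)"
    unfolding eq by (intro Bochner_Integration.integrable_sum int)
  have "(LINT z|M. (\<Sum>i\<in>A. d i * e i z)\<^sup>2) = (\<Sum>i\<in>A. \<Sum>j\<in>A. LINT z|M. d i * d j * (e i z * e j z))"
    unfolding eq using int by (simp add: Bochner_Integration.integral_sum Bochner_Integration.integrable_sum del: integral_mult_right_zero)
  also have "\<dots> = (\<Sum>i\<in>A. \<Sum>j\<in>A. if i = j then d i * d j else 0)"
    using A e_orth by (intro sum.cong refl) (auto simp: subset_iff)
  also have "\<dots> = (\<Sum>i\<in>A. (d i)\<^sup>2)" using A by (simp add: power2_eq_square)
  finally show "(LINT z|M. (\<Sum>i\<in>A. d i * e i z)\<^sup>2) = (\<Sum>i\<in>A. (d i)\<^sup>2)" .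
qed

lemma bessel:
  assumes A: "finite A" "A \<subseteq> \<Lambda>" and f2: "integrable M (\<lambda>z. (f z)\<^sup>2)"
    and fe: "\<And>i. i \<in> A \<Longrightarrow> integrable M (\<lambda>z. f z * e i z)"
  shows "(\<Sum>i\<in>A. (LINT z|M. f z * e i z)\<^sup>2) \<le> (LINT z|M. (f z)\<^sup>2)"
proof -
  define a where "a i = (LINT z|M. f z * e i z)" for i
  define g where "g z = (\<Sum>i\<in>A. a i * e i z)" for z
  have g2: "integrable M (\<lambda>z. (g z)\<^sup>2)" "(LINT z|M. (g z)\<^sup>2) = (\<Sum>i\<in>A. (a i)\<^sup>2)"
    unfolding g_def using finite_expansion[OF A] by auto
  have fg_eq: "f z * g z = (\<Sum>i\<in>A. a i * (f z * e i z))" for z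
    unfolding g_def sum_distrib_left by (simp only: mult_ac)
  have fg: "integrable M (\<lambda>z. f z * g z)" "(LINT z|M. f z * g z) = (\<Sum>i\<in>A. (a i)\<^sup>2)"
    unfolding fg_eq using fe by (auto simp: Bochner_Integration.integral_sum a_def power2_eq_square)
  have "(f z - g z)\<^sup>2 = (f z)\<^sup>2 - 2 * (f z * g z) + (g z)\<^sup>2" for z by (simp add: power2_diff)
  then have "(LINT z|M. (f z - g z)\<^sup>2) = (LINT z|M. (f z)\<^sup>2) - 2 * (LINT z|M. f z * g z) + (LINT z|M. (g z)\<^sup>2)"
    using f2 g2(1) fg(1) by simp
  moreover have "0 \<le> (LINT z|M. (f z - g z)\<^sup>2)" by simp
  ultimately show ?thesis using g2(2) fg(2) unfolding a_def by linarith
qed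

text \<open>The pointwise sum of an expansion with square summable coefficients is its sum in \<open>L\<^sup>2\<close>: Fatou's
  lemma along an exhaustion of the index set turns the remainder of a finite partial sum into the
  remainder of the sum of squares.\<close>

lemma riesz_fischer_pointwise:
  assumes count: "countable \<Lambda>"
    and sq: "(\<lambda>i. (c i)\<^sup>2) summable_on \<Lambda>" and pt: "\<And>z. (\<lambda>i. c i * e i z) summable_on \<Lambda>"
  defines "F \<equiv> \<lambda>z. \<Sum>\<^sub>\<infinity>i\<in>\<Lambda>. c i * e i z"
  shows "F \<in> borel_measurable M" "integrable M (\<lambda>z. (F z)\<^sup>2)"
    "((\<lambda>A. LINT z|M. (F z - (\<Sum>i\<in>A. c i * e i z))\<^sup>2) \<longlongrightarrow> 0) (finite_subsets_at_top \<Lambda>)"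
proof -
  define B where "B N = {i\<in>\<Lambda>. to_nat_on \<Lambda> i < N}" for N
  have B: "finite (B N)" "B N \<subseteq> \<Lambda>" for N
  proof -
    have "inj_on (to_nat_on \<Lambda>) (B N)"
      using inj_on_to_nat_on[OF count] by (rule inj_on_subset) (auto simp: B_def)
    moreover have "finite (to_nat_on \<Lambda> ` B N)" by (rule finite_subset[of _ "{..<N}"]) (auto simp: B_def)
    ultimately show "finite (B N)" by (rule finite_imageD[rotated])
  qed (auto simp: B_def)
  have B_sup: "eventually (\<lambda>N. X \<subseteq> B N) sequentially" if X: "finite X" "X \<subseteq> \<Lambda>" for X
  proof (rule eventually_sequentiallyI)
    fix N assume N: "Suc (Max (insert 0 (to_nat_on \<Lambda> ` X))) \<le> N"
    show "X \<subseteq> B N"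
    proof
      fix i assume "i \<in> X"
      then have "to_nat_on \<Lambda> i \<le> Max (insert 0 (to_nat_on \<Lambda> ` X))" using X(1) by (intro Max_ge) auto
      then show "i \<in> B N" using N X(2) \<open>i \<in> X\<close> by (auto simp: B_def)
    qed
  qed
  have B_lim: "filterlim B (finite_subsets_at_top \<Lambda>) sequentially"
    unfolding filterlim_finite_subsets_at_top using B B_sup by (auto elim!: eventually_mono)
  have lim: "(\<lambda>N. \<Sum>i\<in>B N. c i * e i z) \<longlonglongrightarrow> F z" for z
  proof -
    have "(sum (\<lambda>i. c i * e i z) \<longlongrightarrow> F z) (finite_subsets_at_top \<Lambda>)"
      using has_sum_infsum[OF pt[of z]] unfolding has_sum_def F_def .
    then show ?thesis using B_lim by (rule filterlim_compose)
  qed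
  have part_meas: "(\<lambda>z. \<Sum>i\<in>A. c i * e i z) \<in> borel_measurable M" if "A \<subseteq> \<Lambda>" for A
    using that e_meas by (intro borel_measurable_sum borel_measurable_times) auto
  show F_meas: "F \<in> borel_measurable M"
    by (rule borel_measurable_LIMSEQ_real[OF lim part_meas[OF B(2)]])
  define tot where "tot = (\<Sum>\<^sub>\<infinity>i\<in>\<Lambda>. (c i)\<^sup>2)"
  have part_le: "(\<Sum>i\<in>A. (c i)\<^sup>2) \<le> tot" if "finite A" "A \<subseteq> \<Lambda>" for A
    unfolding tot_def using that sq by (intro finite_sum_le_infsum) auto
  have fatou: "(\<integral>\<^sup>+z. ennreal ((F z - (\<Sum>i\<in>A. c i * e i z))\<^sup>2) \<partial>M) \<le> ennreal (tot - (\<Sum>i\<in>A. (c i)\<^sup>2))"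
    if A: "finite A" "A \<subseteq> \<Lambda>" for A
  proof -
    define u where "u N z = ennreal (((\<Sum>i\<in>B N. c i * e i z) - (\<Sum>i\<in>A. c i * e i z))\<^sup>2)" for N z
    have "(\<lambda>N. u N z) \<longlonglongrightarrow> ennreal ((F z - (\<Sum>i\<in>A. c i * e i z))\<^sup>2)" for z
      unfolding u_def by (intro tendsto_ennrealI tendsto_intros lim)
    then have "liminf (\<lambda>N. u N z) = ennreal ((F z - (\<Sum>i\<in>A. c i * e i z))\<^sup>2)" for z
      by (intro lim_imp_Liminf) auto
    then have "(\<integral>\<^sup>+z. ennreal ((F z - (\<Sum>i\<in>A. c i * e i z))\<^sup>2) \<partial>M) = (\<integral>\<^sup>+z. liminf (\<lambda>N. u N z) \<partial>M)" by simp
    also have "\<dots> \<le> liminf (\<lambda>N. \<integral>\<^sup>+z. u N z \<partial>M)"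
    proof (rule nn_integral_liminf)
      show "u N \<in> borel_measurable M" for N
        unfolding u_def using part_meas[OF B(2), of N] part_meas[OF A(2)] by measurable
    qed
    also have "\<dots> \<le> liminf (\<lambda>N. ennreal (tot - (\<Sum>i\<in>A. (c i)\<^sup>2)))"
    proof (rule Liminf_mono, rule eventually_mono[OF B_sup[OF A]])
      fix N assume sub: "A \<subseteq> B N"
      have u: "u N z = ennreal ((\<Sum>i\<in>B N - A. c i * e i z)\<^sup>2)" for z
        unfolding u_def using sum_diff[OF B(1) sub, of "\<lambda>i. c i * e i z"] by simp
      have D: "finite (B N - A)" "B N - A \<subseteq> \<Lambda>" using B by auto
      have "(\<integral>\<^sup>+z. u N z \<partial>M) = ennreal (\<Sum>i\<in>B N - A. (c i)\<^sup>2)"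
        unfolding u using finite_expansion[OF D, of c] by (subst nn_integral_eq_integral) auto
      also have "(\<Sum>i\<in>B N - A. (c i)\<^sup>2) = (\<Sum>i\<in>B N. (c i)\<^sup>2) - (\<Sum>i\<in>A. (c i)\<^sup>2)"
        by (rule sum_diff[OF B(1) sub])
      finally show "(\<integral>\<^sup>+z. u N z \<partial>M) \<le> ennreal (tot - (\<Sum>i\<in>A. (c i)\<^sup>2))"
        using part_le[OF B] by (auto intro!: ennreal_leI)
    qed
    finally show ?thesis by (simp add: Liminf_const)
  qed
  have rem: "integrable M (\<lambda>z. (F z - (\<Sum>i\<in>A. c i * e i z))\<^sup>2)"
    "(LINT z|M. (F z - (\<Sum>i\<in>A. c i * e i z))\<^sup>2) \<le> tot - (\<Sum>i\<in>A. (c i)\<^sup>2)" if A: "finite A" "A \<subseteq> \<Lambda>" for A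
  proof -
    have m: "(\<lambda>z. (F z - (\<Sum>i\<in>A. c i * e i z))\<^sup>2) \<in> borel_measurable M"
      using F_meas part_meas[OF A(2)] by measurable
    show int: "integrable M (\<lambda>z. (F z - (\<Sum>i\<in>A. c i * e i z))\<^sup>2)"
      using le_less_trans[OF fatou[OF A] ennreal_less_top] m by (intro integrableI_nonneg) auto
    have "ennreal (LINT z|M. (F z - (\<Sum>i\<in>A. c i * e i z))\<^sup>2) \<le> ennreal (tot - (\<Sum>i\<in>A. (c i)\<^sup>2))"
      using fatou[OF A] nn_integral_eq_integral[OF int] by simp
    then show "(LINT z|M. (F z - (\<Sum>i\<in>A. c i * e i z))\<^sup>2) \<le> tot - (\<Sum>i\<in>A. (c i)\<^sup>2)"
      using part_le[OF A] by (subst (asm) ennreal_le_iff) auto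
  qed
  show "integrable M (\<lambda>z. (F z)\<^sup>2)" using rem(1)[of "{}"] by simp
  show "((\<lambda>A. LINT z|M. (F z - (\<Sum>i\<in>A. c i * e i z))\<^sup>2) \<longlongrightarrow> 0) (finite_subsets_at_top \<Lambda>)"
  proof (rule tendsto_sandwich)
    show "\<forall>\<^sub>F A in finite_subsets_at_top \<Lambda>. 0 \<le> (LINT z|M. (F z - (\<Sum>i\<in>A. c i * e i z))\<^sup>2)"
      by (intro always_eventually allI integral_nonneg_AE) auto
    show "\<forall>\<^sub>F A in finite_subsets_at_top \<Lambda>. (LINT z|M. (F z - (\<Sum>i\<in>A. c i * e i z))\<^sup>2) \<le> tot - (\<Sum>i\<in>A. (c i)\<^sup>2)"
      using rem(2) by (rule eventually_finite_subsets_at_top_weakI)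
    have "((\<lambda>A. \<Sum>i\<in>A. (c i)\<^sup>2) \<longlongrightarrow> tot) (finite_subsets_at_top \<Lambda>)"
      using has_sum_infsum[OF sq] unfolding has_sum_def tot_def .
    from tendsto_diff[OF tendsto_const[of tot] this]
    show "((\<lambda>A. tot - (\<Sum>i\<in>A. (c i)\<^sup>2)) \<longlongrightarrow> 0) (finite_subsets_at_top \<Lambda>)" by simp
  qed (rule tendsto_const)
qed

end

lemma countable_dyadic_intervals: "countable dyadic_intervals"
proof -
  have "dyadic_intervals = (\<lambda>(n, k). dyadic_interval n k) ` UNIV" unfolding dyadic_intervals_def by auto
  then show ?thesis by (metis countable_image countableI_type)
qed

lemma haar2_borel [measurable]:
  assumes "i \<in> dyadic_intervals \<times> dyadic_intervals"
  shows "haar2 (fst i) (snd i) \<in> borel_measurable lborel"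
proof -
  obtain n k m l where i: "i = (dyadic_interval n k, dyadic_interval m l)" using assms unfolding dyadic_intervals_def by blast
  define L where "L = nat (max (1 - n) (1 - m))"
  have nm: "n = int (nat (n - 1 + int L)) + 1 - int L" "m = int (nat (m - 1 + int L)) + 1 - int L" unfolding L_def by auto
  have "haar2 (fst i) (snd i) = lift L (haar_sample n k m l (nat (n - 1 + int L)) (nat (m - 1 + int L)))"
    unfolding i fst_conv snd_conv by (rule haar2_eq_lift[OF nm])
  then show ?thesis using borel_measurable_integrable[OF integrable_lift[OF finite_haar_sample]] by simp
qed

interpretation haar: orthonormal_family lborel "dyadic_intervals \<times> dyadic_intervals" "\<lambda>i. haar2 (fst i) (snd i)"
  using haar2_borel haar2_orthonormal by unfold_locales

section \<open>The paraproduct on the lattice\<close>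

definition pi2_coeff :: "nat \<Rightarrow> (int \<times> int \<Rightarrow> real) \<Rightarrow> (int \<times> int \<Rightarrow> real) \<Rightarrow> real set \<times> real set \<Rightarrow> real" where
  "pi2_coeff L g f i = haar_coeff (lift L f) (fst i) (snd i) * average (lift L g) (fst i \<times> snd i)"

text \<open>The rectangles around a point whose halves in both directions are resolved by the lattice; at this point
  all other terms of the series vanish.\<close>

definition around :: "nat \<Rightarrow> real \<times> real \<Rightarrow> nat \<times> nat \<Rightarrow> real set \<times> real set" where
  "around L z x =
    (dyadic_interval (int (fst x) + 1 - int L) (sample L (fst z) div 2 ^ Suc (fst x)),
     dyadic_interval (int (snd x) + 1 - int L) (sample L (snd z) div 2 ^ Suc (snd x)))"

abbreviation haar_paraproduct :: "(int \<times> int \<Rightarrow> real) \<Rightarrow> (int \<times> int \<Rightarrow> real) \<Rightarrow> nat \<Rightarrow> nat \<Rightarrow> int \<times> int \<Rightarrow> real" where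
  "haar_paraproduct g f \<equiv> paraproduct g (\<lambda>n m. DD n m f)"

lemma mem_dyadic_interval_Suc: "s \<in> dyadic_interval (int a + 1 - int L) k \<longleftrightarrow> sample L s div 2 ^ Suc a = k"
proof -
  have e: "int a + 1 - int L = int (Suc a) - int L" by simp
  show ?thesis unfolding e by (rule mem_dyadic_interval_sample)
qed

lemma mem_around: "z \<in> fst (around L z x) \<times> snd (around L z x)"
  unfolding around_def fst_conv snd_conv mem_Times_iff mem_dyadic_interval_Suc by simp

lemma around_dyadic: "around L z x \<in> dyadic_intervals \<times> dyadic_intervals"
  unfolding around_def dyadic_intervals_def by blast

lemma inj_around: "inj (around L z)"
  unfolding inj_def around_def by (auto simp: dyadic_interval_eq_iff)

lemma coeff_around:
  assumes f: "finite {w. f w \<noteq> 0}"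
  shows "pi2_coeff L g f (around L z x) * haar2 (fst (around L z x)) (snd (around L z x)) z = haar_paraproduct g f (fst x) (snd x) (cell L z)"
proof -
  define n where "n = int (fst x) + 1 - int L"
  define m where "m = int (snd x) + 1 - int L"
  define k where "k = sample L (fst z) div 2 ^ Suc (fst x)"
  define l where "l = sample L (snd z) div 2 ^ Suc (snd x)"
  have ar: "around L z x = (dyadic_interval n k, dyadic_interval m l)" unfolding around_def n_def m_def k_def l_def ..
  have z: "z \<in> dyadic_interval n k \<times> dyadic_interval m l" using mem_around[of z L x] unfolding ar by simp
  have nm: "0 < n + int L" "0 < m + int L" "nat (n - 1 + int L) = fst x" "nat (m - 1 + int L) = snd x"
    "nat (n + int L) = Suc (fst x)" "nat (m + int L) = Suc (snd x)" unfolding n_def m_def by auto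
  have "haar_coeff (lift L f) (dyadic_interval n k) (dyadic_interval m l) * haar2 (dyadic_interval n k) (dyadic_interval m l) z =
    DD (fst x) (snd x) f (cell L z)"
    using haar_coeff_mult_haar2[OF f z] nm by simp
  moreover have "average (lift L g) (dyadic_interval n k \<times> dyadic_interval m l) = EE (Suc (fst x)) (Suc (snd x)) g (cell L z)"
    using average_lift[OF z, of L g] nm by simp
  ultimately show ?thesis
    unfolding ar pi2_coeff_def paraproduct_def by (simp add: mult_ac)
qed

lemma coeff_not_around:
  assumes f: "finite {w. f w \<noteq> 0}" and i: "i \<in> dyadic_intervals \<times> dyadic_intervals - range (around L z)"
  shows "pi2_coeff L g f i * haar2 (fst i) (snd i) z = 0"
proof -
  obtain n k m l where ij: "i = (dyadic_interval n k, dyadic_interval m l)" using i unfolding dyadic_intervals_def by blast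
  show ?thesis
  proof (cases "z \<in> dyadic_interval n k \<times> dyadic_interval m l")
    case z: True
    have "\<not> (0 < n + int L \<and> 0 < m + int L)"
    proof
      assume nm: "0 < n + int L \<and> 0 < m + int L"
      define a where "a = nat (n - 1 + int L)"
      define b where "b = nat (m - 1 + int L)"
      have ab: "n = int a + 1 - int L" "m = int b + 1 - int L" using nm by (auto simp: a_def b_def)
      have "sample L (fst z) div 2 ^ Suc a = k" "sample L (snd z) div 2 ^ Suc b = l"
        using z unfolding ab mem_Times_iff fst_conv snd_conv mem_dyadic_interval_Suc by auto
      then have "around L z (a, b) = i" unfolding around_def ij fst_conv snd_conv ab[symmetric] by simp
      then show False using i by blast
    qed
    then have "haar_coeff (lift L f) (dyadic_interval n k) (dyadic_interval m l) * haar2 (dyadic_interval n k) (dyadic_interval m l) z = 0"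
      using haar_coeff_mult_haar2[OF f z, of L] by (simp only: if_False)
    then show ?thesis unfolding ij pi2_coeff_def by auto
  next
    case False
    then have "haar2 (dyadic_interval n k) (dyadic_interval m l) z = 0" unfolding haar2_def haar_def by (auto simp: mem_Times_iff)
    then show ?thesis unfolding ij by simp
  qed
qed

text \<open>The weight \<open>\<theta>\<close> serves to restrict the series to the rectangles that contribute to an average.\<close>

lemma has_sum_around:
  assumes f: "finite {w. f w \<noteq> 0}"
  shows "((\<lambda>i. pi2_coeff L g f i * haar2 (fst i) (snd i) z * \<theta> i) has_sum S) (dyadic_intervals \<times> dyadic_intervals) \<longleftrightarrow>
    ((\<lambda>x. haar_paraproduct g f (fst x) (snd x) (cell L z) * \<theta> (around L z x)) has_sum S) UNIV"
proof -
  let ?t = "\<lambda>i. pi2_coeff L g f i * haar2 (fst i) (snd i) z * \<theta> i"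
  have "(?t has_sum S) (dyadic_intervals \<times> dyadic_intervals) \<longleftrightarrow> (?t has_sum S) (range (around L z))"
  proof (rule has_sum_cong_neutral)
    fix i assume "i \<in> range (around L z) - dyadic_intervals \<times> dyadic_intervals"
    then show "?t i = 0" using around_dyadic[of L z] by blast
  next
    fix i assume "i \<in> dyadic_intervals \<times> dyadic_intervals - range (around L z)"
    then show "?t i = 0" by (simp only: coeff_not_around[OF f] mult_zero_left)
  qed (rule refl)
  also have "\<dots> \<longleftrightarrow> ((?t \<circ> around L z) has_sum S) UNIV"
    by (rule has_sum_reindex[OF inj_around])
  also have "?t \<circ> around L z = (\<lambda>x. haar_paraproduct g f (fst x) (snd x) (cell L z) * \<theta> (around L z x))"
    unfolding o_def by (simp only: coeff_around[OF f])
  finally show ?thesis .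
qed

definition mass :: "(int \<times> int \<Rightarrow> real) \<Rightarrow> real" where
  "mass h = (\<Sum>w | h w \<noteq> 0. \<bar>h w\<bar>)"

lemma mass_nonneg [simp]: "0 \<le> mass h" unfolding mass_def by (intro sum_nonneg) auto

lemma abs_EE_le_mass:
  assumes h: "finite {w. h w \<noteq> 0}"
  shows "\<bar>EE a b h w\<bar> \<le> mass h / 2 ^ (a + b)"
proof -
  have "\<bar>\<Sum>w\<in>rect a b w. h w\<bar> \<le> (\<Sum>w\<in>rect a b w. \<bar>h w\<bar>)" by (rule sum_abs)
  also have "\<dots> = (\<Sum>w\<in>rect a b w \<inter> {w. h w \<noteq> 0}. \<bar>h w\<bar>)" by (intro sum.mono_neutral_right) auto
  also have "\<dots> \<le> mass h" unfolding mass_def using h by (intro sum_mono2) auto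
  finally show ?thesis unfolding EE_eq_sum_rect by (simp add: divide_right_mono)
qed

lemma abs_EE_le_mass': "finite {w. h w \<noteq> 0} \<Longrightarrow> \<bar>EE a b h w\<bar> \<le> mass h"
proof -
  assume "finite {w. h w \<noteq> 0}"
  then have "\<bar>EE a b h w\<bar> \<le> mass h / 2 ^ (a + b)" by (rule abs_EE_le_mass)
  also have "\<dots> \<le> mass h / 1" by (intro divide_left_mono) auto
  finally show ?thesis by simp
qed

text \<open>The average of a sampled function over a large rectangle is at most its total mass divided by the size of
  the rectangle, so the series decays geometrically in both levels.\<close>

lemma summable_haar_paraproduct:
  assumes f: "finite {w. f w \<noteq> 0}" and g: "finite {w. g w \<noteq> 0}"
  shows "(\<lambda>x. haar_paraproduct g f (fst x) (snd x) w) summable_on UNIV"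
proof -
  define C where "C = mass g * (4 * mass f)"
  have C0: "0 \<le> C" by (simp add: C_def)
  have le: "\<bar>haar_paraproduct g f a b w\<bar> \<le> C * ((1 / 2) ^ a * (1 / 2) ^ b)" for a b
  proof -
    have p: "mass f / 2 ^ (a' + b') \<le> mass f / 2 ^ (a + b)" if "a \<le> a'" "b \<le> b'" for a' b' :: nat
      using that by (intro divide_left_mono power_increasing) auto
    have E: "\<bar>EE a' b' f w\<bar> \<le> mass f / 2 ^ (a + b)" if "a \<le> a'" "b \<le> b'" for a' b'
      using abs_EE_le_mass[OF f, of a' b' w] p[OF that] by linarith
    have "\<bar>DD a b f w\<bar> \<le> 4 * (mass f / 2 ^ (a + b))"
      unfolding DD_eq_EE using E[of a b] E[of "Suc a" b] E[of a "Suc b"] E[of "Suc a" "Suc b"] by linarith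
    then have "\<bar>EE (Suc a) (Suc b) g w\<bar> * \<bar>DD a b f w\<bar> \<le> mass g * (4 * (mass f / 2 ^ (a + b)))"
      by (intro mult_mono abs_EE_le_mass' g) auto
    then show ?thesis unfolding paraproduct_def C_def abs_mult by (simp add: power_add power_one_over field_simps)
  qed
  have "(\<lambda>x. norm (haar_paraproduct g f (fst x) (snd x) w)) summable_on UNIV"
  proof (rule nonneg_bdd_above_summable_on)
    have "(\<Sum>x\<in>A. norm (haar_paraproduct g f (fst x) (snd x) w)) \<le> C * 4" if A: "finite A" for A
    proof -
      obtain M where M: "fst ` A \<subseteq> {..<M}" "snd ` A \<subseteq> {..<M}"
        using A finite_nat_iff_bounded[of "fst ` A \<union> snd ` A"] by auto
      have half: "(\<Sum>a<M. (1 / 2 :: real) ^ a) \<le> 2"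
        using geometric_sum[of "1 / 2 :: real" M] by simp
      have "(\<Sum>x\<in>A. norm (haar_paraproduct g f (fst x) (snd x) w)) \<le> (\<Sum>x\<in>A. C * ((1 / 2) ^ fst x * (1 / 2) ^ snd x))"
        unfolding real_norm_def by (intro sum_mono le)
      also have "\<dots> \<le> (\<Sum>x\<in>{..<M} \<times> {..<M}. C * ((1 / 2) ^ fst x * (1 / 2) ^ snd x))"
        using M C0 by (intro sum_mono2) force+
      also have "\<dots> = C * ((\<Sum>a<M. (1 / 2) ^ a) * (\<Sum>b<M. (1 / 2) ^ b))"
        by (simp only: sum.cartesian_product' fst_conv snd_conv sum_distrib_left[symmetric] sum_product)
      also have "\<dots> \<le> C * (2 * 2)"
        using half C0 by (intro mult_left_mono mult_mono) (auto intro: sum_nonneg)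
      finally show ?thesis by simp
    qed
    then show "bdd_above (sum (\<lambda>x. norm (haar_paraproduct g f (fst x) (snd x) w)) ` {F. F \<subseteq> UNIV \<and> finite F})"
      by (intro bdd_aboveI[of _ "C * 4"]) auto
  qed auto
  then show ?thesis by (rule abs_summable_summable)
qed

lemma coeff_square_summable:
  assumes f: "finite {w. f w \<noteq> 0}" and g: "finite {w. g w \<noteq> 0}"
  shows "(\<lambda>i. (pi2_coeff L g f i)\<^sup>2) summable_on dyadic_intervals \<times> dyadic_intervals"
proof (rule nonneg_bdd_above_summable_on)
  let ?D = "dyadic_intervals \<times> dyadic_intervals"
  define Q where "Q = (LINT z|lborel. (lift L f z)\<^sup>2)"
  have f2: "integrable lborel (\<lambda>z. (lift L f z)\<^sup>2)"
    unfolding power2_eq_square by (rule integrable_lift_mult[OF f])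
  have "(\<Sum>i\<in>A. (pi2_coeff L g f i)\<^sup>2) \<le> (mass g)\<^sup>2 * Q" if A: "finite A" "A \<subseteq> ?D" for A
  proof -
    have fe: "integrable lborel (\<lambda>z. lift L f z * haar2 (fst i) (snd i) z)" if "i \<in> A" for i
    proof (rule Bochner_Integration.integrable_bound[of _ "\<lambda>z. (lift L f z)\<^sup>2 + haar2 (fst i) (snd i) z * haar2 (fst i) (snd i) z"])
      have i: "i \<in> ?D" using that A by blast
      show "integrable lborel (\<lambda>z. (lift L f z)\<^sup>2 + haar2 (fst i) (snd i) z * haar2 (fst i) (snd i) z)"
        using f2 haar.e_int[OF i i] by (rule Bochner_Integration.integrable_add)
      show "(\<lambda>z. lift L f z * haar2 (fst i) (snd i) z) \<in> borel_measurable lborel"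
        using borel_measurable_integrable[OF integrable_lift[OF f]] haar2_borel[OF i] by (rule borel_measurable_times)
      have "\<bar>x * y\<bar> \<le> x\<^sup>2 + y * y" for x y :: real
      proof -
        have "(\<bar>x\<bar> - \<bar>y\<bar>)\<^sup>2 = x\<^sup>2 - 2 * \<bar>x * y\<bar> + y * y"
          by (simp add: power2_diff abs_mult power2_eq_square[of y])
        then show ?thesis using zero_le_power2[of "\<bar>x\<bar> - \<bar>y\<bar>"] abs_ge_zero[of "x * y"] by linarith
      qed
      then show "AE z in lborel. norm (lift L f z * haar2 (fst i) (snd i) z) \<le>
        norm ((lift L f z)\<^sup>2 + haar2 (fst i) (snd i) z * haar2 (fst i) (snd i) z)"
        by (intro AE_I2) (metis abs_ge_self order_trans real_norm_def)
    qed
    have avg: "(average (lift L g) (fst i \<times> snd i))\<^sup>2 \<le> (mass g)\<^sup>2" if "i \<in> A" for i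
    proof -
      have "i \<in> ?D" using A that by blast
      then obtain n k m l where i: "i = (dyadic_interval n k, dyadic_interval m l)"
        unfolding dyadic_intervals_def by blast
      define z :: "real \<times> real" where "z = (of_int k * 2 powi n, of_int l * 2 powi m)"
      have z: "z \<in> dyadic_interval n k \<times> dyadic_interval m l" by (simp add: z_def mem_dyadic_interval_iff)
      have "\<bar>average (lift L g) (fst i \<times> snd i)\<bar> \<le> mass g"
        unfolding i using average_lift[OF z, of L g] abs_EE_le_mass'[OF g] by simp
      then show ?thesis by (metis abs_ge_zero power2_abs power_mono)
    qed
    have "(\<Sum>i\<in>A. (pi2_coeff L g f i)\<^sup>2) \<le> (\<Sum>i\<in>A. (haar_coeff (lift L f) (fst i) (snd i))\<^sup>2 * (mass g)\<^sup>2)"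
      unfolding pi2_coeff_def power_mult_distrib using avg by (intro sum_mono mult_left_mono) auto
    also have "\<dots> = (mass g)\<^sup>2 * (\<Sum>i\<in>A. (haar_coeff (lift L f) (fst i) (snd i))\<^sup>2)"
      by (simp add: sum_distrib_left mult.commute)
    also have "\<dots> \<le> (mass g)\<^sup>2 * Q"
      unfolding Q_def haar_coeff_def by (intro mult_left_mono haar.bessel[OF A f2 fe]) auto
    finally show ?thesis .
  qed
  then show "bdd_above (sum (\<lambda>i. (pi2_coeff L g f i)\<^sup>2) ` {F. F \<subseteq> ?D \<and> finite F})"
    by (intro bdd_aboveI[of _ "(mass g)\<^sup>2 * Q"]) auto
qed auto

lemma is_pi2_lift:
  "is_pi2 (lift L g) (lift L f) F \<longleftrightarrow> F \<in> borel_measurable lborel \<and> integrable lborel (\<lambda>z. (F z)\<^sup>2) \<and>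
    ((\<lambda>A. LINT z|lborel. (F z - (\<Sum>i\<in>A. pi2_coeff L g f i * haar2 (fst i) (snd i) z))\<^sup>2) \<longlongrightarrow> 0)
      (finite_subsets_at_top (dyadic_intervals \<times> dyadic_intervals))"
  unfolding is_pi2_def pi2_coeff_def by (simp add: case_prod_beta)

lemma is_pi2_pi2:
  assumes f: "finite {w. f w \<noteq> 0}" and g: "finite {w. g w \<noteq> 0}"
  shows "is_pi2 (lift L g) (lift L f) (pi2 (lift L g) (lift L f))"
proof -
  have pt: "(\<lambda>i. pi2_coeff L g f i * haar2 (fst i) (snd i) z) summable_on dyadic_intervals \<times> dyadic_intervals" for z
  proof -
    obtain S where "((\<lambda>x. haar_paraproduct g f (fst x) (snd x) (cell L z)) has_sum S) UNIV"
      using summable_haar_paraproduct[OF f g] unfolding summable_on_def by blast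
    then have "((\<lambda>i. pi2_coeff L g f i * haar2 (fst i) (snd i) z) has_sum S) (dyadic_intervals \<times> dyadic_intervals)"
      using has_sum_around[OF f, of L g z "\<lambda>_. 1" S] by simp
    then show ?thesis unfolding summable_on_def by blast
  qed
  have "countable (dyadic_intervals \<times> dyadic_intervals)" by (intro countable_SIGMA countable_dyadic_intervals)
  from haar.riesz_fischer_pointwise[OF this coeff_square_summable[OF f g] pt]
  have "\<exists>F. is_pi2 (lift L g) (lift L f) F" unfolding is_pi2_lift by blast
  then show ?thesis unfolding pi2_def by (rule someI_ex)
qed

text \<open>Averages are continuous for convergence in \<open>L\<^sup>2\<close>. The square of \<open>F\<close> minus its average on \<open>R\<close> has a
  nonnegative integral.\<close>

lemma average_diff_square_le:
  assumes F: "F \<in> borel_measurable lborel" "integrable lborel (\<lambda>z. (F z)\<^sup>2)"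
    and R: "R \<in> sets lborel" "emeasure lborel R < \<infinity>" "0 < measure lborel R"
  shows "integrable lborel (\<lambda>z. indicator R z * F z)" "(average F R)\<^sup>2 \<le> (LINT z|lborel. (F z)\<^sup>2) / measure lborel R"
proof -
  let ?i = "indicator R :: real \<times> real \<Rightarrow> real"
  have i: "integrable lborel ?i" using R by simp
  show int: "integrable lborel (\<lambda>z. ?i z * F z)"
  proof (rule Bochner_Integration.integrable_bound[of _ "\<lambda>z. ?i z + (F z)\<^sup>2"])
    show "integrable lborel (\<lambda>z. ?i z + (F z)\<^sup>2)" using i F(2) by (rule Bochner_Integration.integrable_add)
    show "(\<lambda>z. ?i z * F z) \<in> borel_measurable lborel" using F(1) R(1) by measurable
    have "\<bar>x\<bar> \<le> 1 + x\<^sup>2" for x :: real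
      using zero_le_power2[of "\<bar>x\<bar> - 1"] by (simp add: power2_diff)
    then show "AE z in lborel. norm (?i z * F z) \<le> norm (?i z + (F z)\<^sup>2)"
      by (intro AE_I2) (auto simp: indicator_def)
  qed
  define t where "t = average F R"
  have A: "(LINT z|lborel. ?i z * F z) = t * measure lborel R"
    using R(3) unfolding t_def average_def set_lebesgue_integral_def by simp
  have "0 \<le> (LINT z|lborel. (t * ?i z - F z)\<^sup>2)" by simp
  also have "(\<lambda>z. (t * ?i z - F z)\<^sup>2) = (\<lambda>z. t\<^sup>2 * ?i z - 2 * t * (?i z * F z) + (F z)\<^sup>2)"
    by (auto simp: fun_eq_iff power2_diff indicator_def)
  also have "(LINT z|lborel. t\<^sup>2 * ?i z - 2 * t * (?i z * F z) + (F z)\<^sup>2) =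
    t\<^sup>2 * measure lborel R - 2 * t * (LINT z|lborel. ?i z * F z) + (LINT z|lborel. (F z)\<^sup>2)"
    using i int F(2) R by simp
  finally have "t\<^sup>2 * measure lborel R \<le> (LINT z|lborel. (F z)\<^sup>2)" unfolding A by (simp add: power2_eq_square algebra_simps)
  then show "(average F R)\<^sup>2 \<le> (LINT z|lborel. (F z)\<^sup>2) / measure lborel R"
    using R(3) by (simp add: t_def pos_le_divide_eq)
qed

lemma average_pi2_has_sum:
  assumes F: "is_pi2 (lift L g) (lift L f) F" and z: "z \<in> dyadic_interval n k \<times> dyadic_interval m l"
  shows "((\<lambda>i. pi2_coeff L g f i * average (haar2 (fst i) (snd i)) (dyadic_interval n k \<times> dyadic_interval m l)) has_sum
    average F (dyadic_interval n k \<times> dyadic_interval m l)) (dyadic_intervals \<times> dyadic_intervals)"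
proof -
  let ?R = "dyadic_interval n k \<times> dyadic_interval m l" and ?D = "dyadic_intervals \<times> dyadic_intervals"
  have R: "?R \<in> sets lborel" "emeasure lborel ?R < \<infinity>" "0 < measure lborel ?R"
    by (simp_all add: borel_prod[symmetric] emeasure_lborel_Times emeasure_dyadic_interval ennreal_mult[symmetric]
        measure_lborel_Times measure_dyadic_interval)
  define P where "P A z = (\<Sum>i\<in>A. pi2_coeff L g f i * haar2 (fst i) (snd i) z)" for A z
  have F1: "F \<in> borel_measurable lborel" "integrable lborel (\<lambda>z. (F z)\<^sup>2)"
    and F2: "((\<lambda>A. LINT z|lborel. (F z - P A z)\<^sup>2) \<longlongrightarrow> 0) (finite_subsets_at_top ?D)"
    using F unfolding is_pi2_lift P_def by auto
  have key: "\<bar>(\<Sum>i\<in>A. pi2_coeff L g f i * average (haar2 (fst i) (snd i)) ?R) - average F ?R\<bar> \<le>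
     sqrt ((LINT z|lborel. (F z - P A z)\<^sup>2) / measure lborel ?R)" if A: "finite A" "A \<subseteq> ?D" for A
  proof -
    have e_int: "integrable lborel (\<lambda>z. indicator ?R z * haar2 (fst i) (snd i) z)" if "i \<in> A" for i
    proof -
      have i: "i \<in> ?D" using that A by blast
      show ?thesis using average_diff_square_le(1)[OF haar2_borel[OF i] _ R] haar.e_int[OF i i] by (simp add: power2_eq_square)
    qed
    have Pm1: "P A \<in> borel_measurable lborel"
      unfolding P_def[abs_def]
      by (intro borel_measurable_sum borel_measurable_times borel_measurable_const haar2_borel) (use A(2) in blast)
    have Pm2: "integrable lborel (\<lambda>z. (P A z)\<^sup>2)"
      unfolding P_def using haar.finite_expansion(1)[OF A] .
    note Pm = Pm1 Pm2
    have D: "(\<lambda>z. F z - P A z) \<in> borel_measurable lborel" using F1(1) Pm(1) by measurable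
    have D2: "integrable lborel (\<lambda>z. (F z - P A z)\<^sup>2)"
    proof (rule Bochner_Integration.integrable_bound[of _ "\<lambda>z. 2 * (F z)\<^sup>2 + 2 * (P A z)\<^sup>2"])
      show "integrable lborel (\<lambda>z. 2 * (F z)\<^sup>2 + 2 * (P A z)\<^sup>2)" using F1(2) Pm(2) by simp
      show "(\<lambda>z. (F z - P A z)\<^sup>2) \<in> borel_measurable lborel" using D by measurable
      have "(x - y)\<^sup>2 \<le> 2 * x\<^sup>2 + 2 * y\<^sup>2" for x y :: real
        using zero_le_power2[of "x + y"] by (simp add: power2_sum power2_diff)
      then show "AE z in lborel. norm ((F z - P A z)\<^sup>2) \<le> norm (2 * (F z)\<^sup>2 + 2 * (P A z)\<^sup>2)"
        by (intro AE_I2) simp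
    qed
    have P_avg: "average (P A) ?R = (\<Sum>i\<in>A. pi2_coeff L g f i * average (haar2 (fst i) (snd i)) ?R)"
    proof -
      have "(LINT z|lborel. indicator ?R z * P A z) = (LINT z|lborel. (\<Sum>i\<in>A. pi2_coeff L g f i * (indicator ?R z * haar2 (fst i) (snd i) z)))"
        unfolding P_def sum_distrib_left by (simp only: mult_ac)
      also have "\<dots> = (\<Sum>i\<in>A. pi2_coeff L g f i * (LINT z|lborel. indicator ?R z * haar2 (fst i) (snd i) z))"
        using e_int by (subst Bochner_Integration.integral_sum) auto
      finally show ?thesis
        unfolding average_def set_lebesgue_integral_def by (simp add: sum_divide_distrib)
    qed
    have "average (\<lambda>z. F z - P A z) ?R = average F ?R - average (P A) ?R"
      using average_diff_square_le(1)[OF F1 R] average_diff_square_le(1)[OF Pm R]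
      unfolding average_def set_lebesgue_integral_def by (simp add: right_diff_distrib diff_divide_distrib)
    moreover have "(average (\<lambda>z. F z - P A z) ?R)\<^sup>2 \<le> (LINT z|lborel. (F z - P A z)\<^sup>2) / measure lborel ?R"
      by (rule average_diff_square_le(2)[OF D D2 R])
    ultimately have "\<bar>average F ?R - average (P A) ?R\<bar> \<le> sqrt ((LINT z|lborel. (F z - P A z)\<^sup>2) / measure lborel ?R)"
      by (intro real_le_rsqrt) (simp only: power2_abs)
    then show ?thesis unfolding P_avg by (simp only: abs_minus_commute)
  qed
  have "((\<lambda>A. sqrt ((LINT z|lborel. (F z - P A z)\<^sup>2) / measure lborel ?R)) \<longlongrightarrow> sqrt (0 / measure lborel ?R)) (finite_subsets_at_top ?D)"
    using R(3) by (intro tendsto_intros F2) auto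
  then have "((\<lambda>A. sqrt ((LINT z|lborel. (F z - P A z)\<^sup>2) / measure lborel ?R)) \<longlongrightarrow> 0) (finite_subsets_at_top ?D)" by simp
  then have "((\<lambda>A. (\<Sum>i\<in>A. pi2_coeff L g f i * average (haar2 (fst i) (snd i)) ?R) - average F ?R) \<longlongrightarrow> 0) (finite_subsets_at_top ?D)"
  proof (rule Lim_null_comparison[rotated])
    show "\<forall>\<^sub>F A in finite_subsets_at_top ?D. norm ((\<Sum>i\<in>A. pi2_coeff L g f i * average (haar2 (fst i) (snd i)) ?R) - average F ?R) \<le>
      sqrt ((LINT z|lborel. (F z - P A z)\<^sup>2) / measure lborel ?R)"
      unfolding real_norm_def using key by (rule eventually_finite_subsets_at_top_weakI)
  qed
  then show ?thesis unfolding has_sum_def by (rule LIM_zero_cancel)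
qed

lemma powi_2_less_iff: "(2::real) powi n < 2 powi m \<longleftrightarrow> n < m"
proof -
  have "(2::real) powi n = 2 powr real_of_int n" for n by (simp add: powr_real_of_int')
  then show ?thesis by simp
qed

text \<open>By continuity of averages, the average of the paraproduct over a rectangle is the sum
  of the terms that belong to the rectangles around it that are larger in both directions. Along square boxes of levels, the partial sums are the averages of the
  discrete paraproduct.\<close>

lemma average_pi2_lim:
  assumes f: "finite {w. f w \<noteq> 0}" and F: "is_pi2 (lift L g) (lift L f) F"
    and z: "z \<in> dyadic_interval n k \<times> dyadic_interval m l"
  shows "(\<lambda>N. EE (nat (n + int L)) (nat (m + int L)) (haar_sum N (haar_paraproduct g f)) (cell L z)) \<longlonglongrightarrow>
    average F (dyadic_interval n k \<times> dyadic_interval m l)"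
proof -
  define a where "a = nat (n + int L)"
  define b where "b = nat (m + int L)"
  let ?R = "dyadic_interval n k \<times> dyadic_interval m l" and ?D = "dyadic_intervals \<times> dyadic_intervals"
  define w where "w = cell L z"
  define \<theta> where "\<theta> i = (of_bool (2 powi n < measure lborel (fst i) \<and> 2 powi m < measure lborel (snd i)) :: real)" for i :: "real set \<times> real set"
  have eq: "pi2_coeff L g f i * average (haar2 (fst i) (snd i)) ?R = pi2_coeff L g f i * haar2 (fst i) (snd i) z * \<theta> i" if i: "i \<in> ?D" for i
  proof -
    from i obtain n' k' m' l' where i: "i = (dyadic_interval n' k', dyadic_interval m' l')" unfolding dyadic_intervals_def by blast
    show ?thesis unfolding i fst_conv snd_conv average_haar2[OF z] \<theta>_def measure_dyadic_interval
      by (simp add: powi_2_less_iff)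
  qed
  have "((\<lambda>i. pi2_coeff L g f i * haar2 (fst i) (snd i) z * \<theta> i) has_sum average F ?R) ?D"
    by (rule iffD1[OF has_sum_cong[OF eq] average_pi2_has_sum[OF F z]])
  then have "((\<lambda>x. haar_paraproduct g f (fst x) (snd x) w * \<theta> (around L z x)) has_sum average F ?R) UNIV"
    unfolding has_sum_around[OF f] w_def .
  moreover have "\<theta> (around L z x) = of_bool (a \<le> fst x \<and> b \<le> snd x)" for x
  proof -
    have "n < int (fst x) + 1 - int L \<longleftrightarrow> a \<le> fst x" "m < int (snd x) + 1 - int L \<longleftrightarrow> b \<le> snd x" unfolding a_def b_def by auto
    then show ?thesis unfolding \<theta>_def around_def fst_conv snd_conv measure_dyadic_interval by (simp add: powi_2_less_iff)
  qed
  ultimately have hs: "((\<lambda>x. haar_paraproduct g f (fst x) (snd x) w * of_bool (a \<le> fst x \<and> b \<le> snd x)) has_sum average F ?R) UNIV" by simp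
  have box: "filterlim (\<lambda>N. {..<N} \<times> {..<N}) (finite_subsets_at_top UNIV) sequentially"
    unfolding filterlim_finite_subsets_at_top
  proof (intro allI impI)
    fix X :: "(nat \<times> nat) set" assume "finite X \<and> X \<subseteq> UNIV"
    then obtain M where M: "fst ` X \<subseteq> {..<M}" "snd ` X \<subseteq> {..<M}"
      using finite_nat_iff_bounded[of "fst ` X \<union> snd ` X"] by auto
    show "\<forall>\<^sub>F N in sequentially. finite ({..<N} \<times> {..<N}) \<and> X \<subseteq> {..<N} \<times> {..<N} \<and> {..<N} \<times> {..<N} \<subseteq> UNIV"
      using eventually_ge_at_top[of M]
    proof eventually_elim
      case (elim N)
      show ?case using M elim by force
    qed
  qed
  have "(\<lambda>N. \<Sum>x\<in>{..<N} \<times> {..<N}. haar_paraproduct g f (fst x) (snd x) w * of_bool (a \<le> fst x \<and> b \<le> snd x)) \<longlonglongrightarrow> average F ?R"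
    using filterlim_compose[OF hs[unfolded has_sum_def] box] .
  moreover have "(\<Sum>x\<in>{..<N} \<times> {..<N}. haar_paraproduct g f (fst x) (snd x) w * of_bool (a \<le> fst x \<and> b \<le> snd x)) = EE a b (haar_sum N (haar_paraproduct g f)) w" for N
    unfolding EE_haar_sum[OF haar_family_paraproduct[OF haar_family_DD]] sum.cartesian_product' fst_conv snd_conv
    by (intro sum.cong refl) auto
  ultimately show ?thesis unfolding a_def b_def w_def by simp
qed

lemma pi2_averages:
  assumes f: "finite {w. f w \<noteq> 0}" and g: "finite {w. g w \<noteq> 0}"
  obtains e where "has_averages L (pi2 (lift L g) (lift L f)) e"
    and "\<And>a b w. (\<lambda>N. EE a b (haar_sum N (haar_paraproduct g f)) w) \<longlonglongrightarrow> e a b w"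
proof
  let ?F = "pi2 (lift L g) (lift L f)"
  define e where "e a b w = lim (\<lambda>N. EE a b (haar_sum N (haar_paraproduct g f)) w)" for a b w
  show "has_averages L ?F e"
    unfolding has_averages_def e_def
    by (intro allI impI limI[symmetric] average_pi2_lim[OF f is_pi2_pi2[OF f g]])
  fix a b w
  define z where "z = (real_of_int (fst w) / 2 ^ L, real_of_int (snd w) / 2 ^ L)"
  have w: "cell L z = w" using cell_corner[of L "fst w" "snd w"] by (simp add: z_def)
  have z: "z \<in> dyadic_interval (int a - int L) (sample L (fst z) div 2 ^ a) \<times> dyadic_interval (int b - int L) (sample L (snd z) div 2 ^ b)"
    unfolding mem_Times_iff mem_dyadic_interval_sample by simp
  have "convergent (\<lambda>N. EE a b (haar_sum N (haar_paraproduct g f)) w)"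
    using convergentI[OF average_pi2_lim[OF f is_pi2_pi2[OF f g, of L] z]] unfolding w by simp
  then show "(\<lambda>N. EE a b (haar_sum N (haar_paraproduct g f)) w) \<longlonglongrightarrow> e a b w" unfolding e_def convergent_LIMSEQ_iff .
qed

section \<open>Operator norms\<close>

lemma hardy_opnorm_le:
  assumes "\<And>f. dyadic_simple f \<Longrightarrow> hardy_norm q (T f) \<le> K * hardy_norm p f"
  shows "hardy_opnorm p q T \<le> K"
  unfolding hardy_opnorm_def
proof (rule SUP_least)
  fix f assume "f \<in> {f. dyadic_simple f \<and> 0 < hardy_norm p f \<and> hardy_norm p f < \<infinity>}"
  then have f: "dyadic_simple f" "hardy_norm p f \<noteq> 0" "hardy_norm p f \<noteq> top" by auto
  have "hardy_norm q (T f) / hardy_norm p f \<le> (K * hardy_norm p f) / hardy_norm p f"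
    using assms[OF f(1)] by (rule divide_right_mono_ennreal)
  also have "\<dots> = K" using f(2,3) by (rule mult_divide_eq_ennreal)
  finally show "hardy_norm q (T f) / hardy_norm p f \<le> K" .
qed

lemma le_hardy_opnorm:
  assumes "dyadic_simple f" "0 < hardy_norm p f" "hardy_norm p f < \<infinity>"
  shows "hardy_norm q (T f) \<le> hardy_opnorm p q T * hardy_norm p f"
proof -
  have f: "hardy_norm p f \<noteq> 0" "hardy_norm p f \<noteq> top" using assms by auto
  have "hardy_norm q (T f) / hardy_norm p f \<le> hardy_opnorm p q T"
    unfolding hardy_opnorm_def using assms by (intro SUP_upper) simp
  then have "hardy_norm p f * (hardy_norm q (T f) / hardy_norm p f) \<le> hardy_norm p f * hardy_opnorm p q T"
    by (rule mult_left_mono) simp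
  also have "hardy_norm p f * (hardy_norm q (T f) / hardy_norm p f) = hardy_norm q (T f)"
    using mult_divide_eq_ennreal[OF f, of "hardy_norm q (T f)"] by (simp add: ennreal_times_divide mult.commute)
  finally show ?thesis by (simp add: mult.commute)
qed

lemma epowr_mult:
  assumes a: "0 < a"
  shows "epowr (x * y) a = epowr x a * epowr y a"
proof (cases "x = top \<or> y = top")
  case True
  then show ?thesis using a by (cases "x = 0 \<or> y = 0") (auto simp: epowr_def ennreal_mult_eq_top_iff enn2real_eq_0_iff)
next
  case False
  then obtain s t where "x = ennreal s" "0 \<le> s" "y = ennreal t" "0 \<le> t" by (cases x; cases y) auto
  then show ?thesis by (simp add: ennreal_mult[symmetric] epowr_ennreal powr_mult)
qed

lemma grid_sum_EE: "grid_sum p N (\<lambda>n m. EE n m u) = (\<Sum>z\<in>grid N. MM N u z powr p)"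
  by (simp add: grid_sum_def MM_def)

lemma grid_sum_mono:
  assumes "0 < p" "N \<le> M"
  shows "grid_sum p N e \<le> grid_sum p M e"
proof -
  have "grid_sum p N e \<le> (\<Sum>w\<in>grid N. fmax M e w powr p)"
    unfolding grid_sum_def using assms by (intro sum_mono powr_mono2 fmax_mono fmax_nonneg) auto
  also have "\<dots> \<le> grid_sum p M e"
    unfolding grid_sum_def using grid_mono[OF assms(2)] by (intro sum_mono2) auto
  finally show ?thesis .
qed

text \<open>The averages of \<open>pi2 g f\<close> are limits. On a fixed finite grid only finitely many of them enter,
  so a bound passes to the limit.\<close>

lemma SUP_grid_sum_lim_le:
  assumes p: "0 < p" and lim: "\<And>a b w. (\<lambda>N. E N a b w) \<longlonglongrightarrow> e a b w"
    and B: "\<And>N. ennreal (grid_sum p N (E N)) \<le> B"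
  shows "(SUP N. ennreal (grid_sum p N e)) \<le> B"
proof (rule SUP_least)
  fix K :: nat
  have "\<forall>w. \<exists>x. fst x \<le> K \<and> snd x \<le> K \<and> fmax K e w = \<bar>e (fst x) (snd x) w\<bar>"
    using fmax_attained[of K e] by (metis fst_conv snd_conv)
  then obtain c where c: "\<forall>w. fst (c w) \<le> K \<and> snd (c w) \<le> K \<and> fmax K e w = \<bar>e (fst (c w)) (snd (c w)) w\<bar>"
    by (rule choice[THEN exE])
  define x where "x N = (\<Sum>w\<in>grid K. \<bar>E N (fst (c w)) (snd (c w)) w\<bar> powr p)" for N
  have "x \<longlonglongrightarrow> (\<Sum>w\<in>grid K. \<bar>e (fst (c w)) (snd (c w)) w\<bar> powr p)"
    unfolding x_def using p by (intro tendsto_sum tendsto_powr2 tendsto_rabs lim tendsto_const) auto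
  also have "(\<Sum>w\<in>grid K. \<bar>e (fst (c w)) (snd (c w)) w\<bar> powr p) = grid_sum p K e"
    unfolding grid_sum_def
  proof (intro sum.cong refl)
    fix w
    show "\<bar>e (fst (c w)) (snd (c w)) w\<bar> powr p = fmax K e w powr p" using spec[OF c, of w] by simp
  qed
  finally have "x \<longlonglongrightarrow> grid_sum p K e" .
  then have "(\<lambda>N. ennreal (x N)) \<longlonglongrightarrow> ennreal (grid_sum p K e)" by (rule tendsto_ennrealI)
  moreover have "ennreal (x N) \<le> B" if N: "K \<le> N" for N
  proof -
    have "x N \<le> (\<Sum>w\<in>grid K. fmax N (E N) w powr p)"
      unfolding x_def using p c N by (intro sum_mono powr_mono2 fmax_ge) (auto intro: order_trans)
    also have "\<dots> \<le> grid_sum p N (E N)"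
      unfolding grid_sum_def using grid_mono[OF N] by (intro sum_mono2) auto
    finally show ?thesis using B[of N] by (meson ennreal_leI order_trans)
  qed
  ultimately show "ennreal (grid_sum p K e) \<le> B" by (intro LIMSEQ_le_const2) auto
qed

lemma common_lift:
  assumes "dyadic_simple f" "dyadic_simple g"
  obtains L f0 g0 where "finite {w. f0 w \<noteq> 0}" "f = lift L f0" "finite {w. g0 w \<noteq> 0}" "g = lift L g0"
proof -
  obtain L1 where L1: "\<And>L. L1 \<le> L \<Longrightarrow> \<exists>h. finite {w. h w \<noteq> 0} \<and> f = lift L h \<and> EE 1 1 h = h"
    using dyadic_simple_imp_lift[OF assms(1)] by metis
  obtain L2 where L2: "\<And>L. L2 \<le> L \<Longrightarrow> \<exists>h. finite {w. h w \<noteq> 0} \<and> g = lift L h \<and> EE 1 1 h = h"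
    using dyadic_simple_imp_lift[OF assms(2)] by metis
  show thesis using L1[of "max L1 L2"] L2[of "max L1 L2"] that by auto
qed

text \<open>The volume of a lattice cell enters with the exponent \<open>1 / q\<close> on the left and with \<open>1 / r\<close> and \<open>1 / p\<close>
  on the right, so the constant does not depend on the mesh.\<close>

theorem pi2_upper:
  assumes p: "0 < p" "0 < q" "0 < r" "1 / q = 1 / p + 1 / r"
  shows "\<exists>C>0. \<forall>g f. dyadic_simple g \<longrightarrow> dyadic_simple f \<longrightarrow>
    hardy_norm q (pi2 g f) \<le> ennreal C * hardy_norm r g * hardy_norm p f"
proof -
  obtain C0 where C0: "0 < C0" and le: "\<And>N f g. (\<Sum>z\<in>grid N. MM N (haar_sum N (haar_paraproduct g f)) z powr q) \<le>
    C0 * (\<Sum>z\<in>grid N. MM N g z powr r) powr (q / r) * (\<Sum>z\<in>grid N. MM N f z powr p) powr (q / p)"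
    using paraproduct_upper[OF p] by blast
  have "hardy_norm q (pi2 g f) \<le> ennreal (C0 powr (1 / q)) * hardy_norm r g * hardy_norm p f"
    if simple: "dyadic_simple g" "dyadic_simple f" for g f
  proof -
    obtain L f0 g0 where f0: "finite {w. f0 w \<noteq> 0}" "f = lift L f0" and g0: "finite {w. g0 w \<noteq> 0}" "g = lift L g0"
      using common_lift[OF simple(2,1)] .
    obtain e where e: "has_averages L (pi2 g f) e" "\<And>a b w. (\<lambda>N. EE a b (haar_sum N (haar_paraproduct g0 f0)) w) \<longlonglongrightarrow> e a b w"
      using pi2_averages[OF f0(1) g0(1), of L] unfolding f0(2) g0(2) by blast
    define c where "c = ennreal (1 / 4 ^ L)"
    define G where "G = (SUP N. ennreal (grid_sum r N (\<lambda>n m. EE n m g0)))"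
    define F where "F = (SUP N. ennreal (grid_sum p N (\<lambda>n m. EE n m f0)))"
    define S where "S = (SUP N. ennreal (grid_sum q N e))"
    have "S \<le> ennreal C0 * epowr G (q / r) * epowr F (q / p)"
      unfolding S_def
    proof (rule SUP_grid_sum_lim_le[OF p(2) e(2)])
      fix N
      let ?g = "grid_sum r N (\<lambda>n m. EE n m g0)" and ?f = "grid_sum p N (\<lambda>n m. EE n m f0)"
      have "ennreal (grid_sum q N (\<lambda>a b. EE a b (haar_sum N (haar_paraproduct g0 f0)))) \<le> ennreal (C0 * ?g powr (q / r) * ?f powr (q / p))"
        unfolding grid_sum_EE by (rule ennreal_leI[OF le])
      also have "\<dots> = ennreal C0 * epowr (ennreal ?g) (q / r) * epowr (ennreal ?f) (q / p)"
        using C0 by (simp add: epowr_ennreal ennreal_mult)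
      also have "\<dots> \<le> ennreal C0 * epowr G (q / r) * epowr F (q / p)"
        unfolding G_def F_def using p(1-3) by (intro mult_mono epowr_mono SUP_upper) auto
      finally show "ennreal (grid_sum q N (\<lambda>a b. EE a b (haar_sum N (haar_paraproduct g0 f0)))) \<le> ennreal C0 * epowr G (q / r) * epowr F (q / p)" .
    qed
    then have "epowr (c * S) (1 / q) \<le> epowr (c * (ennreal C0 * epowr G (q / r) * epowr F (q / p))) (1 / q)"
      using p(2) by (intro epowr_mono mult_left_mono) auto
    also have "\<dots> = epowr c (1 / q) * (epowr (ennreal C0) (1 / q) * epowr G (1 / r) * epowr F (1 / p))"
      using p(1-3) by (simp add: epowr_mult epowr_epowr)
    also have "epowr c (1 / q) = epowr c (1 / r) * epowr c (1 / p)"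
      unfolding c_def p(4) by (simp add: epowr_ennreal ennreal_mult[symmetric] powr_add mult.commute del: powr_one_eq_one)
    also have "epowr (ennreal C0) (1 / q) = ennreal (C0 powr (1 / q))" using C0 by (simp add: epowr_ennreal)
    also have "epowr c (1 / r) * epowr c (1 / p) * (ennreal (C0 powr (1 / q)) * epowr G (1 / r) * epowr F (1 / p)) =
      ennreal (C0 powr (1 / q)) * epowr (c * G) (1 / r) * epowr (c * F) (1 / p)"
      using p(1-3) by (simp add: epowr_mult mult_ac)
    finally show ?thesis
      using hardy_norm_eq_SUP[OF p(2) e(1)] hardy_norm_eq_SUP[OF p(3) has_averages_lift, of L g0]
        hardy_norm_eq_SUP[OF p(1) has_averages_lift, of L f0]
      unfolding S_def G_def F_def c_def f0(2) g0(2) by simp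
  qed
  then show ?thesis using C0 by (intro exI[of _ "C0 powr (1 / q)"]) auto
qed

lemma linfty_norm_lift_ge: "ennreal \<bar>h w\<bar> \<le> linfty_norm (lift L h)"
proof (rule ccontr)
  assume neg: "\<not> ennreal \<bar>h w\<bar> \<le> linfty_norm (lift L h)"
  have "AE z in lborel. ennreal \<bar>lift L h z\<bar> \<le> linfty_norm (lift L h)"
    unfolding linfty_norm_def by (rule esssup_AE)
  then obtain N where N: "{z \<in> space lborel. \<not> ennreal \<bar>lift L h z\<bar> \<le> linfty_norm (lift L h)} \<subseteq> N"
    "emeasure lborel N = 0" "N \<in> sets lborel" by (rule AE_E)
  have "{z. cell L z = w} \<subseteq> N" using N(1) neg by (auto simp: lift_def)
  then have "emeasure lborel {z. cell L z = w} \<le> 0" using emeasure_mono[OF _ N(3)] N(2) by metis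
  then show False by (simp add: emeasure_cell_fibre)
qed

lemma linfty_norm_lift_le:
  assumes "finite {w. h w \<noteq> 0}" "\<And>w. ennreal \<bar>h w\<bar> \<le> K"
  shows "linfty_norm (lift L h) \<le> K"
  unfolding linfty_norm_def
proof (rule esssup_I)
  have "lift L h \<in> borel_measurable lborel" using integrable_lift[OF assms(1)] by (rule borel_measurable_integrable)
  then show "(\<lambda>z. ennreal \<bar>lift L h z\<bar>) \<in> borel_measurable lborel" by measurable
  show "AE z in lborel. ennreal \<bar>lift L h z\<bar> \<le> K" using assms(2) by (auto simp: lift_def)
qed

theorem pi2_upper_bounded:
  assumes p: "0 < p"
  shows "\<exists>C>0. \<forall>g f. dyadic_simple g \<longrightarrow> dyadic_simple f \<longrightarrow>
    hardy_norm p (pi2 g f) \<le> ennreal C * linfty_norm g * hardy_norm p f"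
proof -
  obtain C0 where C0: "0 < C0" and le: "\<And>N f g B. 0 \<le> B \<Longrightarrow> (\<And>n m z. \<bar>EE n m g z\<bar> \<le> B) \<Longrightarrow>
    (\<Sum>z\<in>grid N. MM N (haar_sum N (haar_paraproduct g f)) z powr p) \<le> C0 * B powr p * (\<Sum>z\<in>grid N. MM N f z powr p)"
    using paraproduct_upper_bounded[OF p] by blast
  have "hardy_norm p (pi2 g f) \<le> ennreal (C0 powr (1 / p)) * linfty_norm g * hardy_norm p f"
    if simple: "dyadic_simple g" "dyadic_simple f" for g f
  proof -
    obtain L f0 g0 where f0: "finite {w. f0 w \<noteq> 0}" "f = lift L f0" and g0: "finite {w. g0 w \<noteq> 0}" "g = lift L g0"
      using common_lift[OF simple(2,1)] .
    obtain e where e: "has_averages L (pi2 g f) e" "\<And>a b w. (\<lambda>N. EE a b (haar_sum N (haar_paraproduct g0 f0)) w) \<longlonglongrightarrow> e a b w"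
      using pi2_averages[OF f0(1) g0(1), of L] unfolding f0(2) g0(2) by blast
    let ?V = "insert 0 ((\<lambda>w. \<bar>g0 w\<bar>) ` {w. g0 w \<noteq> 0})"
    define B where "B = Max ?V"
    have fin: "finite ?V" using g0(1) by simp
    have B0: "0 \<le> B" unfolding B_def using fin by (intro Max_ge) auto
    have gB: "\<bar>g0 w\<bar> \<le> B" for w
    proof (cases "g0 w = 0")
      case False
      then show ?thesis unfolding B_def using fin by (intro Max_ge) auto
    qed (use B0 in simp)
    have EB: "\<bar>EE n m g0 z\<bar> \<le> B" for n m z
      using abs_EE_le[of n m g0 z] EE_mono[of n m z "\<lambda>w. \<bar>g0 w\<bar>" "\<lambda>_. B"] gB by (simp add: EE_const)
    have B_le: "ennreal B \<le> linfty_norm g"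
    proof -
      have "B \<in> ?V" unfolding B_def using fin by (intro Max_in) auto
      then show ?thesis unfolding g0(2) using linfty_norm_lift_ge by auto
    qed
    define c where "c = ennreal (1 / 4 ^ L)"
    define F where "F = (SUP N. ennreal (grid_sum p N (\<lambda>n m. EE n m f0)))"
    define S where "S = (SUP N. ennreal (grid_sum p N e))"
    have "S \<le> ennreal C0 * epowr (ennreal B) p * F"
      unfolding S_def
    proof (rule SUP_grid_sum_lim_le[OF p e(2)])
      fix N
      let ?f = "grid_sum p N (\<lambda>n m. EE n m f0)"
      have "ennreal (grid_sum p N (\<lambda>a b. EE a b (haar_sum N (haar_paraproduct g0 f0)))) \<le> ennreal (C0 * B powr p * ?f)"
        unfolding grid_sum_EE by (rule ennreal_leI[OF le[OF B0 EB]])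
      also have "\<dots> = ennreal C0 * epowr (ennreal B) p * ennreal ?f"
        using C0 B0 by (simp add: epowr_ennreal ennreal_mult)
      also have "\<dots> \<le> ennreal C0 * epowr (ennreal B) p * F"
        unfolding F_def by (intro mult_left_mono SUP_upper) auto
      finally show "ennreal (grid_sum p N (\<lambda>a b. EE a b (haar_sum N (haar_paraproduct g0 f0)))) \<le> ennreal C0 * epowr (ennreal B) p * F" .
    qed
    then have "epowr (c * S) (1 / p) \<le> epowr (c * (ennreal C0 * epowr (ennreal B) p * F)) (1 / p)"
      using p by (intro epowr_mono mult_left_mono) auto
    also have "\<dots> = epowr (ennreal C0) (1 / p) * ennreal B * epowr (c * F) (1 / p)"
      using p by (simp add: epowr_mult epowr_inverse mult_ac)
    also have "epowr (ennreal C0) (1 / p) = ennreal (C0 powr (1 / p))" using C0 by (simp add: epowr_ennreal)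
    also have "ennreal (C0 powr (1 / p)) * ennreal B * epowr (c * F) (1 / p) \<le>
        ennreal (C0 powr (1 / p)) * linfty_norm g * epowr (c * F) (1 / p)"
      by (intro mult_right_mono mult_left_mono B_le) auto
    finally show ?thesis
      using hardy_norm_eq_SUP[OF p e(1)] hardy_norm_eq_SUP[OF p has_averages_lift, of L f0]
      unfolding S_def F_def c_def f0(2) by simp
  qed
  then show ?thesis using C0 by (intro exI[of _ "C0 powr (1 / p)"]) auto
qed

section \<open>Lower bounds\<close>

lemma DD_haar_sum_if:
  assumes T: "haar_family N T"
  shows "DD n m (haar_sum N T) z = (if n < N \<and> m < N then T n m z else 0)"
proof (cases "n < N \<and> m < N")
  case False
  then have "EE a b (haar_sum N T) z = 0" if "n \<le> a" "m \<le> b" for a b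
    unfolding EE_haar_sum[OF T] using that by (intro sum.neutral ballI) auto
  then have "DD n m (haar_sum N T) z = 0" unfolding DD_eq_EE by simp
  then show ?thesis by (simp only: if_not_P[OF False])
qed (use DD_haar_sum[OF T] in auto)

text \<open>For a finite sum of Haar functions the averages of its paraproduct are reached after finitely
  many steps.\<close>

lemma pi2_averages_haar_sum:
  assumes T: "haar_family N T" and u: "finite {w. haar_sum N T w \<noteq> 0}" and g: "finite {w. g w \<noteq> 0}"
  shows "has_averages L (pi2 (lift L g) (lift L (haar_sum N T))) (\<lambda>a b. EE a b (haar_sum N (paraproduct g T)))"
proof -
  obtain e where e: "has_averages L (pi2 (lift L g) (lift L (haar_sum N T))) e"
    "\<And>a b w. (\<lambda>M. EE a b (haar_sum M (haar_paraproduct g (haar_sum N T))) w) \<longlonglongrightarrow> e a b w"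
    using pi2_averages[OF u g, of L] by blast
  have tot: "haar_sum M (haar_paraproduct g (haar_sum N T)) = haar_sum N (paraproduct g T)" if M: "N \<le> M" for M
  proof
    fix z
    have "haar_sum M (haar_paraproduct g (haar_sum N T)) z = (\<Sum>n<M. \<Sum>m<M. if n < N \<and> m < N then paraproduct g T n m z else 0)"
      unfolding haar_sum_def[of M] paraproduct_def DD_haar_sum_if[OF T] by (intro sum.cong refl) auto
    also have "\<dots> = (\<Sum>n<N. \<Sum>m<M. if n < N \<and> m < N then paraproduct g T n m z else 0)"
      using M by (intro sum.mono_neutral_right) auto
    also have "\<dots> = (\<Sum>n<N. \<Sum>m<N. paraproduct g T n m z)"
      using M by (intro sum.cong[OF refl] sum.mono_neutral_cong_right) auto
    finally show "haar_sum M (haar_paraproduct g (haar_sum N T)) z = haar_sum N (paraproduct g T) z" by (simp only: haar_sum_def)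
  qed
  have "e a b w = EE a b (haar_sum N (paraproduct g T)) w" for a b w
  proof (rule LIMSEQ_unique[OF e(2)])
    show "(\<lambda>M. EE a b (haar_sum M (haar_paraproduct g (haar_sum N T))) w) \<longlonglongrightarrow> EE a b (haar_sum N (paraproduct g T)) w"
      by (rule tendsto_eventually, rule eventually_mono[OF eventually_ge_at_top[of N]]) (simp only: tot)
  qed
  then have "e = (\<lambda>a b. EE a b (haar_sum N (paraproduct g T)))" by (intro ext)
  then show ?thesis using e(1) by simp
qed

text \<open>A single Haar function is mapped to its multiple by the average of \<open>g\<close> over its rectangle, which for a
  small square is a value of \<open>g\<close>.\<close>

theorem linfty_le_opnorm:
  assumes p: "0 < p" and g: "dyadic_simple g"
  shows "linfty_norm g \<le> hardy_opnorm p p (pi2 g)"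
proof -
  obtain L0 where "\<And>L. L0 \<le> L \<Longrightarrow> \<exists>h. finite {w. h w \<noteq> 0} \<and> g = lift L h \<and> EE 1 1 h = h"
    using dyadic_simple_imp_lift[OF g] by metis
  then obtain L g0 where g0: "finite {w. g0 w \<noteq> 0}" "g = lift L g0" "EE 1 1 g0 = g0" by blast
  have "ennreal \<bar>g0 w0\<bar> \<le> hardy_opnorm p p (pi2 g)" for w0
  proof -
    define T :: "nat \<Rightarrow> nat \<Rightarrow> int \<times> int \<Rightarrow> real"
      where "T n m z = ind (rect 1 1 w0) z * (rademacher n (fst z) * rademacher m (snd z))" for n m z
    define u where "u = T 0 0"
    have "MEAS 1 1 (ind (rect 1 1 w0))"
      unfolding MEAS_def X.meas_def Y.meas_def blk1_def blk2_def rect_def ind_def by auto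
    then have T: "haar_family 1 T"
      unfolding T_def[abs_def] by (intro haar_family_rademacher) auto
    have tot: "haar_sum 1 T = u" "haar_sum 1 (paraproduct g0 T) = (\<lambda>z. g0 w0 * u z)"
    proof -
      show "haar_sum 1 T = u" by (simp add: haar_sum_def[abs_def] u_def)
      have "g0 z * u z = g0 w0 * u z" for z
      proof (cases "z \<in> rect 1 1 w0")
        case True
        then have "EE 1 1 g0 z = EE 1 1 g0 w0" by (rule EE_const_on_rect)
        then show ?thesis unfolding g0(3) by simp
      qed (simp add: u_def T_def ind_def)
      then show "haar_sum 1 (paraproduct g0 T) = (\<lambda>z. g0 w0 * u z)"
        using g0(3) by (simp add: haar_sum_def[abs_def] paraproduct_def u_def fun_eq_iff)
    qed
    have fin: "finite {w. u w \<noteq> 0}"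
      by (rule finite_subset[OF _ finite_rect[of 1 1 w0]]) (auto simp: u_def T_def ind_def)
    have av: "has_averages L (pi2 g (lift L u)) (\<lambda>a b. EE a b (\<lambda>z. g0 w0 * u z))"
      using pi2_averages_haar_sum[OF T, of g0 L] fin g0 unfolding tot by simp
    have gs: "grid_sum p N (\<lambda>a b. EE a b (\<lambda>z. g0 w0 * u z)) = \<bar>g0 w0\<bar> powr p * grid_sum p N (\<lambda>a b. EE a b u)" for N
    proof -
      have "fmax N (\<lambda>a b. EE a b (\<lambda>z. g0 w0 * u z)) w = \<bar>g0 w0\<bar> * fmax N (\<lambda>a b. EE a b u) w" for w
      proof (rule antisym)
        show "fmax N (\<lambda>a b. EE a b (\<lambda>z. g0 w0 * u z)) w \<le> \<bar>g0 w0\<bar> * fmax N (\<lambda>a b. EE a b u) w"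
          unfolding EE_cmult
          by (rule fmax_le) (auto simp: abs_mult intro!: mult_left_mono fmax_ge[of _ N _ "\<lambda>a b. EE a b u" w])
        obtain a b where ab: "a \<le> N" "b \<le> N" "fmax N (\<lambda>a b. EE a b u) w = \<bar>EE a b u w\<bar>"
          using fmax_attained[of N "\<lambda>a b. EE a b u" w] by blast
        show "\<bar>g0 w0\<bar> * fmax N (\<lambda>a b. EE a b u) w \<le> fmax N (\<lambda>a b. EE a b (\<lambda>z. g0 w0 * u z)) w"
          unfolding ab(3) using fmax_ge[OF ab(1,2), of "\<lambda>a b. EE a b (\<lambda>z. g0 w0 * u z)" w] by (simp add: EE_cmult abs_mult)
      qed
      then show ?thesis unfolding grid_sum_def by (simp add: powr_mult fmax_nonneg sum_distrib_left)
    qed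
    have EEu: "EE a b u w = (if a = 0 \<and> b = 0 then u w else 0)" for a b w
      using EE_haar_family[OF T, of 0 0 a b w] by (simp add: u_def)
    have fu: "fmax N (\<lambda>a b. EE a b u) w = ind (rect 1 1 w0) w" for N w
    proof -
      have "\<bar>u w\<bar> = ind (rect 1 1 w0) w" by (auto simp: u_def T_def ind_def rademacher_def)
      then show ?thesis
        using fmax_ge[of 0 N 0 "\<lambda>a b. EE a b u" w] by (intro antisym fmax_le) (auto simp: EEu ind_def)
    qed
    define S where "S = (SUP N. ennreal (grid_sum p N (\<lambda>a b. EE a b u)))"
    have "grid_sum p N (\<lambda>a b. EE a b u) \<le> 4" for N
    proof -
      have "grid_sum p N (\<lambda>a b. EE a b u) = (\<Sum>w\<in>grid N. ind (rect 1 1 w0) w)"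
        unfolding grid_sum_def fu using p by (intro sum.cong) (auto simp: ind_def)
      also have "\<dots> \<le> card (rect 1 1 w0)" by (simp add: sum_ind card_mono)
      finally show ?thesis by (simp add: card_rect)
    qed
    then have "S \<le> ennreal 4" unfolding S_def by (intro SUP_least ennreal_leI)
    then have S1: "S < top" using ennreal_less_top[of 4] by (rule le_less_trans)
    obtain N0 where N0: "w0 \<in> grid N0" using grid_exhaust by blast
    have "1 \<le> grid_sum p N0 (\<lambda>a b. EE a b u)"
    proof -
      have "fmax N0 (\<lambda>a b. EE a b u) w0 powr p \<le> grid_sum p N0 (\<lambda>a b. EE a b u)"
        unfolding grid_sum_def using N0 by (intro member_le_sum) auto
      then show ?thesis unfolding fu by (simp add: ind_def rect_self)
    qed
    then have "ennreal 1 \<le> ennreal (grid_sum p N0 (\<lambda>a b. EE a b u))" by (rule ennreal_leI)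
    also have "\<dots> \<le> S" unfolding S_def by (rule SUP_upper) simp
    finally have S0: "0 < S" by (simp add: less_le_trans[OF zero_less_one])
    have f: "hardy_norm p (lift L u) = epowr (ennreal (1 / 4 ^ L) * S) (1 / p)"
      unfolding S_def by (rule hardy_norm_eq_SUP[OF p has_averages_lift])
    have fF: "hardy_norm p (pi2 g (lift L u)) = ennreal \<bar>g0 w0\<bar> * hardy_norm p (lift L u)"
    proof -
      have "hardy_norm p (pi2 g (lift L u)) = epowr (ennreal (1 / 4 ^ L) * (epowr (ennreal \<bar>g0 w0\<bar>) p * S)) (1 / p)"
        unfolding hardy_norm_eq_SUP[OF p av] gs S_def by (simp add: ennreal_mult epowr_ennreal SUP_mult_left_ennreal)
      also have "\<dots> = ennreal \<bar>g0 w0\<bar> * epowr (ennreal (1 / 4 ^ L) * S) (1 / p)"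
        using p by (simp add: epowr_mult epowr_inverse mult_ac)
      finally show ?thesis unfolding f .
    qed
    obtain s where s: "S = ennreal s" "0 < s" using S0 S1 by (cases S) auto
    have fin_f: "hardy_norm p (lift L u) = ennreal ((1 / 4 ^ L * s) powr (1 / p))"
      unfolding f s(1) using s(2) by (simp add: ennreal_mult[symmetric] epowr_ennreal)
    have pos: "0 < (1 / 4 ^ L * s) powr (1 / p)" using s(2) by simp
    have f0: "0 < hardy_norm p (lift L u)" "hardy_norm p (lift L u) < \<infinity>" unfolding fin_f using pos by auto
    have "hardy_norm p (pi2 g (lift L u)) / hardy_norm p (lift L u) \<le> hardy_opnorm p p (pi2 g)"
      unfolding hardy_opnorm_def using f0 dyadic_simple_lift[OF fin, of L] by (intro SUP_upper) simp
    moreover have "hardy_norm p (pi2 g (lift L u)) / hardy_norm p (lift L u) = ennreal \<bar>g0 w0\<bar>"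
      unfolding fF using f0 by (intro mult_divide_eq_ennreal) auto
    ultimately show ?thesis by simp
  qed
  then show ?thesis unfolding g0(2) by (intro linfty_norm_lift_le g0(1))
qed

text \<open>The family chosen for \<open>g\<close> on a grid is a test function. Its norm and that of its image give
  \<open>y\<^bsup>1/q\<^esup>\<close> at most the operator norm times \<open>y\<^bsup>1/p\<^esup>\<close>, up to constants, for the normalised sum \<open>y\<close> of the
  \<open>r\<close>-th powers of the maximal function of \<open>g\<close> over the grid; dividing leaves \<open>y\<^bsup>1/r\<^esup>\<close>. The grids exhaust the plane.\<close>

theorem hardy_le_opnorm:
  assumes p: "0 < p" "0 < q" "0 < r" "1 / q = 1 / p + 1 / r"
  shows "\<exists>C>0. \<forall>g. dyadic_simple g \<longrightarrow> hardy_norm r g \<le> ennreal C * hardy_opnorm p q (pi2 g)"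
proof -
  obtain C where C: "0 < C" and low: "\<And>N g. (\<forall>z\<in>grid N. \<exists>n m. 0 < n \<and> n \<le> N \<and> 0 < m \<and> m \<le> N \<and> MM N g z = \<bar>EE n m g z\<bar>) \<Longrightarrow>
    (\<exists>T. haar_family N T \<and>
      (\<Sum>z\<in>grid N. MM N (haar_sum N T) z powr p) \<le> C * (\<Sum>z\<in>grid N. MM N g z powr r) \<and>
      (\<Sum>z\<in>grid N. MM N g z powr r) \<le> C * (\<Sum>z\<in>grid N. MM N (haar_sum N (paraproduct g T)) z powr q))"
    using paraproduct_lower[OF p] by blast
  obtain C1 where up: "\<And>g f. dyadic_simple g \<Longrightarrow> dyadic_simple f \<Longrightarrow>
    hardy_norm q (pi2 g f) \<le> ennreal C1 * hardy_norm r g * hardy_norm p f"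
    using pi2_upper[OF p] by blast
  define C2 where "C2 = C powr (1 / q) * C powr (1 / p)"
  have "hardy_norm r g \<le> ennreal C2 * hardy_opnorm p q (pi2 g)" if simple: "dyadic_simple g" for g
  proof -
    define K where "K = hardy_opnorm p q (pi2 g)"
    obtain L0 where "\<And>L. L0 \<le> L \<Longrightarrow> \<exists>h. finite {w. h w \<noteq> 0} \<and> g = lift L h \<and> EE 1 1 h = h"
      using dyadic_simple_imp_lift[OF simple] by metis
    then obtain L g0 where g0: "finite {w. g0 w \<noteq> 0}" "g = lift L g0" "EE 1 1 g0 = g0" by blast
    define c where "c = (1 / 4 ^ L :: real)"
    have c: "0 < c" by (simp add: c_def)
    define W where "W N = grid_sum r N (\<lambda>n m. EE n m g0)" for N
    have bound: "epowr (ennreal (c * W N)) (1 / r) \<le> ennreal C2 * K" if N: "1 \<le> N" for N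
    proof (cases "W N = 0")
      case False
      then have W0: "0 < W N" unfolding W_def using grid_sum_nonneg[of r N "\<lambda>n m. EE n m g0"] by (simp only: less_le) simp
      have max: "\<exists>n m. 0 < n \<and> n \<le> N \<and> 0 < m \<and> m \<le> N \<and> MM N g0 z = \<bar>EE n m g0 z\<bar>" for z
      proof -
        obtain a b where ab: "a \<le> N" "b \<le> N" "MM N g0 z = \<bar>EE a b g0 z\<bar>"
          using fmax_attained[of N "\<lambda>n m. EE n m g0" z] unfolding MM_def by blast
        have "EE a b g0 = EE (max a 1) (max b 1) g0" using EE_EE[of a b 1 1 g0] unfolding g0(3) .
        then have "MM N g0 z = \<bar>EE (max a 1) (max b 1) g0 z\<bar>" using ab(3) by simp
        moreover have "0 < max a 1" "max a 1 \<le> N" "0 < max b 1" "max b 1 \<le> N" using ab N by auto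
        ultimately show ?thesis by blast
      qed
      obtain T where T: "haar_family N T"
        "(\<Sum>z\<in>grid N. MM N (haar_sum N T) z powr p) \<le> C * W N"
        "W N \<le> C * (\<Sum>z\<in>grid N. MM N (haar_sum N (paraproduct g0 T)) z powr q)"
        using low[of N g0] max unfolding W_def grid_sum_EE by blast
      \<comment> \<open>Only the values on the grid are controlled, so the test function is cut off to it; the cut-off is
        measurable for all levels in use.\<close>
      define T' where "T' n m z = ind (grid N) z * T n m z" for n m z
      define u where "u = haar_sum N T'"
      have grid_meas: "MEAS (Suc n) (Suc m) (ind (grid N))" if "n < N" "m < N" for n m
      proof -
        have "X.meas N (ind (grid N))" "Y.meas N (ind (grid N))"
          unfolding X.meas_def Y.meas_def blk1_def blk2_def ind_def by (auto simp: mem_grid_iff)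
        then show ?thesis unfolding MEAS_def using that X.meas_mono[of N _ "Suc n"] Y.meas_mono[of N _ "Suc m"] by auto
      qed
      have T': "haar_family N T'"
        unfolding T'_def[abs_def] by (intro haar_family_mult T grid_meas)
      have out: "EE a b (haar_sum N (paraproduct h T')) z = 0" "EE a b u z = 0" if "z \<notin> grid N" for a b z h
        unfolding u_def EE_haar_sum[OF T'] EE_haar_sum[OF haar_family_paraproduct[OF T']]
        using that by (auto intro!: sum.neutral simp: T'_def paraproduct_def ind_def)
      have inside: "EE a b (haar_sum N (paraproduct h T')) z = EE a b (haar_sum N (paraproduct h T)) z"
        "EE a b u z = EE a b (haar_sum N T) z" if "z \<in> grid N" for a b z h
        unfolding u_def EE_haar_sum[OF T'] EE_haar_sum[OF T(1)] EE_haar_sum[OF haar_family_paraproduct[OF T']]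
          EE_haar_sum[OF haar_family_paraproduct[OF T(1)]]
        using that by (auto intro!: sum.cong simp: T'_def paraproduct_def ind_def)
      have fin: "finite {w. u w \<noteq> 0}"
        using out(2)[of _ 0 0] by (intro finite_subset[OF _ finite_grid[of N]]) auto
      have u_sum: "grid_sum p M (\<lambda>a b. EE a b u) \<le> C * W N" for M
      proof -
        have "fmax M (\<lambda>a b. EE a b u) w \<le> (if w \<in> grid N then MM N (haar_sum N T) w else 0)" for w
        proof (rule fmax_le)
          fix a b
          show "\<bar>EE a b u w\<bar> \<le> (if w \<in> grid N then MM N (haar_sum N T) w else 0)"
          proof (cases "w \<in> grid N")
            case w: True
            show ?thesis
            proof (cases "a \<le> N \<and> b \<le> N")
              case True
              then show ?thesis using w MM_ge[of a N b "haar_sum N T" w] by (simp add: inside(2)[OF w])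
            next
              case False
              then have "EE a b u w = 0"
                unfolding inside(2)[OF w] EE_haar_sum[OF T(1)] by (auto intro!: sum.neutral)
              then show ?thesis using w by simp
            qed
          qed (simp add: out)
        qed
        then have "grid_sum p M (\<lambda>a b. EE a b u) \<le> (\<Sum>w\<in>grid M. (if w \<in> grid N then MM N (haar_sum N T) w else 0) powr p)"
          unfolding grid_sum_def using p(1) by (intro sum_mono powr_mono2 fmax_nonneg) auto
        also have "\<dots> \<le> (\<Sum>w\<in>grid M \<union> grid N. (if w \<in> grid N then MM N (haar_sum N T) w else 0) powr p)"
          by (intro sum_mono2) auto
        also have "\<dots> = (\<Sum>w\<in>grid N. MM N (haar_sum N T) w powr p)"
          by (intro sum.mono_neutral_cong_right) auto
        finally show ?thesis using T(2) by linarith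
      qed
      define f where "f = lift L u"
      have f_simple: "dyadic_simple f" unfolding f_def by (rule dyadic_simple_lift[OF fin])
      have f_le: "hardy_norm p f \<le> ennreal ((c * (C * W N)) powr (1 / p))"
      proof -
        have "(SUP M. ennreal (grid_sum p M (\<lambda>a b. EE a b u))) \<le> ennreal (C * W N)"
          by (intro SUP_least ennreal_leI u_sum)
        then have "hardy_norm p f \<le> epowr (ennreal c * ennreal (C * W N)) (1 / p)"
          unfolding f_def hardy_norm_eq_SUP[OF p(1) has_averages_lift] c_def using p(1) by (intro epowr_mono mult_left_mono) auto
        also have "\<dots> = ennreal ((c * (C * W N)) powr (1 / p))"
          using c C W0 by (simp add: ennreal_mult[symmetric] epowr_ennreal)
        finally show ?thesis .
      qed
      have F_ge: "ennreal ((c * (W N / C)) powr (1 / q)) \<le> hardy_norm q (pi2 g f)"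
      proof -
        have av: "has_averages L (pi2 g f) (\<lambda>a b. EE a b (haar_sum N (paraproduct g0 T')))"
          unfolding g0(2) f_def u_def using pi2_averages_haar_sum[OF T' _ g0(1)] fin unfolding u_def by blast
        have "grid_sum q N (\<lambda>a b. EE a b (haar_sum N (paraproduct g0 T'))) = (\<Sum>z\<in>grid N. MM N (haar_sum N (paraproduct g0 T)) z powr q)"
          unfolding grid_sum_def MM_def fmax_def by (intro sum.cong refl) (simp add: inside)
        then have "W N / C \<le> grid_sum q N (\<lambda>a b. EE a b (haar_sum N (paraproduct g0 T')))"
          using T(3) C by (simp add: pos_divide_le_eq mult.commute)
        then have "ennreal (W N / C) \<le> (SUP M. ennreal (grid_sum q M (\<lambda>a b. EE a b (haar_sum N (paraproduct g0 T')))))"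
          by (intro SUP_upper2[of N] ennreal_leI) auto
        then have "epowr (ennreal c * ennreal (W N / C)) (1 / q) \<le> hardy_norm q (pi2 g f)"
          unfolding hardy_norm_eq_SUP[OF p(2) av] c_def using p(2) by (intro epowr_mono mult_left_mono) auto
        moreover have "epowr (ennreal c * ennreal (W N / C)) (1 / q) = ennreal ((c * (W N / C)) powr (1 / q))"
          using c C W0 by (simp add: ennreal_mult[symmetric] epowr_ennreal)
        ultimately show ?thesis by simp
      qed
      have "hardy_norm q (pi2 g f) \<le> K * hardy_norm p f"
      proof (cases "hardy_norm p f = 0")
        case True
        then show ?thesis using up[OF simple f_simple] by simp
      next
        case False
        have "hardy_norm p f < \<infinity>" using f_le ennreal_less_top by (metis infinity_ennreal_def le_less_trans)
        then show ?thesis unfolding K_def using False by (intro le_hardy_opnorm f_simple) (auto simp: zero_less_iff_neq_zero)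
      qed
      also have "\<dots> \<le> K * ennreal ((c * (C * W N)) powr (1 / p))" by (intro mult_left_mono f_le) simp
      finally have main: "ennreal ((c * (W N / C)) powr (1 / q)) \<le> K * ennreal ((c * (C * W N)) powr (1 / p))"
        using F_ge by (rule order_trans[rotated])
      show ?thesis
      proof (cases K)
        case (real k)
        have "(c * (W N / C)) powr (1 / q) \<le> k * (c * (C * W N)) powr (1 / p)"
          using main real by (simp add: ennreal_mult[symmetric])
        define y where "y = c * W N"
        have y: "0 < y" using c W0 by (simp add: y_def)
        have "(y / C) powr (1 / q) \<le> k * (C * y) powr (1 / p)"
          using \<open>(c * (W N / C)) powr (1 / q) \<le> k * (c * (C * W N)) powr (1 / p)\<close> by (simp add: y_def mult_ac)
        then have "y powr (1 / q) \<le> k * (C powr (1 / p) * y powr (1 / p)) * C powr (1 / q)"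
          using y C by (simp add: powr_divide powr_mult pos_divide_le_eq)
        moreover have "y powr (1 / q) = y powr (1 / r) * y powr (1 / p)"
          unfolding powr_add[symmetric] p(4) by (simp only: add.commute)
        ultimately have "y powr (1 / r) * y powr (1 / p) \<le> (C2 * k) * y powr (1 / p)"
          unfolding C2_def by (simp only: mult_ac)
        then have "y powr (1 / r) \<le> C2 * k" using y by simp
        then show ?thesis
          using real C y by (simp add: y_def epowr_ennreal ennreal_mult[symmetric] C2_def ennreal_leI)
      next
        case top
        have "0 < C2" using C by (simp add: C2_def)
        then show ?thesis using top by simp
      qed
    qed (use p(3) in \<open>simp add: epowr_def\<close>)
    have "epowr (ennreal c * (SUP N. ennreal (W N))) (1 / r) = (SUP N. epowr (ennreal (c * W N)) (1 / r))"
      using p(3) c by (simp add: SUP_mult_left_ennreal epowr_SUP ennreal_mult W_def)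
    also have "\<dots> \<le> ennreal C2 * K"
    proof (rule SUP_least)
      fix N
      have "W N \<le> W (max N 1)" unfolding W_def using p(3) by (intro grid_sum_mono) auto
      then have "epowr (ennreal (c * W N)) (1 / r) \<le> epowr (ennreal (c * W (max N 1))) (1 / r)"
        using p(3) c by (intro epowr_mono ennreal_leI mult_left_mono) auto
      then show "epowr (ennreal (c * W N)) (1 / r) \<le> ennreal C2 * K" using bound[of "max N 1"] by simp
    qed
    finally show ?thesis
      unfolding K_def g0(2) hardy_norm_eq_SUP[OF p(3) has_averages_lift] W_def c_def .
  qed
  moreover have "0 < C2" using C by (simp add: C2_def)
  ultimately show ?thesis by blast
qed

theorem theorem2p1:
  shows "(\<forall>p::real. 0 < p \<longrightarrow>
           (\<exists>C::real. 1 \<le> C \<and>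
             (\<forall>g. dyadic_simple g \<longrightarrow>
                ennreal (1 / C) * linfty_norm g \<le> hardy_opnorm p p (pi2 g) \<and>
                hardy_opnorm p p (pi2 g) \<le> ennreal C * linfty_norm g))) \<and>
         (\<forall>(p::real) (q::real) (r::real).
           0 < p \<and> 0 < q \<and> 0 < r \<and> 1 / q = 1 / p + 1 / r \<longrightarrow>
           (\<exists>C::real. 1 \<le> C \<and>
             (\<forall>g. dyadic_simple g \<longrightarrow>
                ennreal (1 / C) * hardy_norm r g \<le> hardy_opnorm p q (pi2 g) \<and>
                hardy_opnorm p q (pi2 g) \<le> ennreal C * hardy_norm r g)))"
proof -
  have combine: "\<exists>C::real. 1 \<le> C \<and> (\<forall>g. dyadic_simple g \<longrightarrow> ennreal (1 / C) * A g \<le> B g \<and> B g \<le> ennreal C * A g)"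
    if "0 < C1" "\<And>g. dyadic_simple g \<Longrightarrow> A g \<le> ennreal C1 * B g" "\<And>g. dyadic_simple g \<Longrightarrow> B g \<le> ennreal C2 * A g"
    for C1 C2 :: real and A B :: "(real \<times> real \<Rightarrow> real) \<Rightarrow> ennreal"
  proof (intro exI[of _ "max 1 (max C1 C2)"] conjI allI impI)
    let ?C = "max 1 (max C1 C2)"
    show "1 \<le> ?C" by simp
    fix g assume g: "dyadic_simple g"
    have "ennreal (1 / ?C) * A g \<le> ennreal (1 / ?C) * (ennreal ?C * B g)"
      by (intro mult_left_mono order_trans[OF that(2)[OF g]] mult_right_mono ennreal_leI) auto
    also have "\<dots> = B g" by (simp add: mult.assoc[symmetric] ennreal_mult[symmetric])
    finally show "ennreal (1 / ?C) * A g \<le> B g" .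
    show "B g \<le> ennreal ?C * A g"
      by (intro order_trans[OF that(3)[OF g]] mult_right_mono ennreal_leI) auto
  qed
  show ?thesis
  proof (intro conjI allI impI)
    fix p :: real assume p: "0 < p"
    obtain C where C: "\<And>g f. dyadic_simple g \<Longrightarrow> dyadic_simple f \<Longrightarrow>
        hardy_norm p (pi2 g f) \<le> ennreal C * linfty_norm g * hardy_norm p f"
      using pi2_upper_bounded[OF p] by blast
    show "\<exists>C::real. 1 \<le> C \<and> (\<forall>g. dyadic_simple g \<longrightarrow>
        ennreal (1 / C) * linfty_norm g \<le> hardy_opnorm p p (pi2 g) \<and>
        hardy_opnorm p p (pi2 g) \<le> ennreal C * linfty_norm g)"
    proof (rule combine[of 1 linfty_norm "\<lambda>g. hardy_opnorm p p (pi2 g)" C])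
      show "linfty_norm g \<le> ennreal 1 * hardy_opnorm p p (pi2 g)" if "dyadic_simple g" for g
        using linfty_le_opnorm[OF p that] by simp
      show "hardy_opnorm p p (pi2 g) \<le> ennreal C * linfty_norm g" if "dyadic_simple g" for g
        by (rule hardy_opnorm_le) (rule C[OF that])
    qed simp
  next
    fix p q r :: real assume "0 < p \<and> 0 < q \<and> 0 < r \<and> 1 / q = 1 / p + 1 / r"
    then have p: "0 < p" "0 < q" "0 < r" "1 / q = 1 / p + 1 / r" by blast+
    obtain C1 where C1: "0 < C1" "\<And>g. dyadic_simple g \<Longrightarrow> hardy_norm r g \<le> ennreal C1 * hardy_opnorm p q (pi2 g)"
      using hardy_le_opnorm[OF p] by blast
    obtain C where C: "\<And>g f. dyadic_simple g \<Longrightarrow> dyadic_simple f \<Longrightarrow>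
        hardy_norm q (pi2 g f) \<le> ennreal C * hardy_norm r g * hardy_norm p f"
      using pi2_upper[OF p] by blast
    show "\<exists>C::real. 1 \<le> C \<and> (\<forall>g. dyadic_simple g \<longrightarrow>
        ennreal (1 / C) * hardy_norm r g \<le> hardy_opnorm p q (pi2 g) \<and>
        hardy_opnorm p q (pi2 g) \<le> ennreal C * hardy_norm r g)"
    proof (rule combine[of C1 "hardy_norm r" "\<lambda>g. hardy_opnorm p q (pi2 g)" C])
      show "hardy_opnorm p q (pi2 g) \<le> ennreal C * hardy_norm r g" if "dyadic_simple g" for g
        by (rule hardy_opnorm_le) (rule C[OF that])
    qed (use C1 in auto)
  qed
qed

end
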